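(* Let $T>0$, $1\le p\le\infty$, and let $f:[0,T]\times[0,+\infty)\times\mathbb{R}\to\mathbb{R}$ be an $L^p$-Carathéodory function satisfying the conditions $(f_1)$, $(f_2)$, $(f_3)$ listed in the context. Suppose that there exist two constants $r,R>0$, with $r\neq R$, such that the following hypotheses hold. $(H_r)$ The inequality $$\int_0^T f(t,at,a)\,dt<0,\qquad \text{for } a=\frac{r}{T},$$ holds. Moreover, for every $\vartheta$ with $0<\vartheta\le 1$, any solution $u$ of the problem $$u''+\vartheta f(t,u,u')=0,\quad 0<t<T,\qquad u'(0)=u'(T),\quad u(0)=0,$$ such that $u(t)>0$ for all $t\in(0,T]$, satisfies $\|u\|_\infty\neq r$. $(H_R)$ There exist a non-negative function $v\in L^p([0,T],\mathbb{R})$ with $v\not\equiv0$ and a constant $\alpha_0>0$ such that, for every $\alpha\in[0,\alpha_0]$, every solution $u\ge 0$ of the problem $$u''+f(t,u,u')+\alpha v(t)=0,\quad 0<t<T,\qquad u'(0)=u'(T),\quad u(0)=0,$$ satisfies $\|u\|_\infty\neq R$. Moreover, for $\alpha=\alpha_0$ this problem has no solution $u$ with $0\le u(t)\le R$ for all $t\in[0,T]$. Then the problem $$u''+f(t,u,u')=0,\quad 0<t<T,\qquad u'(0)=u'(T),\quad u(0)=0,$$ has at least one positive solution $u$ (that is, a solution with $u(t)>0$ for all $t\in(0,T]$) such that $$\min\{r,R\}<\max_{t\in[0,T]}u(t)<\max\{r,R\}.$$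
   Context: Solutions: a solution of any of the boundary value problems is a function $u:[0,T]\to\mathbb{R}$ of class $C^1$ such that $u'$ is absolutely continuous, $u$ satisfies the differential equation for almost every $t\in[0,T]$, and $u$ satisfies the boundary conditions. $\|u\|_\infty=\max_{t\in[0,T]}|u(t)|$. Since the boundary conditions force $u(0)=0$, "positive solution" here means $u(t)>0$ for all $t\in(0,T]$. $L^p$-Carathéodory (standard meaning): $f(\cdot,s,\xi)$ is measurable for all $(s,\xi)$, $f(t,\cdot,\cdot)$ is continuous for almost every $t$, and for every $c>0$ there is $g_c\in L^p([0,T])$ with $|f(t,s,\xi)|\le g_c(t)$ for almost every $t$ and all $(s,\xi)$ in the domain with $|s|\le c$, $|\xi|\le c$. Conditions on $f$: $(f_1)$ $f(t,0,\xi)=0$ for almost every $t\in[0,T]$ and every $\xi\in\mathbb{R}$. $(f_2)$ There exist a non-negative function $k\in L^1([0,T])$ and a constant $\rho>0$ such that $|f(t,s,\xi)|\le k(t)(|s|+|\xi|)$ for almost every $t\in[0,T]$, every $0\le s\le\rho$ and every $|\xi|\le\rho$. $(f_3)$ (Bernstein–Nagumo type condition) For each $\eta>0$ there exist a continuous function $\phi=\phi_\eta:[0,+\infty)\to[0,+\infty)$ with $\int^{\infty}\frac{\xi^{(p-1)/p}}{\phi(\xi)}\,d\xi=\infty$ and $\liminf_{\xi\to+\infty}\phi(\xi)>0$, and a function $\psi=\psi_\eta\in L^p([0,T],[0,+\infty))$ such that $|f(t,s,\xi)|\le\psi(t)\phi(|\xi|)$ for almost every $t\in[0,T]$, all $s\in[0,\eta]$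 and all $\xi\in\mathbb{R}$. (Here $(p-1)/p$ is read as $1$ if $p=\infty$, and $\int^\infty$ denotes the integral over a neighbourhood of $+\infty$.) *)

theory Defs
  imports "HOL-Analysis.Analysis"
begin

text \<open>
  Functions on \<open>[0,T]\<close> are total functions on the reals of which only the values on
  \<open>{0..T}\<close> matter; likewise only the values \<open>f t s \<xi>\<close> with \<open>t \<in> {0..T}\<close> and \<open>s \<ge> 0\<close>
  are ever constrained or used.
  Elements of \<open>L\<^sup>p\<close> are represented by measurable functions, so sign conditions and
  non-vanishing of such functions are understood almost everywhere.
\<close>

definition Lp_fun :: "ennreal \<Rightarrow> real \<Rightarrow> (real \<Rightarrow> real) \<Rightarrow> bool" where
  "Lp_fun p T g \<longleftrightarrow>
     g \<in> borel_measurable (lebesgue_on {0..T}) \<and>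
     (if p = \<infinity> then \<exists>C. AE t in lebesgue_on {0..T}. \<bar>g t\<bar> \<le> C
      else integrable (lebesgue_on {0..T}) (\<lambda>t. \<bar>g t\<bar> powr enn2real p))"

definition nonneg_ae :: "real \<Rightarrow> (real \<Rightarrow> real) \<Rightarrow> bool" where
  "nonneg_ae T g \<longleftrightarrow> (AE t in lebesgue_on {0..T}. 0 \<le> g t)"

definition Lp_Caratheodory :: "ennreal \<Rightarrow> real \<Rightarrow> (real \<Rightarrow> real \<Rightarrow> real \<Rightarrow> real) \<Rightarrow> bool" where
  "Lp_Caratheodory p T f \<longleftrightarrow>
     (\<forall>s\<ge>0. \<forall>\<xi>. (\<lambda>t. f t s \<xi>) \<in> borel_measurable (lebesgue_on {0..T})) \<and>
     (AE t in lebesgue_on {0..T}. continuous_on ({0..} \<times> UNIV) (\<lambda>(s, \<xi>). f t s \<xi>)) \<and>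
     (\<forall>c>0. \<exists>g. Lp_fun p T g \<and>
        (AE t in lebesgue_on {0..T}. \<forall>s \<xi>. 0 \<le> s \<and> \<bar>s\<bar> \<le> c \<and> \<bar>\<xi>\<bar> \<le> c \<longrightarrow> \<bar>f t s \<xi>\<bar> \<le> g t))"

definition cond_f1 :: "real \<Rightarrow> (real \<Rightarrow> real \<Rightarrow> real \<Rightarrow> real) \<Rightarrow> bool" where
  "cond_f1 T f \<longleftrightarrow> (AE t in lebesgue_on {0..T}. \<forall>\<xi>. f t 0 \<xi> = 0)"

definition cond_f2 :: "real \<Rightarrow> (real \<Rightarrow> real \<Rightarrow> real \<Rightarrow> real) \<Rightarrow> bool" where
  "cond_f2 T f \<longleftrightarrow>
     (\<exists>k \<rho>. Lp_fun 1 T k \<and> nonneg_ae T k \<and> \<rho> > 0 \<and>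
        (AE t in lebesgue_on {0..T}. \<forall>s \<xi>. 0 \<le> s \<and> s \<le> \<rho> \<and> \<bar>\<xi>\<bar> \<le> \<rho> \<longrightarrow>
            \<bar>f t s \<xi>\<bar> \<le> k t * (\<bar>s\<bar> + \<bar>\<xi>\<bar>)))"

definition Nagumo_exponent :: "ennreal \<Rightarrow> real" where
  "Nagumo_exponent p = (if p = \<infinity> then 1 else (enn2real p - 1) / enn2real p)"

text \<open>
  The divergence of the integral at infinity is stated for all sufficiently large lower
  limits \<open>M\<close>: as the inferior limit of \<open>\<phi>\<close> is positive, \<open>\<phi>\<close> has no zero in
  \<open>{M..}\<close> for large \<open>M\<close>, and the divergence does not depend on such an \<open>M\<close>.
\<close>

definition cond_f3 :: "ennreal \<Rightarrow> real \<Rightarrow> (real \<Rightarrow> real \<Rightarrow> real \<Rightarrow> real) \<Rightarrow> bool" where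
  "cond_f3 p T f \<longleftrightarrow>
     (\<forall>\<eta>>0. \<exists>\<phi> \<psi>.
        continuous_on {0..} \<phi> \<and> (\<forall>\<xi>\<ge>0. 0 \<le> \<phi> \<xi>) \<and>
        (\<forall>\<^sub>F M in at_top.
           (\<integral>\<^sup>+\<xi>\<in>{M..}. ennreal (\<xi> powr Nagumo_exponent p / \<phi> \<xi>) \<partial>lborel) = \<infinity>) \<and>
        Liminf at_top (\<lambda>\<xi>. ereal (\<phi> \<xi>)) > 0 \<and>
        Lp_fun p T \<psi> \<and> nonneg_ae T \<psi> \<and>
        (AE t in lebesgue_on {0..T}. \<forall>s \<xi>. 0 \<le> s \<and> s \<le> \<eta> \<longrightarrow>
            \<bar>f t s \<xi>\<bar> \<le> \<psi> t * \<phi> \<bar>\<xi>\<bar>))"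

text \<open>
  The \<open>\<epsilon>\<close>-\<open>\<delta>\<close> definition of absolute continuity; a finite family of non-overlapping
  compact subintervals is a \<open>division_of\<close> its union.
\<close>

definition absolutely_continuous_fun_on :: "real \<Rightarrow> real \<Rightarrow> (real \<Rightarrow> real) \<Rightarrow> bool" where
  "absolutely_continuous_fun_on a b g \<longleftrightarrow>
     (\<forall>\<epsilon>>0. \<exists>\<delta>>0. \<forall>\<D> S. \<D> division_of S \<and> S \<subseteq> {a..b} \<and> (\<Sum>I\<in>\<D>. Sup I - Inf I) < \<delta> \<longrightarrow>
        (\<Sum>I\<in>\<D>. \<bar>g (Sup I) - g (Inf I)\<bar>) < \<epsilon>)"

text \<open>
  \<open>u\<close> solves \<open>u'' + F(t, u, u') = 0\<close> on \<open>[0,T]\<close> with \<open>u'(0) = u'(T)\<close>, \<open>u(0) = 0\<close>.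
  The derivatives at the end points are one-sided.
\<close>

definition is_solution :: "real \<Rightarrow> (real \<Rightarrow> real \<Rightarrow> real \<Rightarrow> real) \<Rightarrow> (real \<Rightarrow> real) \<Rightarrow> bool" where
  "is_solution T F u \<longleftrightarrow>
     (\<exists>u'. (\<forall>t\<in>{0..T}. (u has_real_derivative u' t) (at t within {0..T})) \<and>
           continuous_on {0..T} u' \<and>
           absolutely_continuous_fun_on 0 T u' \<and>
           (AE t in lebesgue_on {0..T}. \<exists>u''. (u' has_real_derivative u'') (at t within {0..T}) \<and>
               u'' + F t (u t) (u' t) = 0) \<and>
           u' 0 = u' T \<and> u 0 = 0)"

text \<open>For continuous \<open>u\<close> the supremum is attained, hence it is the maximum.\<close>

definition max_norm :: "real \<Rightarrow> (real \<Rightarrow> real) \<Rightarrow> real" where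
  "max_norm T u = (SUP t\<in>{0..T}. \<bar>u t\<bar>)"

definition hyp_r :: "real \<Rightarrow> (real \<Rightarrow> real \<Rightarrow> real \<Rightarrow> real) \<Rightarrow> real \<Rightarrow> bool" where
  "hyp_r T f r \<longleftrightarrow>
     (let a = r / T in (LINT t|lebesgue_on {0..T}. f t (a * t) a) < 0) \<and>
     (\<forall>\<theta> u. 0 < \<theta> \<and> \<theta> \<le> 1 \<and> is_solution T (\<lambda>t s \<xi>. \<theta> * f t s \<xi>) u \<and> (\<forall>t\<in>{0<..T}. u t > 0)
        \<longrightarrow> max_norm T u \<noteq> r)"

definition hyp_R :: "ennreal \<Rightarrow> real \<Rightarrow> (real \<Rightarrow> real \<Rightarrow> real \<Rightarrow> real) \<Rightarrow> real \<Rightarrow> bool" where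
  "hyp_R p T f R \<longleftrightarrow>
     (\<exists>v \<alpha>\<^sub>0. Lp_fun p T v \<and> nonneg_ae T v \<and> \<not> (AE t in lebesgue_on {0..T}. v t = 0) \<and> \<alpha>\<^sub>0 > 0 \<and>
        (\<forall>\<alpha>\<in>{0..\<alpha>\<^sub>0}. \<forall>u. is_solution T (\<lambda>t s \<xi>. f t s \<xi> + \<alpha> * v t) u \<and> (\<forall>t\<in>{0..T}. 0 \<le> u t)
            \<longrightarrow> max_norm T u \<noteq> R) \<and>
        \<not> (\<exists>u. is_solution T (\<lambda>t s \<xi>. f t s \<xi> + \<alpha>\<^sub>0 * v t) u \<and> (\<forall>t\<in>{0..T}. 0 \<le> u t \<and> u t \<le> R)))"

end

theory Submission
  imports Defs "HOL-Complex_Analysis.Great_Picard"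
begin

text \<open>
  Since \<open>u(0) = 0\<close>, the only free initial value is the slope \<open>a = u'(0)\<close>. Truncate \<open>f\<close> beyond the a
  priori bounds (\<open>max r R\<close> for \<open>u\<close>, the Nagumo bound for \<open>u'\<close>) and extend it to negative \<open>s\<close> by a
  positive function. A semi-implicit Euler scheme with \<open>n\<close> steps then determines a discrete solution
  from \<open>a\<close>, and the condition \<open>u'(0) = u'(T)\<close> becomes one scalar equation \<open>P = 0\<close> that depends
  continuously on \<open>a\<close> and on the homotopy parameters \<open>\<theta>\<close> and \<open>\<alpha>\<close>. This reduces the degree argument
  (degree \<open>1\<close> on the ball of radius \<open>r\<close>, degree \<open>0\<close> on the ball of radius \<open>R\<close>) to a continuation
  statement in the plane that follows from Brouwer's fixed point theorem: for every \<open>n\<close> there is a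
  discrete solution with norm between \<open>r\<close> and \<open>R\<close>, or one that violates a discrete form of \<open>(H\<^sub>r)\<close> or
  \<open>(H\<^sub>R)\<close>. By Arzela-Ascoli and dominated convergence the alternative passes to the limit
  \<open>n \<rightarrow> \<infinity>\<close>, where the hypotheses leave only the desired solution; \<open>(f\<^sub>1)\<close>, \<open>(f\<^sub>2)\<close> and a Gronwall
  argument make it positive.
\<close>

subsection \<open>Absolute continuity and Lebesgue differentiation\<close>

text \<open>Both orders of \<open>r\<close> and \<open>R\<close> are treated at once. In the strip
  of pairs (slope, homotopy parameter) the zeros are cut at norm \<open>r\<close> below the
  parameter value 1, which stands for the given problem, and at norm \<open>R\<close> above it. At
  the value 1 both cuts are in force, so a zero on both sides there has norm between
  \<open>min r R\<close> and \<open>max r R\<close>: it is the solution sought. Elsewhere a zero on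
  both sides has norm exactly \<open>r\<close> or \<open>R\<close>. When \<alpha> = 0 the trivial
  solution gives a zero at slope 0 for every \<theta>. It stays on the inner side of the cut, and
  the positive sign of \<open>P\<close> at negative slopes comes from the extension of
  \<open>f\<close> to negative \<open>s\<close>. At \<theta> = 0 the candidates are the lines
  \<open>a * t\<close>, and only the sign of the integral at the slope \<open>r / T\<close> is
  known. A further deformation therefore has to remove the zeros with larger slope. The hypotheses
  speak of genuine solutions, not of discrete ones. Hence the discrete statement is a disjunction of
  closed conditions, and the hypotheses, as well as the strict inequalities, enter only after the
  limit.\<close>

lemma AE_lebesgue_on_negligible:
  fixes S :: "real set"
  assumes "S \<in> sets lebesgue"
  shows "(AE t in lebesgue_on S. P t) \<longleftrightarrow> (\<exists>N. negligible N \<and> (\<forall>t\<in>S - N. P t))"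
proof
  assume "AE t in lebesgue_on S. P t"
  then have "AE t in lebesgue. t \<in> S \<longrightarrow> P t"
    using assms by (simp add: AE_restrict_space_iff)
  then obtain N where "N \<in> null_sets lebesgue" "{t. \<not> (t \<in> S \<longrightarrow> P t)} \<subseteq> N"
    unfolding eventually_ae_filter by auto
  then show "\<exists>N. negligible N \<and> (\<forall>t\<in>S - N. P t)"
    by (intro exI[of _ N]) (auto simp: negligible_iff_null_sets)
next
  assume "\<exists>N. negligible N \<and> (\<forall>t\<in>S - N. P t)"
  then obtain N where "N \<in> null_sets lebesgue" "\<forall>t\<in>S - N. P t"
    by (auto simp: negligible_iff_null_sets)
  then have "AE t in lebesgue. t \<in> S \<longrightarrow> P t"
    unfolding eventually_ae_filter by (intro bexI[of _ N]) auto
  then show "AE t in lebesgue_on S. P t"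
    using assms by (simp add: AE_restrict_space_iff)
qed

text \<open>Cutting \<open>e\<close> at a height \<open>k\<close> splits its integral. The part
  below \<open>k\<close> contributes at most \<open>k\<close> times the total length of the
  intervals, and the excess over \<open>k\<close> has a small integral on all of
  \<open>{a..b}\<close> by dominated convergence. The length bound uses \<open>k + 1\<close> because
  \<open>k\<close> may be 0.\<close>

lemma absolutely_continuous_fun_on_integral_bound:
  fixes w e :: "real \<Rightarrow> real"
  assumes e: "e integrable_on {a..b}" and nn: "\<And>t. t \<in> {a..b} \<Longrightarrow> 0 \<le> e t"
    and w: "\<And>s t. a \<le> s \<Longrightarrow> s \<le> t \<Longrightarrow> t \<le> b \<Longrightarrow> \<bar>w t - w s\<bar> \<le> integral {s..t} e"
  shows "absolutely_continuous_fun_on a b w"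
  unfolding absolutely_continuous_fun_on_def
proof (intro allI impI)
  fix \<epsilon> :: real assume "\<epsilon> > 0"
  have ae: "e absolutely_integrable_on {a..b}"
    by (rule nonnegative_absolutely_integrable_1[OF e nn])
  have mi: "(\<lambda>t. min (e t) (real k)) integrable_on {a..b}" for k
    by (intro set_lebesgue_integral_eq_integral absolutely_integrable_min_1 ae
        absolutely_integrable_on_const) auto
  have di: "(\<lambda>t. e t - min (e t) (real k)) integrable_on {a..b}" for k
    by (intro integrable_diff e mi)
  have "(\<lambda>k. integral {a..b} (\<lambda>t. e t - min (e t) (real k))) \<longlonglongrightarrow> integral {a..b} (\<lambda>t. 0)"
  proof (rule dominated_convergence[OF di e])
    show "(\<lambda>k. e t - min (e t) (real k)) \<longlonglongrightarrow> 0" for t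
    proof (rule tendsto_eventually)
      show "\<forall>\<^sub>F k in sequentially. e t - min (e t) (real k) = 0"
        using eventually_ge_at_top[of "nat \<lceil>e t\<rceil>"]
        by eventually_elim (auto simp: min_def)
    qed
  qed (use nn in \<open>auto simp: min_def\<close>)
  then obtain k where k: "integral {a..b} (\<lambda>t. e t - min (e t) (real k)) < \<epsilon> / 2"
    using order_tendstoD(2)[of _ 0 sequentially "\<epsilon> / 2"] \<open>\<epsilon> > 0\<close>
    by (fastforce simp: eventually_sequentially)
  define d where "d t = e t - min (e t) (real k)" for t
  have d: "d integrable_on {a..b}" using di by (simp add: d_def[abs_def])
  have dnn: "0 \<le> d t" for t by (simp add: d_def)
  show "\<exists>\<delta>>0. \<forall>\<D> S. \<D> division_of S \<and> S \<subseteq> {a..b} \<and> (\<Sum>I\<in>\<D>. Sup I - Inf I) < \<delta> \<longrightarrow>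
        (\<Sum>I\<in>\<D>. \<bar>w (Sup I) - w (Inf I)\<bar>) < \<epsilon>"
  proof (intro exI[of _ "\<epsilon> / (2 * (real k + 1))"] conjI allI impI)
    show "\<epsilon> / (2 * (real k + 1)) > 0" using \<open>\<epsilon> > 0\<close> by simp
    fix \<D> S assume *: "\<D> division_of S \<and> S \<subseteq> {a..b} \<and> (\<Sum>I\<in>\<D>. Sup I - Inf I) < \<epsilon> / (2 * (real k + 1))"
    then have D: "\<D> division_of S" and S: "S \<subseteq> {a..b}" by auto
    have one: "\<bar>w (Sup I) - w (Inf I)\<bar> \<le> integral I d + real k * (Sup I - Inf I)" if ID: "I \<in> \<D>" for I
    proof -
      obtain c c' where I: "I = {c..c'}" "I \<noteq> {}" "I \<subseteq> S"
        using division_ofD(2)[OF D ID] division_ofD(3)[OF D ID] division_ofD(4)[OF D ID] by (metis box_real(2))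
      then have "c \<le> c'" using I by simp
      moreover have sub: "{c..c'} \<subseteq> {a..b}" using I S by blast
      ultimately have cc: "c \<le> c'" "a \<le> c" "c' \<le> b" by auto
      have "\<bar>w c' - w c\<bar> \<le> integral {c..c'} e" using w cc by auto
      also have "\<dots> = integral {c..c'} d + integral {c..c'} (\<lambda>t. min (e t) (real k))"
        using integral_add[of d "{c..c'}" "\<lambda>t. min (e t) (real k)"]
          integrable_on_subinterval[OF d sub] integrable_on_subinterval[OF mi sub]
        by (simp add: d_def)
      also have "integral {c..c'} (\<lambda>t. min (e t) (real k)) \<le> integral {c..c'} (\<lambda>t. real k)"
        by (rule integral_le) (use integrable_on_subinterval[OF mi sub] in auto)
      finally show ?thesis using cc I by (simp add: algebra_simps)
    qed
    have "(\<Sum>I\<in>\<D>. \<bar>w (Sup I) - w (Inf I)\<bar>) \<le> (\<Sum>I\<in>\<D>. integral I d + real k * (Sup I - Inf I))"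
      by (rule sum_mono[OF one])
    also have "\<dots> = (\<Sum>I\<in>\<D>. integral I d) + real k * (\<Sum>I\<in>\<D>. Sup I - Inf I)"
      by (simp add: sum.distrib sum_distrib_left)
    also have "(\<Sum>I\<in>\<D>. integral I d) = integral S d"
      by (rule integral_combine_division_topdown[symmetric])
        (use D d S integrable_on_subdivision in blast)+
    also have "integral S d \<le> integral {a..b} d"
      by (rule integral_subset_le) (use D d S dnn integrable_on_subdivision in blast)+
    also have "integral {a..b} d < \<epsilon> / 2" using k by (simp add: d_def[abs_def])
    also have "real k * (\<Sum>I\<in>\<D>. Sup I - Inf I) \<le> real k * (\<epsilon> / (2 * (real k + 1)))"
      using * by (intro mult_left_mono) auto
    also have "\<dots> \<le> \<epsilon> / 2" using \<open>\<epsilon> > 0\<close> by (simp add: field_simps)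
    finally show "(\<Sum>I\<in>\<D>. \<bar>w (Sup I) - w (Inf I)\<bar>) < \<epsilon>" by simp
  qed
qed

text \<open>Averages over intervals to the right of a point converge to the value off a negligible
  set. The same fact for the reflected function handles averages to the left. Extending
  \<open>e\<close> by zero makes it integrable on every interval, as needed for averages that reach
  beyond the end points.\<close>

lemma Lebesgue_differentiation_real:
  fixes e :: "real \<Rightarrow> real"
  assumes e: "e integrable_on {a..b}"
  obtains N where "negligible N"
    "\<And>t. t \<in> {a..b} - N \<Longrightarrow> ((\<lambda>t. integral {a..t} e) has_real_derivative e t) (at t within {a..b})"
proof -
  define f where "f t = (if t \<in> {a..b} then e t else 0)" for t
  have fU: "f integrable_on UNIV"
    unfolding f_def using e integrable_restrict_UNIV by blast
  have f: "f integrable_on cbox c d" for c d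
    using fU integrable_on_subcbox by blast
  have f': "(\<lambda>t. f (- t)) integrable_on cbox c d" for c d
    using f[of "- d" "- c"] Henstock_Kurzweil_Integration.integrable_reflect_real[where f = f and a = "- d" and b = "- c"] by simp
  obtain N1 where N1: "negligible N1" "\<And>x e. x \<notin> N1 \<Longrightarrow> 0 < e \<Longrightarrow> \<exists>d>0. \<forall>h. 0 < h \<and> h < d \<longrightarrow>
      \<bar>integral {x..x + h} f / h - f x\<bar> < e"
    using integrable_ccontinuous_explicit[of f] f by (auto simp: divide_inverse mult.commute)
  obtain N2 where N2: "negligible N2" "\<And>x e. x \<notin> N2 \<Longrightarrow> 0 < e \<Longrightarrow> \<exists>d>0. \<forall>h. 0 < h \<and> h < d \<longrightarrow>
      \<bar>integral {x..x + h} (\<lambda>t. f (- t)) / h - f (- x)\<bar> < e"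
    using integrable_ccontinuous_explicit[of "\<lambda>t. f (- t)"] f' by (auto simp: divide_inverse mult.commute)
  have "negligible (uminus ` N2)"
    using N2(1) by (intro negligible_differentiable_image_negligible) (auto intro: differentiable_on_minus)
  then have N: "negligible (N1 \<union> uminus ` N2)" using N1(1) by simp
  have inc: "integral {a..y} e - integral {a..t} e = integral {t..y} f" if "a \<le> t" "t \<le> y" "y \<le> b" for t y
  proof -
    have "e integrable_on {a..y}" using e integrable_on_subinterval[of e "{a..b}"] that by auto
    then have "integral {a..t} e + integral {t..y} e = integral {a..y} e"
      using that by (intro Henstock_Kurzweil_Integration.integral_combine) auto
    moreover have "integral {t..y} e = integral {t..y} f"
      by (rule integral_cong) (use that in \<open>auto simp: f_def\<close>)
    ultimately show ?thesis by simp
  qed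
  have "((\<lambda>t. integral {a..t} e) has_real_derivative e t) (at t within {a..b})"
    if t: "t \<in> {a..b} - (N1 \<union> uminus ` N2)" for t
    unfolding has_field_derivative_iff Lim_within
  proof (intro allI impI)
    fix \<epsilon> :: real assume "\<epsilon> > 0"
    obtain d1 where d1: "d1 > 0" "\<And>h. 0 < h \<Longrightarrow> h < d1 \<Longrightarrow> \<bar>integral {t..t + h} f / h - f t\<bar> < \<epsilon>"
      using N1(2)[of t \<epsilon>] t \<open>\<epsilon> > 0\<close> by auto
    have "- t \<notin> N2" using t by force
    then obtain d2 where d2: "d2 > 0"
      "\<And>h. 0 < h \<Longrightarrow> h < d2 \<Longrightarrow> \<bar>integral {- t..- t + h} (\<lambda>t. f (- t)) / h - f t\<bar> < \<epsilon>"
      using N2(2)[of "- t" \<epsilon>] \<open>\<epsilon> > 0\<close> by auto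
    have ft: "f t = e t" using t by (simp add: f_def)
    show "\<exists>d>0. \<forall>y\<in>{a..b}. 0 < dist y t \<and> dist y t < d \<longrightarrow>
        dist ((integral {a..y} e - integral {a..t} e) / (y - t)) (e t) < \<epsilon>"
    proof (intro exI[of _ "min d1 d2"] conjI ballI impI)
      fix y assume y: "y \<in> {a..b}" "0 < dist y t \<and> dist y t < min d1 d2"
      show "dist ((integral {a..y} e - integral {a..t} e) / (y - t)) (e t) < \<epsilon>"
      proof (cases "t < y")
        case True
        then show ?thesis using d1(2)[of "y - t"] y t inc[of t y] ft by (auto simp: dist_real_def)
      next
        case False
        then have *: "y < t" using y by auto
        have "integral {- t..- y} (\<lambda>t. f (- t)) = integral {y..t} f"
          using integral_reflect_real[of t y f] by simp
        moreover have "(integral {a..y} e - integral {a..t} e) / (y - t) = integral {y..t} f / (t - y)"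
          using inc[of y t] * y t by (simp add: field_simps)
        ultimately show ?thesis using d2(2)[of "t - y"] y * ft by (auto simp: dist_real_def)
      qed
    qed (use d1 d2 in auto)
  qed
  with N that show thesis by blast
qed

lemma integral_abs_increment_le:
  fixes h e :: "real \<Rightarrow> real"
  assumes h: "h integrable_on {a..b}" and e: "e integrable_on {a..b}"
    and le: "\<And>t. t \<in> {a..b} \<Longrightarrow> \<bar>h t\<bar> \<le> e t"
    and st: "a \<le> s" "s \<le> t" "t \<le> b"
  shows "\<bar>integral {a..t} h - integral {a..s} h\<bar> \<le> integral {s..t} e"
proof -
  have hi: "h integrable_on {a..t}" "h integrable_on {s..t}" "e integrable_on {s..t}"
    using integrable_on_subinterval[OF h] integrable_on_subinterval[OF e] st by auto
  have "integral {a..s} h + integral {s..t} h = integral {a..t} h"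
    using st hi by (intro Henstock_Kurzweil_Integration.integral_combine) auto
  moreover have "\<bar>integral {s..t} h\<bar> \<le> integral {s..t} e"
    using integral_norm_bound_integral[OF hi(2,3)] le st by auto
  ultimately show ?thesis by simp
qed

text \<open>The bridge from the integral equations, which are what survives the limit, to the
  differential definition: absolute continuity comes from the dominating function \<open>e\<close>,
  the second derivative from Lebesgue differentiation, and the boundary condition on the derivative
  from \<open>H0\<close>.\<close>

lemma is_solutionI_integral:
  fixes H e F x y and \<theta> :: real
  assumes T: "T > 0" and H: "H integrable_on {0..T}" and e: "e integrable_on {0..T}"
    and He: "\<And>t. t \<in> {0..T} \<Longrightarrow> \<bar>H t\<bar> \<le> e t"
    and H0: "integral {0..T} H = 0"
    and y_def: "y = (\<lambda>t. a - \<theta> * integral {0..t} H)"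
    and x_def: "x = (\<lambda>t. integral {0..t} y)"
    and N: "negligible N" "\<And>t. t \<in> {0..T} - N \<Longrightarrow> F t (x t) (y t) = \<theta> * H t"
  shows "is_solution T F x"
  unfolding is_solution_def
proof (intro exI[of _ y] conjI ballI)
  show cy: "continuous_on {0..T} y"
    unfolding y_def by (intro continuous_intros indefinite_integral_continuous_1 H)
  show "(x has_real_derivative y t) (at t within {0..T})" if "t \<in> {0..T}" for t
    unfolding x_def by (rule integral_has_real_derivative[OF cy that])
  have enn: "0 \<le> e t" if "t \<in> {0..T}" for t using He[OF that] by linarith
  show "absolutely_continuous_fun_on 0 T y"
  proof (rule absolutely_continuous_fun_on_integral_bound[where e = "\<lambda>t. \<bar>\<theta>\<bar> * e t"])
    fix s t assume st: "0 \<le> s" "s \<le> t" "t \<le> T"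
    have "\<bar>y t - y s\<bar> = \<bar>\<theta>\<bar> * \<bar>integral {0..t} H - integral {0..s} H\<bar>"
      by (simp add: y_def abs_mult[symmetric] algebra_simps abs_minus_commute)
    also have "\<dots> \<le> \<bar>\<theta>\<bar> * integral {s..t} e"
      by (intro mult_left_mono integral_abs_increment_le[OF H e He st]) auto
    finally show "\<bar>y t - y s\<bar> \<le> integral {s..t} (\<lambda>t. \<bar>\<theta>\<bar> * e t)" by simp
  qed (use e enn in \<open>auto intro: integrable_on_mult_right\<close>)
  obtain N' where N': "negligible N'" "\<And>t. t \<in> {0..T} - N' \<Longrightarrow>
      ((\<lambda>t. integral {0..t} H) has_real_derivative H t) (at t within {0..T})"
    using Lebesgue_differentiation_real[OF H] by blast
  show "AE t in lebesgue_on {0..T}. \<exists>u''. (y has_real_derivative u'') (at t within {0..T}) \<and> u'' + F t (x t) (y t) = 0"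
    unfolding AE_lebesgue_on_negligible[of "{0..T}", simplified]
  proof (intro exI[of _ "N \<union> N'"] conjI ballI)
    show "negligible (N \<union> N')" using N N' by simp
    fix t assume t: "t \<in> {0..T} - (N \<union> N')"
    have "(y has_real_derivative - (\<theta> * H t)) (at t within {0..T})"
      unfolding y_def using N'(2)[of t] t by (auto intro!: derivative_eq_intros)
    then show "\<exists>u''. (y has_real_derivative u'') (at t within {0..T}) \<and> u'' + F t (x t) (y t) = 0"
      using N(2)[of t] t by (intro exI[of _ "- (\<theta> * H t)"]) auto
  qed
  show "y 0 = y T" using H0 by (simp add: y_def)
  show "x 0 = 0" by (simp add: x_def)
qed

subsection \<open>The Nagumo bound\<close>

lemma enn2real_ge_1:
  assumes "1 \<le> p" "p \<noteq> \<infinity>"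
  shows "1 \<le> enn2real p"
  using assms by (cases p) (auto simp: ennreal_ge_1)

text \<open>A Young inequality without sharp constants: the product is a weighted geometric mean of
  \<open>a powr q\<close> and \<open>w\<close>, with weights \<open>1 / q\<close> and
  \<open>(q - 1) / q\<close>, hence at most the larger of the two.\<close>

lemma powr_mult_le_add_powr:
  fixes a w q :: real
  assumes q: "1 \<le> q" and a: "0 \<le> a" and w: "0 < w"
  shows "a * w powr ((q - 1) / q) \<le> a powr q + w"
proof (cases "a powr q \<le> w")
  case True
  have "a = (a powr q) powr (1 / q)" using a q by (simp add: powr_powr)
  also have "\<dots> \<le> w powr (1 / q)" using True q by (intro powr_mono2) auto
  finally have "a * w powr ((q - 1) / q) \<le> w powr (1 / q) * w powr ((q - 1) / q)"
    by (intro mult_right_mono) auto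
  also have "\<dots> = w" using q w by (simp add: powr_add[symmetric] add_divide_distrib[symmetric])
  finally show ?thesis by (simp add: add_increasing)
next
  case False
  then have "a \<noteq> 0" using w by auto
  then have a0: "a > 0" using a by simp
  have "w powr ((q - 1) / q) \<le> (a powr q) powr ((q - 1) / q)"
    using False w q by (intro powr_mono2) auto
  also have "\<dots> = a powr (q - 1)" using q by (simp add: powr_powr)
  finally have "a * w powr ((q - 1) / q) \<le> a powr 1 * a powr (q - 1)"
    using a0 by (auto intro: mult_left_mono)
  also have "\<dots> = a powr q" using a0 powr_mult_base[of a "q - 1"] by simp
  finally show ?thesis using w by simp
qed

text \<open>This pointwise bound takes the place of Hoelder's inequality in the Nagumo estimate.\<close>

lemma Lp_fun_Nagumo_bound:
  assumes p: "1 \<le> p" and \<psi>: "Lp_fun p T \<psi>" "nonneg_ae T \<psi>"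
  obtains E C where "E integrable_on {0..T}" "\<And>t. 0 \<le> E t" "0 \<le> C"
    "AE t in lebesgue_on {0..T}. \<forall>w>0. \<psi> t * w powr Nagumo_exponent p \<le> E t + C * w"
proof (cases "p = \<infinity>")
  case True
  then obtain C where C: "AE t in lebesgue_on {0..T}. \<bar>\<psi> t\<bar> \<le> C" using \<psi> by (auto simp: Lp_fun_def)
  show thesis
  proof (rule that[of "\<lambda>_. 0" "max 0 C"])
    show "AE t in lebesgue_on {0..T}. \<forall>w>0. \<psi> t * w powr Nagumo_exponent p \<le> 0 + max 0 C * w"
      using C by eventually_elim (auto simp: Nagumo_exponent_def True intro!: mult_right_mono)
  qed auto
next
  case False
  let ?q = "enn2real p"
  have q: "1 \<le> ?q" using enn2real_ge_1[OF p False] .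
  have "integrable (lebesgue_on {0..T}) (\<lambda>t. \<bar>\<psi> t\<bar> powr ?q)" using \<psi> False by (auto simp: Lp_fun_def)
  then have i: "(\<lambda>t. \<bar>\<psi> t\<bar> powr ?q) integrable_on {0..T}" by (intro integrable_on_lebesgue_on) auto
  show thesis
  proof (rule that[of "\<lambda>t. \<bar>\<psi> t\<bar> powr ?q" 1, OF i])
    show "AE t in lebesgue_on {0..T}. \<forall>w>0. \<psi> t * w powr Nagumo_exponent p \<le> \<bar>\<psi> t\<bar> powr ?q + 1 * w"
      using \<psi>(2) unfolding nonneg_ae_def
      by eventually_elim (use powr_mult_le_add_powr[OF q] False in \<open>simp add: Nagumo_exponent_def\<close>)
  qed auto
qed

lemma Lp_fun_imp_integrable:
  assumes p: "1 \<le> p" and \<psi>: "Lp_fun p T \<psi>"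
  shows "integrable (lebesgue_on {0..T}) \<psi>"
proof -
  interpret finite_measure "lebesgue_on {0..T}" by (simp add: finite_measure_lebesgue_on)
  show ?thesis
  proof (cases "p = \<infinity>")
    case True
    then obtain C where C: "AE t in lebesgue_on {0..T}. \<bar>\<psi> t\<bar> \<le> C" using \<psi> by (auto simp: Lp_fun_def)
    show ?thesis
      by (rule Bochner_Integration.integrable_bound[of _ "\<lambda>_. C"])
        (use \<psi> C in \<open>auto simp: Lp_fun_def elim: eventually_mono\<close>)
  next
    case False
    let ?q = "enn2real p"
    have q: "1 \<le> ?q" using enn2real_ge_1[OF p False] .
    have *: "\<bar>z\<bar> \<le> 1 + \<bar>z\<bar> powr ?q" for z :: real
    proof (cases "\<bar>z\<bar> \<le> 1")
      case True then show ?thesis by (simp add: add_increasing2)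
    next
      case False
      then have "\<bar>z\<bar> powr 1 \<le> \<bar>z\<bar> powr ?q" using q by (intro powr_mono) auto
      then show ?thesis by simp
    qed
    show ?thesis
      by (rule Bochner_Integration.integrable_bound[of _ "\<lambda>t. 1 + \<bar>\<psi> t\<bar> powr ?q"])
        (use \<psi> False * in \<open>auto simp: Lp_fun_def\<close>)
  qed
qed

text \<open>Steps of length at most \<open>\<delta> / 2\<close> are chained by the triangle
  inequality while the increments of \<open>B\<close> telescope.\<close>

lemma local_increment_imp_global:
  fixes A B :: "real \<Rightarrow> real"
  assumes "\<delta> > 0" "s \<le> t"
    and loc: "\<And>x y. s \<le> x \<Longrightarrow> x \<le> y \<Longrightarrow> y \<le> t \<Longrightarrow> y - x < \<delta> \<Longrightarrow> \<bar>A y - A x\<bar> \<le> B y - B x"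
  shows "\<bar>A t - A s\<bar> \<le> B t - B s"
proof -
  have *: "\<bar>A y - A s\<bar> \<le> B y - B s" if "s \<le> y" "y \<le> t" "y - s \<le> real n * (\<delta> / 2)" for n y
    using that
  proof (induction n arbitrary: y)
    case (Suc n)
    define x where "x = max s (y - \<delta> / 2)"
    have x: "s \<le> x" "x \<le> y" "y - x < \<delta>" "x - s \<le> real n * (\<delta> / 2)"
      using Suc.prems \<open>\<delta> > 0\<close> by (auto simp: x_def max_def algebra_simps)
    have "\<bar>A x - A s\<bar> \<le> B x - B s" using Suc.IH[of x] x Suc.prems by auto
    moreover have "\<bar>A y - A x\<bar> \<le> B y - B x" using loc[of x y] x Suc.prems by auto
    ultimately show ?case by linarith
  qed auto
  obtain n :: nat where "(t - s) / (\<delta> / 2) \<le> real n" using real_arch_simple by blast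
  then have "t - s \<le> real n * (\<delta> / 2)" using \<open>\<delta> > 0\<close> by (simp add: field_simps)
  then show ?thesis using *[of t n] \<open>s \<le> t\<close> by auto
qed

lemma continuous_mult_integrable:
  fixes g e :: "real \<Rightarrow> real"
  assumes g: "continuous_on {c..d} g" and e: "e integrable_on {c..d}" "\<And>t. t \<in> {c..d} \<Longrightarrow> 0 \<le> e t"
  shows "(\<lambda>t. g t * e t) integrable_on {c..d}"
proof -
  have ae: "e absolutely_integrable_on {c..d}"
    by (rule nonnegative_absolutely_integrable_1[OF e])
  show ?thesis
    using absolutely_integrable_bounded_measurable_product_real[OF _ _ _ ae, of g]
      continuous_imp_measurable_on_sets_lebesgue[OF g]
      compact_imp_bounded[OF compact_continuous_image[OF g]]
    by (auto simp: set_lebesgue_integral_eq_integral)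
qed

lemma integral_le_off_negligible:
  fixes f g :: "real \<Rightarrow> real"
  assumes "f integrable_on S" "g integrable_on S" "negligible N" "\<And>t. t \<in> S - N \<Longrightarrow> f t \<le> g t"
  shows "integral S f \<le> integral S g"
proof -
  define f' where "f' t = (if t \<in> N then g t else f t)" for t
  have "integral S f = integral S f'"
    using assms(3) by (rule integral_spike) (auto simp: f'_def)
  also have "\<dots> \<le> integral S g"
  proof (rule integral_le)
    show "f' integrable_on S"
      using assms(3) by (rule integrable_spike[OF assms(1)]) (auto simp: f'_def)
  qed (use assms in \<open>auto simp: f'_def\<close>)
  finally show ?thesis .
qed

text \<open>
  \<open>Y\<close> need not be differentiable: on short intervals the mean value theorem is applied to \<open>G\<close>
  and the intermediate value theorem to \<open>Y\<close>.
\<close>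

lemma substitution_increment_le:
  fixes Y e G \<gamma> :: "real \<Rightarrow> real"
  assumes cd: "c \<le> d" and Y: "continuous_on {c..d} Y" "Y ` {c..d} \<subseteq> {m..M}"
    and G: "\<And>z. z \<in> {m..M} \<Longrightarrow> (G has_real_derivative \<gamma> z) (at z within {m..M})"
    and \<gamma>: "continuous_on {m..M} \<gamma>" "\<And>z. z \<in> {m..M} \<Longrightarrow> 0 \<le> \<gamma> z"
    and e: "e integrable_on {c..d}" "\<And>t. t \<in> {c..d} \<Longrightarrow> 0 \<le> e t"
    and inc: "\<And>s t. c \<le> s \<Longrightarrow> s \<le> t \<Longrightarrow> t \<le> d \<Longrightarrow> \<bar>Y t - Y s\<bar> \<le> integral {s..t} e"
  shows "\<bar>G (Y d) - G (Y c)\<bar> \<le> integral {c..d} (\<lambda>t. \<gamma> (Y t) * e t)"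
proof -
  have c\<gamma>Y: "continuous_on {c..d} (\<lambda>t. \<gamma> (Y t))"
    by (rule continuous_on_compose2[OF \<gamma>(1) Y])
  have i: "(\<lambda>t. \<gamma> (Y t) * e t) integrable_on {c..d}"
    by (rule continuous_mult_integrable[OF c\<gamma>Y e])
  have main: "\<bar>G (Y d) - G (Y c)\<bar> \<le> integral {c..d} (\<lambda>t. \<gamma> (Y t) * e t) + \<epsilon> * integral {c..d} e"
    if "\<epsilon> > 0" for \<epsilon>
  proof -
    \<comment> \<open>The mean value theorem yields \<gamma> at some point of a short interval,
      whereas the integral needs it at the running point. Uniform continuity bounds the difference
      by \<epsilon>, and the term \<open>\<epsilon> * e t\<close> pays for it.\<close>
    define h where "h t = \<gamma> (Y t) * e t + \<epsilon> * e t" for t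
    have hint: "h integrable_on {c..d}"
      unfolding h_def by (intro integrable_add i integrable_on_mult_right e)
    obtain \<delta> where \<delta>: "\<delta> > 0"
      "\<And>t t'. t \<in> {c..d} \<Longrightarrow> t' \<in> {c..d} \<Longrightarrow> \<bar>t' - t\<bar> < \<delta> \<Longrightarrow> \<bar>\<gamma> (Y t') - \<gamma> (Y t)\<bar> < \<epsilon>"
      using compact_uniformly_continuous[OF c\<gamma>Y] \<open>\<epsilon> > 0\<close>
      unfolding uniformly_continuous_on_def dist_real_def by (metis compact_Icc)
    have "\<bar>G (Y d) - G (Y c)\<bar> \<le> integral {c..d} h - integral {c..c} h"
    proof (rule local_increment_imp_global[OF \<delta>(1) cd, where A = "\<lambda>t. G (Y t)" and B = "\<lambda>t. integral {c..t} h"])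
      fix s t assume st: "c \<le> s" "s \<le> t" "t \<le> d" "t - s < \<delta>"
      have sub: "{s..t} \<subseteq> {c..d}" using st by auto
      have Ym: "Y s \<in> {m..M}" "Y t \<in> {m..M}" using Y(2) st by (auto simp: image_subset_iff)
      have "\<exists>\<tau>\<in>{s..t}. \<bar>G (Y t) - G (Y s)\<bar> \<le> \<gamma> (Y \<tau>) * \<bar>Y t - Y s\<bar>"
      proof (cases "Y s = Y t")
        case True then show ?thesis using st by (intro bexI[of _ s]) auto
      next
        case False
        define lo and hi where "lo = min (Y s) (Y t)" and "hi = max (Y s) (Y t)"
        have lh: "lo < hi" "m \<le> lo" "hi \<le> M" using False Ym by (auto simp: lo_def hi_def)
        have "\<exists>z\<in>{lo<..<hi}. G hi - G lo = (*) (\<gamma> z) (hi - lo)"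
        proof (rule mvt_simple[OF lh(1)])
          fix z assume "lo \<le> z" "z \<le> hi"
          then show "(G has_derivative (*) (\<gamma> z)) (at z within {lo..hi})"
            using has_field_derivative_subset[OF G, of z "{lo..hi}"] lh
            by (auto simp: has_field_derivative_def)
        qed
        then obtain z where z: "lo < z" "z < hi" "G hi - G lo = \<gamma> z * (hi - lo)" by auto
        have "connected (Y ` {s..t})"
          using continuous_on_subset[OF Y(1) sub] by (intro connected_continuous_image) auto
        moreover have "lo \<in> Y ` {s..t}" "hi \<in> Y ` {s..t}"
          using st by (auto simp: lo_def hi_def min_def max_def)
        ultimately have "z \<in> Y ` {s..t}" using connectedD_interval z by (metis less_imp_le)
        then obtain \<tau> where \<tau>: "\<tau> \<in> {s..t}" "z = Y \<tau>" by blast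
        have "\<bar>G (Y t) - G (Y s)\<bar> = \<bar>G hi - G lo\<bar>" "hi - lo = \<bar>Y t - Y s\<bar>"
          by (auto simp: lo_def hi_def min_def max_def)
        moreover have "0 \<le> \<gamma> z" using \<gamma>(2)[of z] z lh by auto
        ultimately show ?thesis using z \<tau> by (intro bexI[of _ \<tau>]) (auto simp: abs_mult)
      qed
      then obtain \<tau> where \<tau>: "\<tau> \<in> {s..t}" "\<bar>G (Y t) - G (Y s)\<bar> \<le> \<gamma> (Y \<tau>) * \<bar>Y t - Y s\<bar>" by blast
      have ei: "e integrable_on {s..t}" using integrable_on_subinterval[OF e(1) sub] .
      have "\<gamma> (Y \<tau>) * \<bar>Y t - Y s\<bar> \<le> \<gamma> (Y \<tau>) * integral {s..t} e"
        using \<tau> Y(2) \<gamma>(2)[of "Y \<tau>"] sub inc[of s t] st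
        by (intro mult_left_mono) (auto simp: image_subset_iff)
      also have "\<dots> = integral {s..t} (\<lambda>t. \<gamma> (Y \<tau>) * e t)" by simp
      also have "\<dots> \<le> integral {s..t} h"
      proof (rule integral_le)
        fix x assume x: "x \<in> {s..t}"
        then have "\<bar>\<tau> - x\<bar> < \<delta>" "x \<in> {c..d}" "\<tau> \<in> {c..d}" using \<tau>(1) st by auto
        then have "\<gamma> (Y \<tau>) \<le> \<gamma> (Y x) + \<epsilon>" using \<delta>(2)[of x \<tau>] by linarith
        then show "\<gamma> (Y \<tau>) * e x \<le> h x"
          unfolding h_def distrib_right[symmetric] using x sub e(2) by (intro mult_right_mono) auto
      qed (use ei integrable_on_subinterval[OF hint sub] in \<open>auto intro: integrable_on_mult_right\<close>)
      also have "\<dots> = integral {c..t} h - integral {c..s} h"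
      proof -
        have "h integrable_on {c..t}" using integrable_on_subinterval[OF hint] st by auto
        then have "integral {c..s} h + integral {s..t} h = integral {c..t} h"
          using st by (intro Henstock_Kurzweil_Integration.integral_combine) auto
        then show ?thesis by simp
      qed
      finally show "\<bar>G (Y t) - G (Y s)\<bar> \<le> integral {c..t} h - integral {c..s} h" using \<tau>(2) by linarith
    qed
    also have "integral {c..d} h = integral {c..d} (\<lambda>t. \<gamma> (Y t) * e t) + \<epsilon> * integral {c..d} e"
      unfolding h_def using i e(1) integrable_on_mult_right by (subst integral_add) auto
    finally show ?thesis by simp
  qed
  define I where "I = integral {c..d} e"
  have "I \<ge> 0" unfolding I_def using e by (intro integral_nonneg) auto
  show ?thesis
  proof (rule field_le_epsilon)
    fix \<epsilon> :: real assume "\<epsilon> > 0"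
    have "\<epsilon> / (I + 1) * I \<le> \<epsilon>" using \<open>I \<ge> 0\<close> \<open>\<epsilon> > 0\<close> by (simp add: field_simps)
    then show "\<bar>G (Y d) - G (Y c)\<bar> \<le> integral {c..d} (\<lambda>t. \<gamma> (Y t) * e t) + \<epsilon>"
      using main[of "\<epsilon> / (I + 1)"] \<open>I \<ge> 0\<close> \<open>\<epsilon> > 0\<close> unfolding I_def[symmetric] by auto
  qed
qed

text \<open>\<open>d\<close> is the first time at which \<open>Y\<close> reaches \<open>M\<close>,
  and \<open>c\<close> is the last time before \<open>d\<close> at which \<open>Y\<close> is at most
  \<open>m\<close>; in between neither level can be passed.\<close>

lemma continuous_crossing:
  fixes Y :: "real \<Rightarrow> real"
  assumes Y: "continuous_on {a..b} Y" and "a \<le> b" "Y a \<le> m" "m < M" "M \<le> Y b"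
  obtains c d where "a \<le> c" "c < d" "d \<le> b" "Y c = m" "Y d = M" "\<And>t. t \<in> {c..d} \<Longrightarrow> Y t \<in> {m..M}"
proof -
  have "closed ({a..b} \<inter> Y -` {M..})" using continuous_closed_preimage[OF Y] by simp
  then have "compact ({a..b} \<inter> Y -` {M..})"
    by (metis bounded_Int bounded_closed_interval compact_eq_bounded_closed)
  moreover have "b \<in> {a..b} \<inter> Y -` {M..}" using assms by auto
  ultimately obtain d where "d \<in> {a..b} \<inter> Y -` {M..}" "\<forall>t\<in>{a..b} \<inter> Y -` {M..}. d \<le> t"
    using compact_attains_inf[of "{a..b} \<inter> Y -` {M..}"] by blast
  then have d: "a \<le> d" "d \<le> b" "M \<le> Y d" "\<And>t. a \<le> t \<Longrightarrow> t \<le> b \<Longrightarrow> M \<le> Y t \<Longrightarrow> d \<le> t"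
    by auto
  have Yd: "continuous_on {a..d} Y" using Y by (rule continuous_on_subset) (use d in auto)
  have dM: "Y d = M"
  proof -
    obtain t where t: "a \<le> t" "t \<le> d" "Y t = M" using IVT'[of Y a M d] Yd d assms by auto
    then have "d \<le> t" using d(2) d(4)[of t] by auto
    then show ?thesis using t by simp
  qed
  have "closed ({a..d} \<inter> Y -` {..m})" using continuous_closed_preimage[OF Yd] by simp
  then have "compact ({a..d} \<inter> Y -` {..m})"
    by (metis bounded_Int bounded_closed_interval compact_eq_bounded_closed)
  moreover have "a \<in> {a..d} \<inter> Y -` {..m}" using assms d by auto
  ultimately obtain c where "c \<in> {a..d} \<inter> Y -` {..m}" "\<forall>t\<in>{a..d} \<inter> Y -` {..m}. t \<le> c"
    using compact_attains_sup[of "{a..d} \<inter> Y -` {..m}"] by blast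
  then have c: "a \<le> c" "c \<le> d" "Y c \<le> m" "\<And>t. a \<le> t \<Longrightarrow> t \<le> d \<Longrightarrow> Y t \<le> m \<Longrightarrow> t \<le> c"
    by auto
  have Yc: "continuous_on {c..d} Y" using Yd by (rule continuous_on_subset) (use c in auto)
  have cm: "Y c = m"
  proof -
    obtain t where t: "c \<le> t" "t \<le> d" "Y t = m" using IVT'[of Y c m d] Yc c dM assms by auto
    then have "t \<le> c" using c(1) c(4)[of t] by auto
    then show ?thesis using t by simp
  qed
  show thesis
  proof (rule that[OF c(1) _ d(2) cm dM])
    show "c < d" using c(2) cm dM assms by (cases "c = d") auto
    fix t assume t: "t \<in> {c..d}"
    have "m \<le> Y t" using t c(1) c(4)[of t] cm by (cases "Y t \<le> m") auto
    moreover have "Y t \<le> M" using t c(1) d(2) d(4)[of t] dM by (cases "M \<le> Y t") auto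
    ultimately show "Y t \<in> {m..M}" by simp
  qed
qed

text \<open>In the Nagumo estimate the slope may be small after it is large as well as before. The
  first case is the second one for the time-reversed function.\<close>

lemma continuous_crossing_either_way:
  fixes Y :: "real \<Rightarrow> real"
  assumes Y: "continuous_on {a..b} Y" and t: "t0 \<in> {a..b}" "t1 \<in> {a..b}" and "Y t0 \<le> m" "m < M" "M \<le> Y t1"
  obtains c d where "a \<le> c" "c < d" "d \<le> b" "\<And>t. t \<in> {c..d} \<Longrightarrow> Y t \<in> {m..M}"
    "Y c = m \<and> Y d = M \<or> Y c = M \<and> Y d = m"
proof (cases "t0 \<le> t1")
  case True
  have "continuous_on {t0..t1} Y" using Y by (rule continuous_on_subset) (use t in auto)
  from continuous_crossing[OF this True assms(4-6)] show thesis
    using that t by (metis atLeastAtMost_iff order_trans)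
next
  case False
  have "continuous_on ((\<lambda>x. - x) ` {- t0..- t1}) Y" using Y by (rule continuous_on_subset) (use t in auto)
  then have "continuous_on {- t0..- t1} (\<lambda>x. Y (- x))"
    by (intro continuous_on_compose2[of _ Y _ uminus]) (auto intro!: continuous_intros)
  then obtain c d where cd: "- t0 \<le> c" "c < d" "d \<le> - t1" "Y (- c) = m" "Y (- d) = M"
      "\<And>t. t \<in> {c..d} \<Longrightarrow> Y (- t) \<in> {m..M}"
    using continuous_crossing[of "- t0" "- t1" "\<lambda>x. Y (- x)" m M] False assms(4-6) by auto
  show thesis
  proof (rule that[of "- d" "- c"])
    show "Y t \<in> {m..M}" if "t \<in> {- d..- c}" for t
      using cd(6)[of "- t"] that by auto
  qed (use cd t in auto)
qed

text \<open>Adding 1 to the denominator makes the quotient continuous even where \<phi> vanishes.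
  The divergence is not lost: far out \<phi> exceeds some \<open>c > 0\<close>, so
  \<open>\<phi> + 1\<close> is at most \<open>(1 + 1 / c) * \<phi>\<close>. A bounded primitive
  would converge by monotonicity, and its limit would make the divergent integral finite.\<close>

lemma Nagumo_primitive_unbounded:
  fixes \<phi> :: "real \<Rightarrow> real"
  assumes \<phi>: "continuous_on {0..} \<phi>" "\<And>\<xi>. 0 \<le> \<xi> \<Longrightarrow> 0 \<le> \<phi> \<xi>"
    and div: "\<forall>\<^sub>F M in at_top. (\<integral>\<^sup>+\<xi>\<in>{M..}. ennreal (\<xi> powr q / \<phi> \<xi>) \<partial>lborel) = \<infinity>"
    and lim: "Liminf at_top (\<lambda>\<xi>. ereal (\<phi> \<xi>)) > 0"
    and m: "m > 0"
  shows "\<exists>N>m. integral {m..N} (\<lambda>\<xi>. \<xi> powr q / (\<phi> \<xi> + 1)) > C"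
proof (rule ccontr)
  assume neg: "\<not> ?thesis"
  \<comment> \<open>Freezing the argument below \<open>m\<close> gives a function that is continuous
    on the whole line, so that measurability and differentiability of its primitive need no case
    distinction.\<close>
  define g where "g \<xi> = max m \<xi> powr q / (\<phi> (max m \<xi>) + 1)" for \<xi>
  have g0: "0 \<le> g \<xi>" for \<xi> using \<phi>(2)[of "max m \<xi>"] m by (auto simp: g_def max_def)
  have cg: "continuous_on UNIV g"
    unfolding g_def
    using m \<phi>(2)[of "max m _"]
    by (intro continuous_intros continuous_on_compose2[OF \<phi>(1)])
      (auto simp: max_def add_nonneg_eq_0_iff)
  define G where "G x = integral {m..x} g" for x
  have gi: "g integrable_on {a..b}" for a b
    by (intro integrable_continuous_real continuous_on_subset[OF cg]) auto
  have G_le: "G N \<le> max 0 C" for N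
  proof (cases "N > m")
    case True
    have "G N = integral {m..N} (\<lambda>\<xi>. \<xi> powr q / (\<phi> \<xi> + 1))"
      unfolding G_def by (rule integral_cong) (auto simp: g_def)
    then show ?thesis using neg True by force
  next
    case False
    then have "{m..N} = {} \<or> {m..N} = cbox m m" by auto
    then show ?thesis by (auto simp: G_def)
  qed
  have "mono G"
  proof (rule monoI)
    fix x y :: real assume "x \<le> y"
    then show "G x \<le> G y"
      unfolding G_def by (intro integral_subset_le gi) (auto simp: g0)
  qed
  then have "incseq (\<lambda>n. G (real n))" by (auto simp: incseq_def mono_def)
  then obtain L where L: "(\<lambda>n. G (real n)) \<longlonglongrightarrow> L"
    using incseq_convergent[of "\<lambda>n. G (real n)"] G_le by metis
  have GL: "(G \<longlongrightarrow> L) at_top"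
    using tendsto_at_topI_sequentially_real[OF \<open>mono G\<close> L] .
  obtain c where c: "0 < ereal c" "ereal c < Liminf at_top (\<lambda>\<xi>. ereal (\<phi> \<xi>))"
    using ereal_dense2[OF lim] by auto
  have "\<forall>\<^sub>F \<xi> in at_top. c < \<phi> \<xi>"
    using less_LiminfD[OF c(2)] by simp
  then have "\<forall>\<^sub>F M in at_top. \<forall>\<xi>\<ge>M. c < \<phi> \<xi>"
    by (simp add: eventually_all_ge_at_top)
  with div eventually_gt_at_top[of m] have "\<forall>\<^sub>F M in at_top.
      (\<integral>\<^sup>+\<xi>\<in>{M..}. ennreal (\<xi> powr q / \<phi> \<xi>) \<partial>lborel) = \<infinity> \<and> (\<forall>\<xi>\<ge>M. c < \<phi> \<xi>) \<and> m < M"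
    by eventually_elim auto
  then obtain M where M: "(\<integral>\<^sup>+\<xi>\<in>{M..}. ennreal (\<xi> powr q / \<phi> \<xi>) \<partial>lborel) = \<infinity>"
      "\<And>\<xi>. \<xi> \<ge> M \<Longrightarrow> c < \<phi> \<xi>" "m < M"
    using eventually_happens'[OF trivial_limit_at_top_linorder] by blast
  have fin: "(\<integral>\<^sup>+\<xi>. ennreal (g \<xi>) * indicator {M..} \<xi> \<partial>lborel) = ennreal (L - G M)"
  proof (rule nn_integral_FTC_atLeast[OF _ _ _ GL])
    show "g \<in> borel_measurable borel" using cg by (rule borel_measurable_continuous_onI)
    fix x assume "M \<le> x"
    then have x: "x \<in> {m<..<x + 1}" using M by auto
    have "(G has_real_derivative g x) (at x within {m..x + 1})"
      unfolding G_def using continuous_on_subset[OF cg] x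
      by (intro integral_has_real_derivative) auto
    then show "(G has_real_derivative g x) (at x)"
      using at_within_Icc_at[of m x "x + 1"] x by simp
    show "0 \<le> g x" by (rule g0)
  qed
  have "\<infinity> = (\<integral>\<^sup>+\<xi>\<in>{M..}. ennreal (\<xi> powr q / \<phi> \<xi>) \<partial>lborel)" using M by simp
  also have "\<dots> \<le> (\<integral>\<^sup>+\<xi>. ennreal (1 + 1 / c) * (ennreal (g \<xi>) * indicator {M..} \<xi>) \<partial>lborel)"
  proof (rule nn_integral_mono)
    fix \<xi> :: real
    show "ennreal (\<xi> powr q / \<phi> \<xi>) * indicator {M..} \<xi> \<le> ennreal (1 + 1 / c) * (ennreal (g \<xi>) * indicator {M..} \<xi>)"
    proof (cases "\<xi> \<ge> M")
      case True
      then have *: "c < \<phi> \<xi>" "m < \<xi>" "0 < c" using M c by auto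
      have "\<phi> \<xi> + 1 \<le> (1 + 1 / c) * \<phi> \<xi>" using * by (simp add: field_simps)
      then have "(1 + 1 / c) / ((1 + 1 / c) * \<phi> \<xi>) \<le> (1 + 1 / c) / (\<phi> \<xi> + 1)"
        using * by (intro divide_left_mono mult_pos_pos add_pos_pos) auto
      moreover have "1 + 1 / c \<noteq> 0" using * by (smt (verit) divide_pos_pos)
      ultimately have "1 / \<phi> \<xi> \<le> (1 + 1 / c) * (1 / (\<phi> \<xi> + 1))" by simp
      then have "\<xi> powr q * (1 / \<phi> \<xi>) \<le> \<xi> powr q * ((1 + 1 / c) * (1 / (\<phi> \<xi> + 1)))"
        by (intro mult_left_mono) auto
      then have "\<xi> powr q / \<phi> \<xi> \<le> (1 + 1 / c) * g \<xi>"
        using * by (simp add: g_def max_def mult_ac)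
      then have "ennreal (\<xi> powr q / \<phi> \<xi>) \<le> ennreal (1 + 1 / c) * ennreal (g \<xi>)"
        using g0 * by (simp add: ennreal_mult[symmetric] ennreal_leI del: ennreal_plus)
      then show ?thesis using True by simp
    qed auto
  qed
  also have "\<dots> = ennreal (1 + 1 / c) * ennreal (L - G M)"
  proof -
    have [measurable]: "g \<in> borel_measurable borel" using cg by (rule borel_measurable_continuous_onI)
    show ?thesis by (subst nn_integral_cmult) (simp_all add: fin)
  qed
  also have "\<dots> < \<infinity>" by (simp add: ennreal_mult_less_top)
  finally show False by simp
qed

text \<open>A continuous function without zeros keeps its sign on an interval. Where the slope stays
  away from 0, the integral of its modulus is thus an increment of the solution, which is bounded by
  the size of the solution.\<close>

lemma integral_abs_const_sign:
  fixes y :: "real \<Rightarrow> real"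
  assumes "continuous_on {c..d} y" "\<And>t. t \<in> {c..d} \<Longrightarrow> y t \<noteq> 0"
  shows "integral {c..d} (\<lambda>t. \<bar>y t\<bar>) = \<bar>integral {c..d} y\<bar>"
proof -
  have conn: "connected (y ` {c..d})" using assms by (intro connected_continuous_image) auto
  have sgn: "(\<forall>t\<in>{c..d}. 0 < y t) \<or> (\<forall>t\<in>{c..d}. y t < 0)"
  proof (rule ccontr)
    assume "\<not> ?thesis"
    then obtain s t where "s \<in> {c..d}" "t \<in> {c..d}" "y s \<le> 0" "0 \<le> y t" by (meson not_le_imp_less)
    then have "0 \<in> y ` {c..d}" using connectedD_interval[OF conn, of "y s" "y t" 0] by blast
    then show False using assms(2) by force
  qed
  have i: "y integrable_on {c..d}" using assms by (intro integrable_continuous_real)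
  from sgn show ?thesis
  proof
    assume pos: "\<forall>t\<in>{c..d}. 0 < y t"
    then have "0 \<le> integral {c..d} y" by (intro integral_nonneg i) (simp add: less_imp_le)
    moreover have "integral {c..d} (\<lambda>t. \<bar>y t\<bar>) = integral {c..d} y"
      using pos by (intro integral_cong) (simp add: abs_of_pos)
    ultimately show ?thesis by simp
  next
    assume neg: "\<forall>t\<in>{c..d}. y t < 0"
    have "integral {c..d} (\<lambda>t. \<bar>y t\<bar>) = integral {c..d} (\<lambda>t. - y t)"
      using neg by (intro integral_cong) (simp add: abs_of_neg)
    also have "\<dots> = - integral {c..d} y" by simp
    finally have *: "integral {c..d} (\<lambda>t. \<bar>y t\<bar>) = - integral {c..d} y" .
    have "0 \<le> integral {c..d} (\<lambda>t. \<bar>y t\<bar>)"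
      using assms(1) by (intro integral_nonneg integrable_continuous_real continuous_intros) auto
    with * show ?thesis by simp
  qed
qed

text \<open>The mean slope is at most \<open>S / T\<close>, so \<open>y\<close> is small somewhere.
  If it also exceeded \<open>N\<close>, its modulus would cross from \<open>m\<close> to
  \<open>N\<close>. Along the crossing the increment inequality, divided by
  \<open>\<phi> + 1\<close> and weighted by the Nagumo power, bounds the primitive at
  \<open>N\<close> by \<open>integral {0..T} E + C * S\<close>, and \<open>N\<close> is chosen to
  exceed this. The argument of \<phi> is cut at the very \<open>N\<close> that is produced, because
  the bound is applied to solutions of the problem truncated at \<open>N\<close>; on the crossing
  interval the cut is inactive. Including \<open>\<alpha>\<^sub>0 * v\<close> makes \<open>N\<close>
  uniform in \<alpha>.\<close>

lemma Nagumo_derivative_bound: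
  fixes \<phi> \<psi> v :: "real \<Rightarrow> real"
  assumes T: "T > 0" and p: "1 \<le> p"
    and \<phi>: "continuous_on {0..} \<phi>" "\<And>\<xi>. 0 \<le> \<xi> \<Longrightarrow> 0 \<le> \<phi> \<xi>"
    and div: "\<forall>\<^sub>F M in at_top. (\<integral>\<^sup>+\<xi>\<in>{M..}. ennreal (\<xi> powr Nagumo_exponent p / \<phi> \<xi>) \<partial>lborel) = \<infinity>"
    and lim: "Liminf at_top (\<lambda>\<xi>. ereal (\<phi> \<xi>)) > 0"
    and \<psi>: "Lp_fun p T \<psi>" "\<And>t. 0 \<le> \<psi> t" and v: "Lp_fun p T v" "\<And>t. 0 \<le> v t"
    and S: "S \<ge> 0" and al: "\<alpha>\<^sub>0 \<ge> 0"
  obtains N where "N > K" "\<And>y t. continuous_on {0..T} y \<Longrightarrow>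
      (\<And>s t. 0 \<le> s \<Longrightarrow> s \<le> t \<Longrightarrow> t \<le> T \<Longrightarrow>
        \<bar>y t - y s\<bar> \<le> integral {s..t} (\<lambda>\<tau>. \<psi> \<tau> * \<phi> (min \<bar>y \<tau>\<bar> N) + \<alpha>\<^sub>0 * v \<tau>)) \<Longrightarrow>
      (\<And>t. t \<in> {0..T} \<Longrightarrow> integral {0..t} y \<in> {0..S}) \<Longrightarrow> t \<in> {0..T} \<Longrightarrow> \<bar>y t\<bar> \<le> N"
proof -
  let ?q = "Nagumo_exponent p"
  have nn: "nonneg_ae T \<psi>" "nonneg_ae T v" using \<psi> v by (auto simp: nonneg_ae_def)
  obtain E1 C1 where E1: "E1 integrable_on {0..T}" "\<And>t. 0 \<le> E1 t" "0 \<le> C1"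
    "AE t in lebesgue_on {0..T}. \<forall>w>0. \<psi> t * w powr ?q \<le> E1 t + C1 * w"
    by (rule Lp_fun_Nagumo_bound[OF p \<psi>(1) nn(1)]) (rule that; assumption)
  obtain E2 C2 where E2: "E2 integrable_on {0..T}" "\<And>t. 0 \<le> E2 t" "0 \<le> C2"
    "AE t in lebesgue_on {0..T}. \<forall>w>0. v t * w powr ?q \<le> E2 t + C2 * w"
    by (rule Lp_fun_Nagumo_bound[OF p v(1) nn(2)]) (rule that; assumption)
  have "AE t in lebesgue_on {0..T}. \<forall>w>0. \<psi> t * w powr ?q + \<alpha>\<^sub>0 * (v t * w powr ?q)
      \<le> E1 t + \<alpha>\<^sub>0 * E2 t + (C1 + \<alpha>\<^sub>0 * C2) * w"
    using E1(4) E2(4)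
  proof eventually_elim
    case (elim t)
    show ?case
    proof (intro allI impI)
      fix w :: real assume "0 < w"
      with elim have 1: "\<psi> t * w powr ?q \<le> E1 t + C1 * w" "v t * w powr ?q \<le> E2 t + C2 * w" by auto
      from mult_left_mono[OF 1(2) al] 1(1)
      show "\<psi> t * w powr ?q + \<alpha>\<^sub>0 * (v t * w powr ?q) \<le> E1 t + \<alpha>\<^sub>0 * E2 t + (C1 + \<alpha>\<^sub>0 * C2) * w"
        by (simp add: algebra_simps)
    qed
  qed
  then obtain Z where Z: "negligible Z" "\<And>t w. t \<in> {0..T} - Z \<Longrightarrow> 0 < w \<Longrightarrow>
      \<psi> t * w powr ?q + \<alpha>\<^sub>0 * (v t * w powr ?q) \<le> E1 t + \<alpha>\<^sub>0 * E2 t + (C1 + \<alpha>\<^sub>0 * C2) * w"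
    using AE_lebesgue_on_negligible[of "{0..T}"] by auto
  define E where "E t = E1 t + \<alpha>\<^sub>0 * E2 t" for t
  define C where "C = C1 + \<alpha>\<^sub>0 * C2"
  have E: "E integrable_on {0..T}" "\<And>t. 0 \<le> E t" and C: "0 \<le> C"
    using E1 E2 al by (auto simp: E_def[abs_def] C_def intro!: integrable_add integrable_on_mult_right)
  \<comment> \<open>Large enough to dominate the mean slope and to force \<open>N > K\<close>, and
    strictly positive, so that the slope has no zero while it is at least \<open>m\<close>.\<close>
  define m where "m = max (S / T) K + 1"
  have "0 \<le> S / T" using S T by simp
  then have m: "m > 0" "m > S / T" "m > K" unfolding m_def by linarith+
  obtain N where N: "N > m" "integral {m..N} (\<lambda>\<xi>. \<xi> powr ?q / (\<phi> \<xi> + 1)) > integral {0..T} E + C * S"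
    using Nagumo_primitive_unbounded[OF \<phi> div lim m(1)] by blast
  have \<psi>i: "\<psi> integrable_on {0..T}" and vi: "v integrable_on {0..T}"
    using Lp_fun_imp_integrable[OF p] \<psi> v by (auto intro: integrable_on_lebesgue_on)
  show thesis
  proof (rule that)
    show "N > K" using N m by simp
    fix y t1
    assume y: "continuous_on {0..T} y"
      and inc: "\<And>s t. 0 \<le> s \<Longrightarrow> s \<le> t \<Longrightarrow> t \<le> T \<Longrightarrow>
        \<bar>y t - y s\<bar> \<le> integral {s..t} (\<lambda>\<tau>. \<psi> \<tau> * \<phi> (min \<bar>y \<tau>\<bar> N) + \<alpha>\<^sub>0 * v \<tau>)"
      and x: "\<And>t. t \<in> {0..T} \<Longrightarrow> integral {0..t} y \<in> {0..S}"
      and t1: "t1 \<in> {0..T}"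
    show "\<bar>y t1\<bar> \<le> N"
    proof (rule ccontr)
      assume "\<not> \<bar>y t1\<bar> \<le> N"
      then have big: "N \<le> \<bar>y t1\<bar>" by simp
      define x where "x t = integral {0..t} y" for t
      have "\<exists>t0\<in>{0..T}. x T - x 0 = (*) (y t0) (T - 0)"
      proof (rule mvt_very_simple)
        fix t assume "0 \<le> t" "t \<le> T"
        then show "(x has_derivative (*) (y t)) (at t within {0..T})"
          using integral_has_real_derivative[OF y, of t] unfolding x_def[abs_def]
          by (simp add: has_field_derivative_def)
      qed (use T in simp)
      then obtain t0 where t0: "t0 \<in> {0..T}" "x T = y t0 * T" by (auto simp: x_def)
      have "\<bar>y t0\<bar> = x T / T" using t0 T x[of T] by (simp add: x_def abs_of_nonneg zero_le_mult_iff)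
      also have "\<dots> \<le> m" using x[of T] T m(2) divide_right_mono[of "x T" S T] by (auto simp: x_def)
      finally have small: "\<bar>y t0\<bar> \<le> m" .
      have cY: "continuous_on {0..T} (\<lambda>t. \<bar>y t\<bar>)" using y by (intro continuous_intros)
      obtain c d where cd: "0 \<le> c" "c < d" "d \<le> T" "\<And>t. t \<in> {c..d} \<Longrightarrow> \<bar>y t\<bar> \<in> {m..N}"
          "\<bar>y c\<bar> = m \<and> \<bar>y d\<bar> = N \<or> \<bar>y c\<bar> = N \<and> \<bar>y d\<bar> = m"
        by (rule continuous_crossing_either_way[OF cY t0(1) t1 small N(1) big]) (rule that; assumption)
      have sub: "{c..d} \<subseteq> {0..T}" using cd by auto
      define e where "e \<tau> = \<psi> \<tau> * \<phi> (min \<bar>y \<tau>\<bar> N) + \<alpha>\<^sub>0 * v \<tau>" for \<tau>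
      define g where "g \<xi> = \<xi> powr ?q / (\<phi> \<xi> + 1)" for \<xi>
      define G where "G z = integral {m..z} g" for z
      have Npos: "0 < N" using N m by simp
      have cphi: "continuous_on {0..T} (\<lambda>\<tau>. \<phi> (min \<bar>y \<tau>\<bar> N))"
        using Npos by (intro continuous_on_compose2[OF \<phi>(1)] continuous_intros y) auto
      have e_int: "e integrable_on {0..T}"
        using continuous_mult_integrable[OF cphi \<psi>i \<psi>(2)] vi
        unfolding e_def by (auto intro!: integrable_add integrable_on_mult_right simp: mult.commute)
      have e0: "0 \<le> e t" for t
        unfolding e_def using \<phi>(2) Npos \<psi>(2) v(2) al by (intro add_nonneg_nonneg mult_nonneg_nonneg) auto
      have cg: "continuous_on {m..N} g"
        unfolding g_def using m(1) \<phi>(2)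
        by (intro continuous_intros continuous_on_subset[OF \<phi>(1)]) (auto simp: add_nonneg_eq_0_iff)
      have g0: "0 \<le> g z" if "z \<in> {m..N}" for z using that m \<phi>(2)[of z] by (auto simp: g_def)
      have main: "\<bar>G \<bar>y d\<bar> - G \<bar>y c\<bar>\<bar> \<le> integral {c..d} (\<lambda>t. g \<bar>y t\<bar> * e t)"
      proof (rule substitution_increment_le[where Y = "\<lambda>t. \<bar>y t\<bar>"])
        show "(G has_real_derivative g z) (at z within {m..N})" if "z \<in> {m..N}" for z
          unfolding G_def by (rule integral_has_real_derivative[OF cg that])
        show "\<bar>\<bar>y t\<bar> - \<bar>y s\<bar>\<bar> \<le> integral {s..t} e" if "c \<le> s" "s \<le> t" "t \<le> d" for s t
          using inc[of s t] that cd unfolding e_def[abs_def] by linarith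
        show "continuous_on {c..d} (\<lambda>t. \<bar>y t\<bar>)" using cY sub by (rule continuous_on_subset)
        show "(\<lambda>t. \<bar>y t\<bar>) ` {c..d} \<subseteq> {m..N}" using cd(4) by blast
        show "e integrable_on {c..d}" using integrable_on_subinterval[OF e_int sub] .
      qed (use cd cg g0 e0 in auto)
      have GN: "G N > integral {0..T} E + C * S" using N by (simp add: G_def g_def[abs_def])
      have "G m = 0" by (simp add: G_def)
      then have "G N \<le> \<bar>G \<bar>y d\<bar> - G \<bar>y c\<bar>\<bar>" using cd(5) by auto
      also note main
      also have "integral {c..d} (\<lambda>t. g \<bar>y t\<bar> * e t) \<le> integral {c..d} (\<lambda>t. E t + C * \<bar>y t\<bar>)"
      proof (rule integral_le_off_negligible[OF _ _ Z(1)])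
        show "(\<lambda>t. g \<bar>y t\<bar> * e t) integrable_on {c..d}"
        proof (rule continuous_mult_integrable)
          show "continuous_on {c..d} (\<lambda>t. g \<bar>y t\<bar>)"
            by (rule continuous_on_compose2[OF cg continuous_on_subset[OF cY sub]]) (use cd(4) in blast)
        qed (use integrable_on_subinterval[OF e_int sub] e0 in auto)
        show "(\<lambda>t. E t + C * \<bar>y t\<bar>) integrable_on {c..d}"
          using integrable_on_subinterval[OF E(1) sub] continuous_on_subset[OF cY sub]
          by (intro integrable_add integrable_on_mult_right) (auto intro: integrable_continuous_real)
        fix t assume t: "t \<in> {c..d} - Z"
        let ?w = "\<bar>y t\<bar>"
        have w: "m \<le> ?w" "?w \<le> N" using cd(4)[of t] t by auto
        have ph: "0 \<le> \<phi> ?w" using \<phi>(2) by simp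
        \<comment> \<open>The denominator of \<open>g\<close> absorbs the factor \<phi> of the
          Nagumo term, and the power left over is what the pointwise bound for \<psi> and
          \<open>v\<close> takes in.\<close>
        have "g ?w * e t = ?w powr ?q / (\<phi> ?w + 1) * (\<psi> t * \<phi> ?w) + ?w powr ?q / (\<phi> ?w + 1) * (\<alpha>\<^sub>0 * v t)"
          using w by (simp add: g_def e_def distrib_left)
        also have "?w powr ?q / (\<phi> ?w + 1) * (\<psi> t * \<phi> ?w) = (\<psi> t * ?w powr ?q) * (\<phi> ?w / (\<phi> ?w + 1))"
          by simp
        also have "\<dots> \<le> (\<psi> t * ?w powr ?q) * 1"
          using ph \<psi>(2)[of t] by (intro mult_left_mono) auto
        also have "?w powr ?q / (\<phi> ?w + 1) * (\<alpha>\<^sub>0 * v t) = (\<alpha>\<^sub>0 * (v t * ?w powr ?q)) * (1 / (\<phi> ?w + 1))"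
          by simp
        also have "\<dots> \<le> (\<alpha>\<^sub>0 * (v t * ?w powr ?q)) * 1"
          using ph v(2)[of t] al by (intro mult_left_mono) auto
        also have "(\<psi> t * ?w powr ?q) * 1 + (\<alpha>\<^sub>0 * (v t * ?w powr ?q)) * 1 \<le> E t + C * ?w"
          using Z(2)[of t ?w] t sub w m by (auto simp: E_def C_def)
        finally show "g ?w * e t \<le> E t + C * ?w" by simp
      qed
      also have "\<dots> = integral {c..d} E + C * integral {c..d} (\<lambda>t. \<bar>y t\<bar>)"
        using integrable_on_subinterval[OF E(1) sub] continuous_on_subset[OF cY sub]
        by (subst integral_add) (auto intro: integrable_on_mult_right integrable_continuous_real)
      also have "integral {c..d} (\<lambda>t. \<bar>y t\<bar>) = \<bar>integral {c..d} y\<bar>"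
      proof (rule integral_abs_const_sign)
        show "y t \<noteq> 0" if "t \<in> {c..d}" for t using cd(4)[OF that] m by auto
      qed (rule continuous_on_subset[OF y sub])
      also have "integral {c..d} y = x d - x c"
      proof -
        have "y integrable_on {0..d}" using y sub cd
          by (intro integrable_continuous_real continuous_on_subset[OF y]) auto
        then have "integral {0..c} y + integral {c..d} y = integral {0..d} y"
          using cd by (intro Henstock_Kurzweil_Integration.integral_combine) auto
        then show ?thesis by (simp add: x_def)
      qed
      also have "C * \<bar>x d - x c\<bar> \<le> C * S"
        using x[of c] x[of d] cd C by (intro mult_left_mono) (auto simp: x_def)
      also have "integral {c..d} E \<le> integral {0..T} E"
        using E integrable_on_subinterval[OF E(1) sub] by (intro integral_subset_le sub) auto
      finally show False using GN by simp
    qed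
  qed
qed

subsection \<open>Positivity\<close>

lemma small_integral_near:
  fixes k :: "real \<Rightarrow> real"
  assumes "k integrable_on {a..b}" "t0 \<in> {a..b}" "e > 0"
  obtains d where "d > 0"
    "\<And>t. t \<in> {a..b} \<Longrightarrow> \<bar>t - t0\<bar> < d \<Longrightarrow> \<bar>integral {a..t} k - integral {a..t0} k\<bar> < e"
proof -
  obtain d where "d > 0" "\<forall>t\<in>{a..b}. dist t t0 < d \<longrightarrow> dist (integral {a..t} k) (integral {a..t0} k) < e"
    using indefinite_integral_continuous_1[OF assms(1)] assms(2,3) unfolding continuous_on_iff by blast
  then show thesis by (intro that[of d]) (auto simp: dist_real_def)
qed

text \<open>Gronwall's argument on a short interval: where \<open>k\<close> has integral at most
  \<open>1 / 2\<close>, the maximum of \<open>z\<close> is at most half of itself, hence 0. The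
  argument runs on both sides of \<open>t0\<close>.\<close>

lemma sublinear_bound_imp_locally_zero:
  fixes z k :: "real \<Rightarrow> real"
  assumes z: "continuous_on {0..T} z" "\<And>t. t \<in> {0..T} \<Longrightarrow> 0 \<le> z t"
    and k: "k integrable_on {0..T}" "\<And>t. t \<in> {0..T} \<Longrightarrow> 0 \<le> k t"
    and t0: "t0 \<in> {0..T}" "z t0 = 0" and \<rho>: "\<rho> > 0"
    and inc: "\<And>s t c. 0 \<le> s \<Longrightarrow> s \<le> t \<Longrightarrow> t \<le> T \<Longrightarrow> 0 \<le> c \<Longrightarrow> c \<le> \<rho> \<Longrightarrow>
       (\<And>\<tau>. \<tau> \<in> {s..t} \<Longrightarrow> z \<tau> \<le> c) \<Longrightarrow> \<bar>z t - z s\<bar> \<le> c * integral {s..t} k"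
  obtains d where "d > 0" "\<And>t. t \<in> {0..T} \<Longrightarrow> \<bar>t - t0\<bar> < d \<Longrightarrow> z t = 0"
proof -
  obtain d1 where d1: "d1 > 0" "\<And>t. t \<in> {0..T} \<Longrightarrow> \<bar>t - t0\<bar> < d1 \<Longrightarrow> \<bar>z t - z t0\<bar> < \<rho>"
    using z(1) t0(1) \<rho> unfolding continuous_on_iff dist_real_def by metis
  obtain d2 where d2: "d2 > 0"
    "\<And>t. t \<in> {0..T} \<Longrightarrow> \<bar>t - t0\<bar> < d2 \<Longrightarrow> \<bar>integral {0..t} k - integral {0..t0} k\<bar> < 1 / 2"
    using small_integral_near[OF k(1) t0(1), of "1 / 2"] by auto
  \<comment> \<open>Halved so that the closed interval \<open>J\<close> of radius \<open>d\<close>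
    still lies inside both open neighbourhoods.\<close>
  define d where "d = min d1 d2 / 2"
  have d: "d > 0" "d < d1" "d < d2" using d1 d2 by (auto simp: d_def min_def)
  define J where "J = {max 0 (t0 - d)..min T (t0 + d)}"
  have J: "J \<subseteq> {0..T}" "t0 \<in> J" "J \<noteq> {}" "compact J" using d t0 by (auto simp: J_def)
  obtain m where m: "m \<in> J" "\<And>t. t \<in> J \<Longrightarrow> z t \<le> z m"
    using continuous_attains_sup[OF J(4,3) continuous_on_subset[OF z(1) J(1)]] by blast
  have mT: "m \<in> {0..T}" using m(1) J(1) by blast
  have md: "\<bar>m - t0\<bar> < d1" "\<bar>m - t0\<bar> < d2" using m(1) d by (auto simp: J_def)
  have zm: "0 \<le> z m" "z m \<le> \<rho>" using d1(2)[OF mT md(1)] z(2)[OF mT] t0 by auto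
  have diff: "integral {s..t} k = integral {0..t} k - integral {0..s} k" if "0 \<le> s" "s \<le> t" "t \<le> T" for s t
  proof -
    have "k integrable_on {0..t}" using integrable_on_subinterval[OF k(1)] that by auto
    then show ?thesis
      using Henstock_Kurzweil_Integration.integral_combine[of 0 s t k] that by simp
  qed
  have "z m \<le> z m * (1 / 2)"
  proof (cases "t0 \<le> m")
    case True
    have "\<bar>z m - z t0\<bar> \<le> z m * integral {t0..m} k"
      using True mT t0 zm m J(2) by (intro inc m(2)) (auto simp: J_def)
    also have "integral {t0..m} k \<le> 1 / 2"
    proof -
      have "integral {t0..m} k = integral {0..m} k - integral {0..t0} k"
        using True mT t0 by (intro diff) auto
      then show ?thesis using d2(2)[OF mT md(2)] by linarith
    qed
    finally show ?thesis using t0 zm by (simp add: mult_left_mono)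
  next
    case False
    have "\<bar>z t0 - z m\<bar> \<le> z m * integral {m..t0} k"
      using False mT t0 zm m J(2) by (intro inc m(2)) (auto simp: J_def)
    also have "integral {m..t0} k \<le> 1 / 2"
    proof -
      have "integral {m..t0} k = integral {0..t0} k - integral {0..m} k"
        using False mT t0 by (intro diff) auto
      then show ?thesis using d2(2)[OF mT md(2)] by linarith
    qed
    finally show ?thesis using t0 zm by (simp add: mult_left_mono)
  qed
  then have "z m = 0" using zm by simp
  then have "z t = 0" if "t \<in> {0..T}" "\<bar>t - t0\<bar> < d" for t
  proof -
    have "t \<in> J" using that unfolding J_def by (simp; linarith)
    then show ?thesis using m(2)[of t] z(2)[OF that(1)] \<open>z m = 0\<close> by simp
  qed
  then show thesis using that d(1) by blast
qed

text \<open>The zero set is closed by continuity, relatively open by \<open>loc\<close> and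
  non-empty, so connectedness makes it the whole interval.\<close>

lemma locally_zero_imp_zero:
  fixes z :: "real \<Rightarrow> real"
  assumes z: "continuous_on {0..T} z" and t0: "t0 \<in> {0..T}" "z t0 = 0"
    and loc: "\<And>t. t \<in> {0..T} \<Longrightarrow> z t = 0 \<Longrightarrow> \<exists>d>0. \<forall>s\<in>{0..T}. \<bar>s - t\<bar> < d \<longrightarrow> z s = 0"
    and t: "t \<in> {0..T}"
  shows "z t = 0"
proof -
  let ?Z = "{t \<in> {0..T}. z t = 0}"
  have "closedin (top_of_set {0..T}) ?Z"
    using continuous_closedin_preimage_constant[OF z] .
  moreover have "openin (top_of_set {0..T}) ?Z"
    unfolding openin_euclidean_subtopology_iff dist_real_def
  proof (intro conjI ballI)
    fix t assume "t \<in> ?Z"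
    then show "\<exists>e>0. \<forall>x'\<in>{0..T}. \<bar>x' - t\<bar> < e \<longrightarrow> x' \<in> ?Z"
      using loc[of t] by auto
  qed auto
  ultimately have "?Z = {} \<or> ?Z = {0..T}"
    using connected_clopen[of "{0..T}"] by auto
  then show ?thesis using t0 t by blast
qed

text \<open>A common zero of \<open>x\<close> and \<open>y\<close> would make \<open>x\<close>
  vanish identically, by the sublinear bound. At an interior zero the nonnegative \<open>x\<close>
  has a minimum, hence \<open>y = 0\<close> there. If \<open>x\<close> vanishes at \<open>T\<close>,
  then \<open>y T \<le> 0 \<le> y 0\<close>, and the boundary condition \<open>y T = y 0\<close>
  yields a common zero at 0.\<close>

lemma nonneg_solution_pos:
  fixes H k x y :: "real \<Rightarrow> real" and a \<theta> \<rho> T t :: real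
  assumes T: "T > 0" and H: "H integrable_on {0..T}" "integral {0..T} H = 0"
    and y_def: "y = (\<lambda>t. a - \<theta> * integral {0..t} H)"
    and x_def: "x = (\<lambda>t. integral {0..t} y)"
    and \<theta>: "\<theta> \<in> {0..1}"
    and x0: "\<And>t. t \<in> {0..T} \<Longrightarrow> 0 \<le> x t"
    and k: "k integrable_on {0..T}" "\<And>t. t \<in> {0..T} \<Longrightarrow> 0 \<le> k t" and \<rho>: "\<rho> > 0"
    and Hk: "\<And>t. t \<in> {0..T} \<Longrightarrow> x t \<le> \<rho> \<Longrightarrow> \<bar>y t\<bar> \<le> \<rho> \<Longrightarrow> \<bar>H t\<bar> \<le> k t * (\<bar>x t\<bar> + \<bar>y t\<bar>)"
    and nz: "\<exists>t\<in>{0..T}. x t \<noteq> 0"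
    and t: "t \<in> {0<..T}"
  shows "x t > 0"
proof (rule ccontr)
  assume "\<not> x t > 0"
  moreover have "0 \<le> x t" using t by (intro x0) auto
  ultimately have xt: "x t = 0" by simp
  have cy: "continuous_on {0..T} y"
    unfolding y_def by (intro continuous_intros indefinite_integral_continuous_1 H)
  have dx: "(x has_real_derivative y t) (at t within {0..T})" if "t \<in> {0..T}" for t
    unfolding x_def by (rule integral_has_real_derivative[OF cy that])
  have cx: "continuous_on {0..T} x"
    using dx by (rule DERIV_continuous_on)
  define z where "z t = \<bar>x t\<bar> + \<bar>y t\<bar>" for t
  have cz: "continuous_on {0..T} z" unfolding z_def by (intro continuous_intros cx cy)
  \<comment> \<open>The summand \<open>k\<close> comes from the equation for \<open>y\<close>, the
    summand 1 from \<open>x' = y\<close>.\<close>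
  have inc: "\<bar>z t - z s\<bar> \<le> c * integral {s..t} (\<lambda>\<tau>. k \<tau> + 1)"
    if st: "0 \<le> s" "s \<le> t" "t \<le> T" and c: "0 \<le> c" "c \<le> \<rho>" "\<And>\<tau>. \<tau> \<in> {s..t} \<Longrightarrow> z \<tau> \<le> c" for s t c
  proof -
    have sub: "{s..t} \<subseteq> {0..T}" using st by auto
    have yi: "y integrable_on {0..t}" "y integrable_on {s..t}"
      using st by (auto intro!: integrable_continuous_real continuous_on_subset[OF cy])
    have Hi: "H integrable_on {0..t}" "H integrable_on {s..t}"
      using st by (auto intro!: integrable_on_subinterval[OF H(1)])
    have ki: "k integrable_on {s..t}" by (rule integrable_on_subinterval[OF k(1) sub])
    have "x t - x s = integral {s..t} y"
      using Henstock_Kurzweil_Integration.integral_combine[OF st(1,2) yi(1)] by (simp add: x_def)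
    also have "\<bar>\<dots>\<bar> \<le> integral {s..t} (\<lambda>_. c)"
      unfolding real_norm_def[symmetric]
    proof (rule integral_norm_bound_integral[OF yi(2)])
      show "norm (y \<tau>) \<le> c" if "\<tau> \<in> {s..t}" for \<tau> using c(3)[OF that] by (simp add: z_def)
    qed auto
    finally have 1: "\<bar>x t - x s\<bar> \<le> integral {s..t} (\<lambda>_. c)" .
    have "y t - y s = - (\<theta> * integral {s..t} H)"
      unfolding y_def
      by (simp add: algebra_simps flip: Henstock_Kurzweil_Integration.integral_combine[OF st(1,2) Hi(1)])
    then have "\<bar>y t - y s\<bar> = \<theta> * \<bar>integral {s..t} H\<bar>" using \<theta> by (simp add: abs_mult)
    also have "\<dots> \<le> 1 * \<bar>integral {s..t} H\<bar>" using \<theta> by (intro mult_right_mono) auto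
    also have "\<bar>integral {s..t} H\<bar> \<le> integral {s..t} (\<lambda>\<tau>. c * k \<tau>)"
      unfolding real_norm_def[symmetric]
    proof (rule integral_norm_bound_integral[OF Hi(2)])
      fix \<tau> assume \<tau>: "\<tau> \<in> {s..t}"
      then have \<tau>T: "\<tau> \<in> {0..T}" using sub by blast
      have "\<bar>x \<tau>\<bar> + \<bar>y \<tau>\<bar> \<le> c" using c(3)[OF \<tau>] by (simp add: z_def)
      then have "\<bar>H \<tau>\<bar> \<le> k \<tau> * (\<bar>x \<tau>\<bar> + \<bar>y \<tau>\<bar>)" using c(2) by (intro Hk \<tau>T) auto
      also have "\<dots> \<le> k \<tau> * c" using k(2)[OF \<tau>T] \<open>\<bar>x \<tau>\<bar> + \<bar>y \<tau>\<bar> \<le> c\<close> by (intro mult_left_mono)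
      finally show "norm (H \<tau>) \<le> c * k \<tau>" by (simp add: mult.commute)
    qed (use ki in \<open>auto intro: integrable_on_mult_right\<close>)
    finally have 2: "\<bar>y t - y s\<bar> \<le> integral {s..t} (\<lambda>\<tau>. c * k \<tau>)" by simp
    have "\<bar>z t - z s\<bar> \<le> \<bar>x t - x s\<bar> + \<bar>y t - y s\<bar>" unfolding z_def by linarith
    also have "\<dots> \<le> integral {s..t} (\<lambda>_. c) + integral {s..t} (\<lambda>\<tau>. c * k \<tau>)" using 1 2 by linarith
    also have "\<dots> = c * integral {s..t} (\<lambda>\<tau>. k \<tau> + 1)"
      using ki st by (subst integral_add) (auto simp: algebra_simps)
    finally show ?thesis .
  qed
  have loc: "\<exists>d>0. \<forall>s\<in>{0..T}. \<bar>s - t\<bar> < d \<longrightarrow> z s = 0" if "t \<in> {0..T}" "z t = 0" for t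
  proof -
    have k1: "(\<lambda>\<tau>. k \<tau> + 1) integrable_on {0..T}" using k(1) by (intro integrable_add) auto
    show ?thesis
    proof (rule sublinear_bound_imp_locally_zero[OF cz _ k1 _ that \<rho>])
      show "\<bar>z t - z s\<bar> \<le> c * integral {s..t} (\<lambda>\<tau>. k \<tau> + 1)"
        if "0 \<le> s" "s \<le> t" "t \<le> T" "0 \<le> c" "c \<le> \<rho>" "\<And>\<tau>. \<tau> \<in> {s..t} \<Longrightarrow> z \<tau> \<le> c" for s t c
        by (rule inc[OF that])
      show "0 \<le> z t" for t by (simp add: z_def)
      show "0 \<le> k t + 1" if "t \<in> {0..T}" for t using k(2)[OF that] by simp
    qed blast
  qed
  have no_zero: False if "s \<in> {0..T}" "x s = 0" "y s = 0" for s
  proof -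
    have zs: "z s = 0" using that by (simp add: z_def)
    obtain t where t: "t \<in> {0..T}" "x t \<noteq> 0" using nz by blast
    have "z t = 0" by (rule locally_zero_imp_zero[OF cz that(1) zs loc t(1)])
    then show False using t(2) by (simp add: z_def add_nonneg_eq_0_iff)
  qed
  have x_0: "x 0 = 0" by (simp add: x_def)
  show False
  proof (cases "t = T")
    case False
    then have t': "t \<in> {0<..<T}" using t by auto
    have "(x has_real_derivative y t) (at t)"
      using dx[of t] at_within_Icc_at[of 0 t T] t' by simp
    moreover have "0 < min t (T - t)" using t' by auto
    moreover have "\<forall>s. \<bar>t - s\<bar> < min t (T - t) \<longrightarrow> x t \<le> x s"
    proof (intro allI impI)
      fix s assume "\<bar>t - s\<bar> < min t (T - t)"
      then have "s \<in> {0..T}" by (simp; linarith)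
      then show "x t \<le> x s" using xt x0 by simp
    qed
    ultimately have "y t = 0" by (rule DERIV_local_min)
    then show False using no_zero[of t] t xt by auto
  next
    case True
    have "((\<lambda>s. (x s - x 0) / (s - 0)) \<longlongrightarrow> y 0) (at 0 within {0..T})"
      using dx[of 0] T by (simp add: has_field_derivative_iff)
    then have y0: "0 \<le> y 0"
    proof (rule tendsto_lowerbound)
      show "\<forall>\<^sub>F s in at 0 within {0..T}. 0 \<le> (x s - x 0) / (s - 0)"
        unfolding eventually_at_filter using x_0 x0 by (auto intro!: always_eventually divide_nonneg_nonneg)
    qed (use T in \<open>simp add: trivial_limit_within\<close>)
    have "((\<lambda>s. (x s - x T) / (s - T)) \<longlongrightarrow> y T) (at T within {0..T})"
      using dx[of T] T by (simp add: has_field_derivative_iff)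
    then have yT: "y T \<le> 0"
    proof (rule tendsto_upperbound)
      show "\<forall>\<^sub>F s in at T within {0..T}. (x s - x T) / (s - T) \<le> 0"
        unfolding eventually_at_filter using xt True x0 by (auto intro!: always_eventually divide_nonneg_nonpos)
    qed (use T in \<open>simp add: trivial_limit_within\<close>)
    have "y T = y 0" using H(2) by (simp add: y_def)
    then show False using no_zero[of 0] x_0 y0 yT T by auto
  qed
qed

subsection \<open>Discretisation and continuation\<close>

text \<open>
  A replacement for the homotopy invariance of the degree: with \<open>c\<close> an Urysohn function that is
  \<open>l1\<close> on the zeros in \<open>K\<close> and \<open>l0\<close> on those in \<open>K'\<close>, a Brouwer fixed point of
  \<open>(a, l) \<mapsto> (a + P (a, l), c (a, l))\<close> (first component clamped) is a zero of \<open>P\<close> at level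
  \<open>l1\<close> in \<open>K\<close> or at level \<open>l0\<close> in \<open>K'\<close>.
\<close>

lemma planar_continuation:
  fixes P :: "real \<times> real \<Rightarrow> real"
  assumes le: "a0 \<le> a1" "l0 \<le> l1"
    and P: "continuous_on ({a0..a1} \<times> {l0..l1}) P"
    and left: "\<And>l. l \<in> {l0..l1} \<Longrightarrow> P (a0, l) > 0"
    and right: "\<And>l. l \<in> {l0..l1} \<Longrightarrow> P (a1, l) < 0"
    and K: "closed K" and K': "closed K'"
    and disj: "\<And>x. x \<in> {a0..a1} \<times> {l0..l1} \<Longrightarrow> P x = 0 \<Longrightarrow> x \<in> K \<Longrightarrow> x \<in> K' \<Longrightarrow> False"
    and cover: "\<And>x. x \<in> {a0..a1} \<times> {l0..l1} \<Longrightarrow> P x = 0 \<Longrightarrow> x \<in> K \<or> x \<in> K'"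
    and top: "\<And>a. a \<in> {a0..a1} \<Longrightarrow> P (a, l1) = 0 \<Longrightarrow> (a, l1) \<in> K \<Longrightarrow> False"
    and bot: "\<And>a. a \<in> {a0..a1} \<Longrightarrow> P (a, l0) = 0 \<Longrightarrow> (a, l0) \<in> K' \<Longrightarrow> False"
  shows False
proof -
  define Q where "Q = {a0..a1} \<times> {l0..l1}"
  have Q: "compact Q" "convex Q" "Q \<noteq> {}" "closed Q"
    using le by (auto simp: Q_def compact_Times convex_Times closed_Times)
  define Z where "Z = {x \<in> Q. P x = 0}"
  have Z: "closed Z"
    using continuous_closed_preimage_constant[of Q P 0] P Q(4) by (simp add: Z_def Q_def)
  have "(Z \<inter> K) \<inter> (Z \<inter> K') = {}"
    using disj by (auto simp: Z_def Q_def)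
  then obtain c :: "real \<times> real \<Rightarrow> real" where c: "continuous_on UNIV c"
      "\<And>x. c x \<in> closed_segment l1 l0" "\<And>x. x \<in> Z \<inter> K \<Longrightarrow> c x = l1" "\<And>x. x \<in> Z \<inter> K' \<Longrightarrow> c x = l0"
    using Urysohn[of "Z \<inter> K" "Z \<inter> K'" l1 l0] closed_Int[OF Z K] closed_Int[OF Z K'] by blast
  have c_range: "c x \<in> {l0..l1}" for x
    using c(2)[of x] le closed_segment_eq_real_ivl[of l1 l0] by (auto split: if_splits)
  define h where "h x = (max a0 (min a1 (fst x + P x)), c x)" for x
  have "continuous_on Q h"
    unfolding h_def using P continuous_on_subset[OF c(1)]
    by (intro continuous_intros) (auto simp: Q_def)
  moreover have "h \<in> Q \<rightarrow> Q"
    using c_range le by (auto simp: h_def Q_def)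
  ultimately obtain x where x: "x \<in> Q" "h x = x"
    using brouwer Q by blast
  obtain a l where [simp]: "x = (a, l)" by force
  have al: "a \<in> {a0..a1}" "l \<in> {l0..l1}" using x by (auto simp: Q_def)
  have fa: "max a0 (min a1 (a + P (a, l))) = a" and fl: "c (a, l) = l"
    using x(2) by (auto simp: h_def)
  \<comment> \<open>Clamping creates no false fixed point: on the sides \<open>a = a0\<close> and
    \<open>a = a1\<close> the sign of \<open>P\<close> points into the rectangle.\<close>
  have "P (a, l) = 0"
    using fa al left[of l] right[of l] by (cases "a = a0"; cases "a = a1") (auto simp: max_def min_def split: if_splits)
  with al cover[of x] top[of a] bot[of a] c(3)[of x] c(4)[of x] fl show False
    by (auto simp: Z_def Q_def)
qed

text \<open>The conditions hold at every \<open>t\<close>, the exceptional null set being removed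
  beforehand by redefining the nonlinearity. \<open>F_le\<close> bounds it by one integrable
  function for all states, so slopes stay in a known range around the initial one.
  \<open>F_neg\<close> makes it positive below \<open>s = 0\<close> and zero at
  \<open>s = 0\<close>, and thereby keeps periodic solutions nonnegative.\<close>

locale truncated_problem =
  fixes T :: real and F :: "real \<Rightarrow> real \<Rightarrow> real \<Rightarrow> real" and g v :: "real \<Rightarrow> real" and \<alpha>\<^sub>0 :: real
  assumes T: "T > 0"
    and F_measurable: "\<And>s \<xi>. (\<lambda>t. F t s \<xi>) \<in> borel_measurable (lebesgue_on {0..T})"
    and F_continuous: "\<And>t. t \<in> {0..T} \<Longrightarrow> continuous_on UNIV (\<lambda>(s, \<xi>). F t s \<xi>)"
    and g: "g integrable_on {0..T}"
    and F_le: "\<And>t s \<xi>. t \<in> {0..T} \<Longrightarrow> \<bar>F t s \<xi>\<bar> \<le> g t"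
    and F_neg: "\<And>t s \<xi>. t \<in> {0..T} \<Longrightarrow> s \<le> 0 \<Longrightarrow> F t s \<xi> = min (- s) 1"
    and v: "v integrable_on {0..T}"
    and v_nonneg: "\<And>t. 0 \<le> v t"
    and al0: "\<alpha>\<^sub>0 \<ge> 0"
begin

section \<open>The semi-implicit Euler scheme\<close>

definition node :: "nat \<Rightarrow> nat \<Rightarrow> real" where
  "node n i = real i * T / real n"

text \<open>\<open>F\<close> is only measurable in \<open>t\<close>, so sampling at nodes would be
  meaningless. The state is frozen on a cell and the right-hand side is integrated exactly in
  \<open>t\<close>.\<close>

definition incr :: "nat \<Rightarrow> nat \<Rightarrow> real \<Rightarrow> real \<Rightarrow> real \<Rightarrow> real" where
  "incr n i \<alpha> u w = integral {node n i..node n (Suc i)} (\<lambda>t. F t u w + \<alpha> * v t)"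

text \<open>
  The step is semi-implicit: \<open>u\<close> is advanced with the new slope. Hence, when \<open>u\<close> becomes
  negative, so is the slope, and both remain negative up to \<open>T\<close>. With the explicit Euler
  scheme this discrete maximum principle would fail.
\<close>

primrec euler :: "nat \<Rightarrow> real \<Rightarrow> real \<Rightarrow> real \<Rightarrow> nat \<Rightarrow> real \<times> real" where
  "euler n \<theta> \<alpha> a 0 = (0, a)"
| "euler n \<theta> \<alpha> a (Suc i) =
     (let u = fst (euler n \<theta> \<alpha> a i); w = snd (euler n \<theta> \<alpha> a i); w' = w - \<theta> * incr n i \<alpha> u w
      in (u + T / real n * w', w'))"

definition U :: "nat \<Rightarrow> real \<Rightarrow> real \<Rightarrow> real \<Rightarrow> nat \<Rightarrow> real" where
  "U n \<theta> \<alpha> a i = fst (euler n \<theta> \<alpha> a i)"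

definition W :: "nat \<Rightarrow> real \<Rightarrow> real \<Rightarrow> real \<Rightarrow> nat \<Rightarrow> real" where
  "W n \<theta> \<alpha> a i = snd (euler n \<theta> \<alpha> a i)"

text \<open>
  The boundary condition \<open>u'(T) = u'(0) = a\<close> becomes \<open>\<theta> * P = 0\<close>; dividing by \<open>\<theta>\<close> retains
  the bifurcation equation \<open>P = 0\<close> at \<open>\<theta> = 0\<close>.
\<close>

definition P :: "nat \<Rightarrow> real \<Rightarrow> real \<Rightarrow> real \<Rightarrow> real" where
  "P n \<theta> \<alpha> a = (\<Sum>i<n. incr n i \<alpha> (U n \<theta> \<alpha> a i) (W n \<theta> \<alpha> a i))"

text \<open>The recursion lets continuity in the parameters follow from continuity of
  \<open>max\<close> by induction.\<close>

primrec M :: "nat \<Rightarrow> real \<Rightarrow> real \<Rightarrow> real \<Rightarrow> nat \<Rightarrow> real" where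
  "M n \<theta> \<alpha> a 0 = 0"
| "M n \<theta> \<alpha> a (Suc i) = max (M n \<theta> \<alpha> a i) \<bar>U n \<theta> \<alpha> a (Suc i)\<bar>"

lemma U_0 [simp]: "U n \<theta> \<alpha> a 0 = 0"
  and W_0 [simp]: "W n \<theta> \<alpha> a 0 = a"
  by (simp_all add: U_def W_def)

lemma W_Suc: "W n \<theta> \<alpha> a (Suc i) = W n \<theta> \<alpha> a i - \<theta> * incr n i \<alpha> (U n \<theta> \<alpha> a i) (W n \<theta> \<alpha> a i)"
  and U_Suc: "U n \<theta> \<alpha> a (Suc i) = U n \<theta> \<alpha> a i + T / real n * W n \<theta> \<alpha> a (Suc i)"
  by (simp_all add: U_def W_def Let_def)

lemma W_eq: "W n \<theta> \<alpha> a i = a - \<theta> * (\<Sum>j<i. incr n j \<alpha> (U n \<theta> \<alpha> a j) (W n \<theta> \<alpha> a j))"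
  by (induction i) (simp_all add: W_Suc algebra_simps)

lemma W_n: "W n \<theta> \<alpha> a n = a - \<theta> * P n \<theta> \<alpha> a"
  by (simp add: W_eq[of n \<theta> \<alpha> a n] P_def)

lemma U_eq: "U n \<theta> \<alpha> a i = (\<Sum>j<i. T / real n * W n \<theta> \<alpha> a (Suc j))"
  by (induction i) (simp_all add: U_Suc)

lemma U_le_M: "j \<le> i \<Longrightarrow> \<bar>U n \<theta> \<alpha> a j\<bar> \<le> M n \<theta> \<alpha> a i"
  by (induction i) (auto simp: le_Suc_eq max.coboundedI1)

lemma M_attained: "\<exists>j\<le>i. M n \<theta> \<alpha> a i = \<bar>U n \<theta> \<alpha> a j\<bar>"
proof (induction i)
  case (Suc i)
  then obtain j where "j \<le> i" "M n \<theta> \<alpha> a i = \<bar>U n \<theta> \<alpha> a j\<bar>" by blast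
  then show ?case
    by (cases "M n \<theta> \<alpha> a i \<le> \<bar>U n \<theta> \<alpha> a (Suc i)\<bar>") (auto simp: max_def intro: le_SucI)
qed simp

lemma node_0 [simp]: "node n 0 = 0"
  by (simp add: node_def)

lemma node_n: "n > 0 \<Longrightarrow> node n n = T"
  by (simp add: node_def)

lemma node_mono: "i \<le> j \<Longrightarrow> node n i \<le> node n j"
  using T by (simp add: node_def divide_right_mono)

lemma node_nonneg: "0 \<le> node n i"
  using T by (simp add: node_def)

lemma node_le: "i \<le> n \<Longrightarrow> node n i \<le> T"
  using T by (cases "n = 0") (auto simp: node_def field_simps)

lemma node_Suc: "node n (Suc i) = node n i + T / real n"
  by (simp add: node_def algebra_simps add_divide_distrib)

lemma cell_subset: "i < n \<Longrightarrow> {node n i..node n (Suc i)} \<subseteq> {0..T}"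
  using node_nonneg[of n i] node_le[of "Suc i" n] by auto

section \<open>Bounds independent of the step number\<close>

lemma F_integrable: "(\<lambda>t. F t u w) integrable_on {0..T}"
  by (rule measurable_bounded_by_integrable_imp_integrable_real[OF F_measurable g F_le]) auto

lemma rhs_integrable: "{c..d} \<subseteq> {0..T} \<Longrightarrow> (\<lambda>t. F t u w + \<alpha> * v t) integrable_on {c..d}"
  using integrable_on_subinterval[OF F_integrable] integrable_on_subinterval[OF v]
  by (intro integrable_add integrable_on_mult_right) auto

text \<open>One dominating function for all admissible \<alpha>. It provides the bounds on the
  scheme, the modulus of equicontinuity and the majorant for the limit.\<close>

definition bnd :: "real \<Rightarrow> real" where "bnd t = g t + \<alpha>\<^sub>0 * v t"

lemma bnd: "bnd integrable_on {0..T}" "t \<in> {0..T} \<Longrightarrow> 0 \<le> bnd t"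
proof -
  show "bnd integrable_on {0..T}"
    unfolding bnd_def using g v by (intro integrable_add integrable_on_mult_right)
  show "0 \<le> bnd t" if "t \<in> {0..T}"
    using F_le[OF that, of 0 0] v_nonneg[of t] al0 by (simp add: bnd_def)
qed

lemma rhs_le:
  assumes "t \<in> {0..T}" "\<alpha> \<in> {0..\<alpha>\<^sub>0}"
  shows "\<bar>F t u w + \<alpha> * v t\<bar> \<le> bnd t"
proof -
  have "\<bar>F t u w + \<alpha> * v t\<bar> \<le> \<bar>F t u w\<bar> + \<bar>\<alpha> * v t\<bar>" by (rule abs_triangle_ineq)
  also have "\<dots> \<le> g t + \<alpha>\<^sub>0 * v t"
    using F_le[OF assms(1)] v_nonneg[of t] assms(2) by (intro add_mono) (auto simp: abs_mult mult_right_mono)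
  finally show ?thesis by (simp add: bnd_def)
qed

lemma incr_le:
  assumes "i < n" "\<alpha> \<in> {0..\<alpha>\<^sub>0}"
  shows "\<bar>incr n i \<alpha> u w\<bar> \<le> integral {node n i..node n (Suc i)} bnd"
  unfolding incr_def real_norm_def[symmetric]
  using cell_subset[OF assms(1)] rhs_le[OF _ assms(2)]
  by (intro integral_norm_bound_integral rhs_integrable integrable_on_subinterval[OF bnd(1)]) auto

lemma integral_cells:
  fixes h :: "real \<Rightarrow> real"
  assumes "h integrable_on {0..T}" "i \<le> n"
  shows "(\<Sum>j<i. integral {node n j..node n (Suc j)} h) = integral {0..node n i} h"
  using assms(2)
proof (induction i)
  case (Suc i)
  have "h integrable_on {0..node n (Suc i)}"
    using integrable_on_subinterval[OF assms(1)] node_le[of "Suc i" n] Suc.prems by auto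
  then have "integral {0..node n i} h + integral {node n i..node n (Suc i)} h = integral {0..node n (Suc i)} h"
    using node_nonneg[of n i] node_mono[of i "Suc i" n]
    by (intro Henstock_Kurzweil_Integration.integral_combine) auto
  with Suc show ?case by simp
qed simp

definition B :: real where "B = integral {0..T} bnd"

lemma B_nonneg: "0 \<le> B"
  unfolding B_def using bnd by (intro integral_nonneg) auto

lemma sum_incr_le:
  assumes "i \<le> n" "\<alpha> \<in> {0..\<alpha>\<^sub>0}"
  shows "\<bar>\<Sum>j<i. incr n j \<alpha> (x j) (y j)\<bar> \<le> B"
proof -
  have "\<bar>\<Sum>j<i. incr n j \<alpha> (x j) (y j)\<bar> \<le> (\<Sum>j<i. integral {node n j..node n (Suc j)} bnd)"
    using assms by (intro order_trans[OF sum_abs] sum_mono incr_le) auto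
  also have "\<dots> = integral {0..node n i} bnd" by (rule integral_cells[OF bnd(1) assms(1)])
  also have "\<dots> \<le> B"
    unfolding B_def using node_le[OF assms(1)] bnd
    by (intro integral_subset_le integrable_on_subinterval[OF bnd(1)]) auto
  finally show ?thesis .
qed

lemma P_le: "\<alpha> \<in> {0..\<alpha>\<^sub>0} \<Longrightarrow> \<bar>P n \<theta> \<alpha> a\<bar> \<le> B"
  unfolding P_def by (rule sum_incr_le) auto

lemma W_bound:
  assumes "i \<le> n" "\<alpha> \<in> {0..\<alpha>\<^sub>0}" "\<theta> \<in> {0..1}"
  shows "\<bar>W n \<theta> \<alpha> a i - a\<bar> \<le> B"
proof -
  have "\<bar>W n \<theta> \<alpha> a i - a\<bar> = \<theta> * \<bar>\<Sum>j<i. incr n j \<alpha> (U n \<theta> \<alpha> a j) (W n \<theta> \<alpha> a j)\<bar>"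
    using assms(3) by (subst W_eq) (auto simp: abs_mult)
  also have "\<dots> \<le> 1 * B"
    using sum_incr_le[OF assms(1,2)] assms(3) B_nonneg by (intro mult_mono) auto
  finally show ?thesis by simp
qed

text \<open>No slope falls below \<open>a - B\<close>. Consequently a discrete solution of norm at
  most \<open>max r R\<close> starts with slope at most \<open>B + max r R / T\<close>, which is
  where this constant comes from.\<close>

lemma U_large:
  assumes "n > 0" "\<alpha> \<in> {0..\<alpha>\<^sub>0}" "\<theta> \<in> {0..1}"
  shows "T * (a - B) \<le> U n \<theta> \<alpha> a n"
proof -
  have "T * (a - B) = (\<Sum>j<n. T / real n * (a - B))" using assms(1) by simp
  also have "\<dots> \<le> (\<Sum>j<n. T / real n * W n \<theta> \<alpha> a (Suc j))"
  proof (intro sum_mono mult_left_mono)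
    fix j assume "j \<in> {..<n}"
    then show "a - B \<le> W n \<theta> \<alpha> a (Suc j)" using W_bound[of "Suc j" n \<alpha> \<theta> a] assms by auto
  qed (use T in auto)
  finally show ?thesis by (simp add: U_eq)
qed

section \<open>Signs and the discrete maximum principle\<close>

lemma incr_nonneg:
  assumes "i < n" "0 \<le> \<alpha>" "u \<le> 0"
  shows "T / real n * min (- u) 1 \<le> incr n i \<alpha> u w" "0 \<le> incr n i \<alpha> u w"
proof -
  have "T / real n * min (- u) 1 = integral {node n i..node n (Suc i)} (\<lambda>t. min (- u) 1)"
    using T by (simp add: node_Suc)
  also have "\<dots> \<le> incr n i \<alpha> u w"
    unfolding incr_def
  proof (rule integral_le)
    fix t assume t: "t \<in> {node n i..node n (Suc i)}"
    then have "t \<in> {0..T}" using cell_subset[OF assms(1)] by blast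
    then show "min (- u) 1 \<le> F t u w + \<alpha> * v t" using F_neg assms v_nonneg[of t] by simp
  qed (use rhs_integrable[OF cell_subset[OF assms(1)]] in auto)
  finally show *: "T / real n * min (- u) 1 \<le> incr n i \<alpha> u w" .
  have "0 \<le> T / real n * min (- u) 1" using T assms by auto
  then show "0 \<le> incr n i \<alpha> u w" using * by linarith
qed

lemma stays_negative:
  assumes th: "0 \<le> \<theta>" "0 \<le> \<alpha>" and j: "U n \<theta> \<alpha> a j \<le> 0" "W n \<theta> \<alpha> a j < 0" and "j \<le> i" "i \<le> n"
  shows "U n \<theta> \<alpha> a i \<le> 0 \<and> W n \<theta> \<alpha> a i < 0 \<and> (j < i \<longrightarrow> U n \<theta> \<alpha> a i < 0)"
  using \<open>j \<le> i\<close> \<open>i \<le> n\<close>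
proof (induction i rule: dec_induct)
  case (step i)
  then have IH: "U n \<theta> \<alpha> a i \<le> 0" "W n \<theta> \<alpha> a i < 0" and i: "i < n" by auto
  have "0 \<le> \<theta> * incr n i \<alpha> (U n \<theta> \<alpha> a i) (W n \<theta> \<alpha> a i)"
    using incr_nonneg(2)[OF i th(2) IH(1)] th by simp
  then have "W n \<theta> \<alpha> a (Suc i) < 0" using IH by (simp add: W_Suc)
  moreover then have "T / real n * W n \<theta> \<alpha> a (Suc i) < 0" using T i by (intro mult_pos_neg) auto
  ultimately show ?case using IH by (simp add: U_Suc)
qed (use j in auto)

text \<open>Two steps are required: the scheme starts at 0, where the extension vanishes, so the
  first increment may be 0. After one step the state is negative and the increment with index 1 is
  strictly positive.\<close>

lemma P_pos:
  assumes "n \<ge> 2" "a < 0" "0 \<le> \<theta>" "0 \<le> \<alpha>"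
  shows "P n \<theta> \<alpha> a > 0"
proof -
  have *: "U n \<theta> \<alpha> a i \<le> 0 \<and> W n \<theta> \<alpha> a i < 0 \<and> (0 < i \<longrightarrow> U n \<theta> \<alpha> a i < 0)" if "i \<le> n" for i
    using stays_negative[of \<theta> \<alpha> n a 0 i] assms that by auto
  have "0 < T / real n * min (- U n \<theta> \<alpha> a 1) 1" using *[of 1] T assms by auto
  then have "0 < incr n 1 \<alpha> (U n \<theta> \<alpha> a 1) (W n \<theta> \<alpha> a 1)"
    using incr_nonneg(1)[of 1 n \<alpha> "U n \<theta> \<alpha> a 1" "W n \<theta> \<alpha> a 1"] *[of 1] assms by linarith
  then show ?thesis
    unfolding P_def using assms * by (intro sum_pos2[where i = 1] incr_nonneg(2)) auto
qed

text \<open>The first negative value is reached with a negative new slope. Both then remain negative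
  up to the last node, where the slope equals \<open>a\<close> because \<open>P\<close> vanishes,
  contradicting \<open>0 \<le> a\<close>.\<close>

lemma zero_imp_U_nonneg:
  assumes "0 \<le> a" "0 \<le> \<theta>" "0 \<le> \<alpha>" "P n \<theta> \<alpha> a = 0" "i \<le> n"
  shows "0 \<le> U n \<theta> \<alpha> a i"
proof (rule ccontr)
  assume "\<not> ?thesis"
  then obtain j where j: "j \<le> n" "U n \<theta> \<alpha> a j < 0" "\<And>k. k < j \<Longrightarrow> \<not> (k \<le> n \<and> U n \<theta> \<alpha> a k < 0)"
    using exists_least_iff[of "\<lambda>j. j \<le> n \<and> U n \<theta> \<alpha> a j < 0"] assms(5) by (auto simp: not_le)
  then obtain k where k: "j = Suc k" by (cases j) auto
  then have "0 \<le> U n \<theta> \<alpha> a k" using j(3)[of k] j(1) by auto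
  then have "T / real n * W n \<theta> \<alpha> a j < 0" using j(2) unfolding k U_Suc by linarith
  then have "W n \<theta> \<alpha> a j < 0" using T k j by (simp add: mult_less_0_iff divide_less_0_iff)
  then have "W n \<theta> \<alpha> a n < 0" using stays_negative[of \<theta> \<alpha> n a j n] assms j by auto
  then show False using W_n[of n \<theta> \<alpha> a] assms by simp
qed

lemma W_zero_theta: "W n 0 \<alpha> a i = a"
  by (subst W_eq) simp

lemma U_zero_theta: "U n 0 \<alpha> a i = a * node n i"
  by (simp add: U_eq W_zero_theta node_def)

lemma M_zero_theta: "M n 0 \<alpha> a i = \<bar>a\<bar> * node n i"
proof (induction i)
  case (Suc i)
  have "\<bar>a\<bar> * node n i \<le> \<bar>a\<bar> * node n (Suc i)"
    by (intro mult_left_mono node_mono) auto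
  then show ?case
    using Suc node_nonneg[of n "Suc i"] by (simp add: U_zero_theta abs_mult max_def)
qed simp

section \<open>Continuity in the slope and in the parameters\<close>

lemma integral_F_continuous:
  assumes "{c..d} \<subseteq> {0..T}"
  shows "continuous_on UNIV (\<lambda>x. integral {c..d} (\<lambda>t. F t (fst x) (snd x)))"
proof (rule continuous_on_sequentiallyI)
  fix z :: "nat \<Rightarrow> real \<times> real" and z0 assume z: "z \<longlonglongrightarrow> z0"
  show "(\<lambda>k. integral {c..d} (\<lambda>t. F t (fst (z k)) (snd (z k)))) \<longlonglongrightarrow> integral {c..d} (\<lambda>t. F t (fst z0) (snd z0))"
  proof (rule dominated_convergence(2))
    show "(\<lambda>t. F t (fst (z k)) (snd (z k))) integrable_on {c..d}" for k
      by (rule integrable_on_subinterval[OF F_integrable assms])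
    show "g integrable_on {c..d}" by (rule integrable_on_subinterval[OF g assms])
    fix t assume t: "t \<in> {c..d}"
    then have t: "t \<in> {0..T}" using assms by blast
    show "norm (F t (fst (z k)) (snd (z k))) \<le> g t" for k using F_le[OF t] by simp
    show "(\<lambda>k. F t (fst (z k)) (snd (z k))) \<longlonglongrightarrow> F t (fst z0) (snd z0)"
      using continuous_on_tendsto_compose[OF F_continuous[OF t] z] by (simp add: case_prod_beta)
  qed
qed

lemma incr_continuous:
  assumes "i < n" "continuous_on X \<alpha>" "continuous_on X u" "continuous_on X w"
  shows "continuous_on X (\<lambda>x. incr n i (\<alpha> x) (u x) (w x))"
proof -
  let ?C = "{node n i..node n (Suc i)}"
  have "incr n i a b c = integral ?C (\<lambda>t. F t b c) + a * integral ?C v" for a b c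
    unfolding incr_def
    using integrable_on_subinterval[OF F_integrable cell_subset[OF assms(1)]]
      integrable_on_subinterval[OF v cell_subset[OF assms(1)]]
    by (subst integral_add) (auto intro: integrable_on_mult_right)
  moreover have "continuous_on X (\<lambda>x. integral ?C (\<lambda>t. F t (u x) (w x)))"
    using continuous_on_compose2[OF integral_F_continuous[OF cell_subset[OF assms(1)]], of X "\<lambda>x. (u x, w x)"] assms
    by (auto intro: continuous_on_Pair)
  ultimately show ?thesis using assms by (auto intro!: continuous_intros)
qed

lemma
  assumes "continuous_on X \<theta>" "continuous_on X \<alpha>" "continuous_on X a"
  shows UW_continuous: "i \<le> n \<Longrightarrow> continuous_on X (\<lambda>x. U n (\<theta> x) (\<alpha> x) (a x) i) \<and>
      continuous_on X (\<lambda>x. W n (\<theta> x) (\<alpha> x) (a x) i)"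
    and P_continuous: "continuous_on X (\<lambda>x. P n (\<theta> x) (\<alpha> x) (a x))"
    and M_continuous: "i \<le> n \<Longrightarrow> continuous_on X (\<lambda>x. M n (\<theta> x) (\<alpha> x) (a x) i)"
proof -
  show *: "continuous_on X (\<lambda>x. U n (\<theta> x) (\<alpha> x) (a x) i) \<and> continuous_on X (\<lambda>x. W n (\<theta> x) (\<alpha> x) (a x) i)"
    if "i \<le> n" for i
    using that
    by (induction i) (auto simp: U_Suc W_Suc intro!: continuous_intros incr_continuous assms)
  show "continuous_on X (\<lambda>x. P n (\<theta> x) (\<alpha> x) (a x))"
    unfolding P_def using * by (intro continuous_on_sum incr_continuous assms) auto
  show "continuous_on X (\<lambda>x. M n (\<theta> x) (\<alpha> x) (a x) i)" if "i \<le> n" for i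
    using that by (induction i) (use * in \<open>auto intro!: continuous_intros continuous_on_max\<close>)
qed

text \<open>The first disjunct negates the sign condition of \<open>hyp_r\<close>. In the second,
  norm \<open>r\<close> at \<alpha> = 0 and norm \<open>R\<close> at \<theta> = 1 are the forbidden
  norms, the case \<theta> = 1, \<alpha> = 0 is the desired solution, and \<alpha> =
  \<open>\<alpha>\<^sub>0\<close> with norm at most \<open>R\<close> is the forbidden case at the
  end of the homotopy. If all of them failed, the zeros would be separated in the way that
  \<open>planar_continuation\<close> rules out.\<close>

lemma discrete_alternative:
  assumes n: "n \<ge> 2" and r: "r > 0" and R: "R > 0"
  shows "\<exists>\<theta> \<alpha> a. \<theta> \<in> {0..1} \<and> \<alpha> \<in> {0..\<alpha>\<^sub>0} \<and> a \<in> {0..B + max r R / T} \<and> (\<forall>i\<le>n. 0 \<le> U n \<theta> \<alpha> a i) \<and>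
    (\<theta> = 0 \<and> \<alpha> = 0 \<and> a = r / T \<and> P n \<theta> \<alpha> a \<ge> 0 \<or>
     P n \<theta> \<alpha> a = 0 \<and> M n \<theta> \<alpha> a n \<le> max r R \<and>
       (\<alpha> = 0 \<and> M n \<theta> \<alpha> a n = r \<or> \<theta> = 1 \<and> M n \<theta> \<alpha> a n = R \<or>
        \<theta> = 1 \<and> \<alpha> = 0 \<and> min r R \<le> M n \<theta> \<alpha> a n \<or> \<theta> = 1 \<and> \<alpha> = \<alpha>\<^sub>0 \<and> M n \<theta> \<alpha> a n \<le> R))"
proof (rule ccontr)
  assume neg: "\<not> ?thesis"
  then have neg: "\<not> (\<theta> = 0 \<and> \<alpha> = 0 \<and> a = r / T \<and> P n \<theta> \<alpha> a \<ge> 0 \<or>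
     P n \<theta> \<alpha> a = 0 \<and> M n \<theta> \<alpha> a n \<le> max r R \<and>
       (\<alpha> = 0 \<and> M n \<theta> \<alpha> a n = r \<or> \<theta> = 1 \<and> M n \<theta> \<alpha> a n = R \<or>
        \<theta> = 1 \<and> \<alpha> = 0 \<and> min r R \<le> M n \<theta> \<alpha> a n \<or> \<theta> = 1 \<and> \<alpha> = \<alpha>\<^sub>0 \<and> M n \<theta> \<alpha> a n \<le> R))"
    if "\<theta> \<in> {0..1}" "\<alpha> \<in> {0..\<alpha>\<^sub>0}" "a \<in> {0..B + max r R / T}" "\<forall>i\<le>n. 0 \<le> U n \<theta> \<alpha> a i" for \<theta> \<alpha> a
    using that by blast
  define A where "A = B + max r R / T"
  define \<rho> where "\<rho> = r / T"
  have \<rho>: "\<rho> > 0" using r T by (simp add: \<rho>_def)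
  have A: "A \<ge> \<rho>"
    using B_nonneg T divide_right_mono[of r "max r R" T] by (simp add: A_def \<rho>_def)
  \<comment> \<open>For \<open>l\<close> in \<open>[-1, 0]\<close> the linear problem is deformed so that no zeros above \<open>r / T\<close> are left
    at \<open>l = -1\<close>; on \<open>[0, 1]\<close> the parameter \<open>\<theta>\<close> grows to \<open>1\<close>, on \<open>[1, 2]\<close> \<open>\<alpha>\<close> grows to \<open>\<alpha>\<^sub>0\<close>.\<close>
  define th where "th l = max 0 (min 1 l)" for l :: real
  define al where "al l = \<alpha>\<^sub>0 * max 0 (min 1 (l - 1))" for l :: real
  define c where "c l = max 0 (min 1 (- l))" for l :: real
  have th: "th l \<in> {0..1}" for l by (auto simp: th_def)
  have al: "al l \<in> {0..\<alpha>\<^sub>0}" for l using al0 by (auto simp: al_def mult_left_le)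
  have c: "c l \<in> {0..1}" for l by (auto simp: c_def)
  define p where "p a l = P n (th l) (al l) a" for a l
  define m where "m a l = M n (th l) (al l) a n" for a l
  \<comment> \<open>The weight \<open>c\<close> blends in the function frozen beyond slope \<rho>.
    The last term vanishes for slopes up to \<open>A\<close>, where all relevant zeros lie; at
    \<open>A + 1\<close> its value \<open>B + 1\<close> outweighs the bound \<open>B\<close> on
    \<open>p\<close> and makes \<open>Q\<close> negative.\<close>
  define Q where "Q x = (1 - c (snd x)) * p (fst x) (snd x) + c (snd x) * p (min (fst x) \<rho>) (snd x)
      - (B + 1) * max 0 (fst x - A)" for x :: "real \<times> real"
  have cont: "continuous_on UNIV Q" "continuous_on UNIV (\<lambda>x. m (fst x) (snd x))"
    unfolding Q_def p_def m_def th_def al_def c_def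
    by (intro continuous_intros P_continuous M_continuous; simp)+
  have Q_neg_a: "Q (a, l) > 0" if "a < 0" for a l
  proof -
    have "p a l > 0" using P_pos[OF n that, of "th l" "al l"] th[of l] al[of l] by (simp add: p_def)
    then show ?thesis using that A \<rho> by (simp add: Q_def min_def max_def algebra_simps)
  qed
  have zero_a: "0 \<le> a" if "Q (a, l) = 0" for a l using Q_neg_a[of a l] that by force
  have m_small: "a \<le> A" if "m a l \<le> max r R" for a l
  proof -
    have "T * (a - B) \<le> m a l"
      using U_large[of n "al l" "th l" a] U_le_M[of n n n "th l" "al l" a] n th al by (auto simp: m_def)
    then have "T * (a - B) \<le> max r R" using that by simp
    then show ?thesis using T by (simp add: A_def field_simps)
  qed
  \<comment> \<open>Zeros of \<open>Q\<close> at parameters \<open>l \<ge> 0\<close> with norm at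
    most \<open>max r R\<close> have slope in \<open>[0, A]\<close>. There the auxiliary terms
    vanish, so they are zeros of \<open>P\<close> with nonnegative states.\<close>
  have good: False if "Q (a, l) = 0" "0 \<le> l" "m a l \<le> max r R"
    "al l = 0 \<and> m a l = r \<or> th l = 1 \<and> m a l = R \<or>
        th l = 1 \<and> al l = 0 \<and> min r R \<le> m a l \<or> th l = 1 \<and> al l = \<alpha>\<^sub>0 \<and> m a l \<le> R" for a l
  proof -
    have a: "0 \<le> a" "a \<le> A" using zero_a m_small that by auto
    have "c l = 0" using that by (simp add: c_def)
    then have "P n (th l) (al l) a = 0" using that(1) a by (simp add: Q_def p_def)
    moreover from this have "\<forall>i\<le>n. 0 \<le> U n (th l) (al l) a i"
      using zero_imp_U_nonneg a th[of l] al[of l] by auto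
    ultimately show ?thesis
      using neg[OF th[of l] al[of l], of a] that(3,4) a unfolding m_def A_def by auto
  qed
  have \<rho>_bad: False if "P n 0 0 \<rho> \<ge> 0"
  proof -
    have "\<forall>i\<le>n. 0 \<le> U n 0 0 \<rho> i" using \<rho> by (simp add: U_zero_theta node_nonneg)
    then show False using neg[of 0 0 \<rho>] that al0 A \<rho> unfolding A_def \<rho>_def by auto
  qed
  \<comment> \<open>At \<theta> = 0 the states lie on a line, so norm \<open>r\<close> means slope
    \<rho>; the slope cut used for \<open>l \<le> 0\<close> thus fits the norm cut used for
    \<open>l \<ge> 0\<close>.\<close>
  have m0: "m a l = a * T" if "l \<le> 0" "0 \<le> a" for a l
    using that n by (simp add: m_def th_def M_zero_theta node_n)
  have p0: "p a l = P n 0 0 a" if "l \<le> 0" for a l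
    using that by (simp add: p_def th_def al_def)
  have at_\<rho>: False if "Q (\<rho>, l) = 0" "l \<le> 0" for l
  proof -
    have "Q (\<rho>, l) = P n 0 0 \<rho>" using that(2) A by (simp add: Q_def p0 algebra_simps)
    then show False using \<rho>_bad that by simp
  qed
  define \<mu> where "\<mu> x = m (fst x) (snd x)" for x
  have \<mu>: "continuous_on UNIV \<mu>" using cont(2) by (simp add: \<mu>_def[abs_def])
  \<comment> \<open>The zeros of norm at most \<open>r\<close> (for \<open>l \<le> 1\<close>) or \<open>R\<close> (for \<open>l \<ge> 1\<close>) are to be separated from the others.\<close>
  define K where "K = {x. snd x \<le> 0 \<and> fst x \<le> \<rho> \<or> 0 \<le> snd x \<and> snd x \<le> 1 \<and> \<mu> x \<le> r \<or>
      1 \<le> snd x \<and> \<mu> x \<le> R}"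
  define K' where "K' = {x. snd x \<le> 0 \<and> \<rho> \<le> fst x \<or> 0 \<le> snd x \<and> snd x \<le> 1 \<and> r \<le> \<mu> x \<or>
      1 \<le> snd x \<and> R \<le> \<mu> x}"
  show False
  proof (rule planar_continuation[of "-1" "A + 1" "-1" 2 Q K K'])
    show "closed K" "closed K'"
      unfolding K_def K'_def
      by (intro closed_Collect_disj closed_Collect_conj closed_Collect_le continuous_intros \<mu>)+
    show "continuous_on ({-1..A + 1} \<times> {-1..2}) Q" using cont(1) by (rule continuous_on_subset) simp
    show "Q (- 1, l) > 0" for l using Q_neg_a by simp
    show "Q (A + 1, l) < 0" for l
    proof -
      have "p a l \<le> B" for a using P_le[OF al, of n "th l" l a] by (simp add: p_def)
      then have "(1 - c l) * p (A + 1) l + c l * p (min (A + 1) \<rho>) l \<le> (1 - c l) * B + c l * B"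
        using c[of l] by (intro add_mono mult_left_mono) auto
      then show ?thesis by (simp add: Q_def algebra_simps)
    qed
    show "x \<in> K \<or> x \<in> K'" for x by (auto simp: K_def K'_def \<mu>_def)
    show False if "Q x = 0" "x \<in> K" "x \<in> K'" for x
    proof -
      obtain a l where x: "x = (a, l)" by force
      have a: "0 \<le> a" using zero_a that x by simp
      consider "l < 0" | "l = 0" | "0 < l" "l < 1" | "l = 1" | "1 < l" by linarith
      then show False
      proof cases
        case 1
        then show False using that at_\<rho>[of l] by (auto simp: x K_def K'_def \<mu>_def)
      next
        case 2
        then have "m a l = a * T" using m0 a by simp
        then have "a = \<rho>" using that(2,3) T 2 by (auto simp: x K_def K'_def \<mu>_def \<rho>_def field_simps)
        then show False using that(1) at_\<rho>[of l] 2 by (simp add: x)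
      next
        case 3
        then have "m a l = r" using that(2,3) by (auto simp: x K_def K'_def \<mu>_def)
        then show False using good[of a l] that(1) 3 by (simp add: x al_def)
      next
        case 4
        then have "min r R \<le> m a l" "m a l \<le> max r R" using that(2,3) by (auto simp: x K_def K'_def \<mu>_def)
        then show False using good[of a l] that(1) 4 by (simp add: x al_def th_def)
      next
        case 5
        then have "m a l = R" using that(2,3) by (auto simp: x K_def K'_def \<mu>_def)
        then show False using good[of a l] that(1) 5 by (simp add: x th_def)
      qed
    qed
    show False if "Q (a, 2) = 0" "(a, 2) \<in> K" for a
      using good[of a 2] that by (auto simp: K_def \<mu>_def th_def al_def le_max_iff_disj)
    show False if "Q (a, - 1) = 0" "(a, - 1) \<in> K'" for a
    proof -
      have "min a \<rho> = \<rho>" using that(2) by (simp add: K'_def \<mu>_def)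
      then have "P n 0 0 \<rho> = (B + 1) * max 0 (a - A)" using that(1) by (simp add: Q_def c_def p0)
      then show False using \<rho>_bad B_nonneg by simp
    qed
  qed (use A \<rho> in auto)
qed

end

subsection \<open>The continuous limit\<close>

lemma max_norm_upper:
  assumes "continuous_on {0..T} x" "t \<in> {0..T}"
  shows "\<bar>x t\<bar> \<le> max_norm T x"
proof -
  have "compact ((\<lambda>t. \<bar>x t\<bar>) ` {0..T})"
    using assms by (intro compact_continuous_image continuous_intros) auto
  then have "bdd_above ((\<lambda>t. \<bar>x t\<bar>) ` {0..T})"
    by (intro bounded_imp_bdd_above compact_imp_bounded)
  then show ?thesis unfolding max_norm_def using assms(2) by (rule cSUP_upper2) simp
qed

lemma max_norm_attained:
  assumes T: "T > 0" and x: "continuous_on {0..T} x"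
  shows "\<exists>t\<in>{0..T}. max_norm T x = \<bar>x t\<bar>"
proof -
  have "continuous_on {0..T} (\<lambda>t. \<bar>x t\<bar>)" using x by (intro continuous_intros)
  then obtain t where t: "t \<in> {0..T}" "\<forall>s\<in>{0..T}. \<bar>x s\<bar> \<le> \<bar>x t\<bar>"
    using continuous_attains_sup[of "{0..T}" "\<lambda>t. \<bar>x t\<bar>"] T by (metis atLeastatMost_empty_iff2 compact_Icc less_eq_real_def not_le)
  have "max_norm T x = \<bar>x t\<bar>"
    unfolding max_norm_def using t by (intro cSup_eq_maximum) auto
  with t show ?thesis by blast
qed

context truncated_problem
begin

text \<open>Cells are closed on the left and open on the right, so \<open>t = T\<close> receives the
  index \<open>n\<close>, one beyond the last cell; its node is \<open>T\<close> itself, and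
  \<open>U\<close> and \<open>W\<close> are defined there.\<close>

definition idx :: "nat \<Rightarrow> real \<Rightarrow> nat" where
  "idx n t = nat \<lfloor>t * real n / T\<rfloor>"

lemma idx:
  assumes "n > 0" "t \<in> {0..T}"
  shows "idx n t \<le> n" "node n (idx n t) \<le> t" "t - node n (idx n t) < T / real n"
proof -
  have q: "0 \<le> t * real n / T" "t * real n / T \<le> real n" using assms T by (auto simp: field_simps)
  then have i: "real (idx n t) \<le> t * real n / T" "t * real n / T < real (idx n t) + 1"
    by (auto simp: idx_def)
  then show "idx n t \<le> n" using q by linarith
  show "node n (idx n t) \<le> t" using i(1) assms T by (simp add: node_def field_simps)
  have "t * real n < (real (idx n t) + 1) * T" using i(2) T by (simp add: pos_divide_less_eq)
  then have "t < node n (Suc (idx n t))" using assms(1) by (simp add: node_def pos_less_divide_eq add.commute)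
  then show "t - node n (idx n t) < T / real n" by (simp add: node_Suc)
qed

lemma idx_cell:
  assumes "n > 0" "node n i \<le> t" "t < node n (Suc i)"
  shows "idx n t = i"
proof -
  have "real i \<le> t * real n / T" "t * real n / T < real i + 1"
    using assms T by (auto simp: node_def field_simps)
  then show ?thesis unfolding idx_def by linarith
qed

definition step_rhs :: "nat \<Rightarrow> real \<Rightarrow> real \<Rightarrow> real \<Rightarrow> real \<Rightarrow> real" where
  "step_rhs n \<theta> \<alpha> a t = F t (U n \<theta> \<alpha> a (idx n t)) (W n \<theta> \<alpha> a (idx n t)) + \<alpha> * v t"

text \<open>A continuous function through the values \<open>W\<close> at the nodes. It solves
  exactly the integral equation whose state is frozen on each cell, so only the freezing has to
  disappear in the limit.\<close>

definition slope :: "nat \<Rightarrow> real \<Rightarrow> real \<Rightarrow> real \<Rightarrow> real \<Rightarrow> real" where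
  "slope n \<theta> \<alpha> a t = a - \<theta> * integral {0..t} (step_rhs n \<theta> \<alpha> a)"

lemma step_rhs_has_integral:
  assumes "n > 0" "i \<le> n"
  shows "(step_rhs n \<theta> \<alpha> a has_integral (\<Sum>j<i. incr n j \<alpha> (U n \<theta> \<alpha> a j) (W n \<theta> \<alpha> a j))) {0..node n i}"
  using assms(2)
proof (induction i)
  case (Suc i)
  let ?h = "\<lambda>t. F t (U n \<theta> \<alpha> a i) (W n \<theta> \<alpha> a i) + \<alpha> * v t"
  have "(?h has_integral incr n i \<alpha> (U n \<theta> \<alpha> a i) (W n \<theta> \<alpha> a i)) {node n i..node n (Suc i)}"
    unfolding incr_def using rhs_integrable[OF cell_subset[of i n]] Suc.prems by (intro integrable_integral) auto
  then have "(step_rhs n \<theta> \<alpha> a has_integral incr n i \<alpha> (U n \<theta> \<alpha> a i) (W n \<theta> \<alpha> a i)) {node n i..node n (Suc i)}"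
    by (rule has_integral_spike_finite[where S = "{node n (Suc i)}", rotated 2])
      (auto simp: step_rhs_def idx_cell[OF assms(1)])
  then show ?case
    using Suc has_integral_combine[of 0 "node n i" "node n (Suc i)" "step_rhs n \<theta> \<alpha> a"]
      node_nonneg[of n i] node_mono[of i "Suc i" n] by auto
qed (simp add: has_integral_refl)

lemma step_rhs_integrable: "n > 0 \<Longrightarrow> step_rhs n \<theta> \<alpha> a integrable_on {0..T}"
  using step_rhs_has_integral[of n n \<theta> \<alpha> a] by (auto simp: node_n)

lemma P_eq_integral: "n > 0 \<Longrightarrow> P n \<theta> \<alpha> a = integral {0..T} (step_rhs n \<theta> \<alpha> a)"
  using step_rhs_has_integral[of n n \<theta> \<alpha> a] by (simp add: P_def node_n integral_unique)

lemma slope_node: "n > 0 \<Longrightarrow> i \<le> n \<Longrightarrow> slope n \<theta> \<alpha> a (node n i) = W n \<theta> \<alpha> a i"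
  using step_rhs_has_integral[of n i \<theta> \<alpha> a] by (subst W_eq) (simp add: slope_def integral_unique)

lemma slope_increment:
  assumes "n > 0" "\<theta> \<in> {0..1}" "\<alpha> \<in> {0..\<alpha>\<^sub>0}" "0 \<le> s" "s \<le> t" "t \<le> T"
  shows "\<bar>slope n \<theta> \<alpha> a t - slope n \<theta> \<alpha> a s\<bar> \<le> integral {s..t} bnd"
proof -
  let ?I = "\<lambda>t. integral {0..t} (step_rhs n \<theta> \<alpha> a)"
  have "\<bar>slope n \<theta> \<alpha> a t - slope n \<theta> \<alpha> a s\<bar> = \<bar>\<theta> * (?I t - ?I s)\<bar>"
    by (simp add: slope_def right_diff_distrib abs_minus_commute)
  also have "\<dots> = \<theta> * \<bar>?I t - ?I s\<bar>" using assms(2) by (simp add: abs_mult)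
  also have "\<dots> \<le> 1 * \<bar>?I t - ?I s\<bar>" using assms(2) by (intro mult_right_mono) auto
  also have "\<bar>?I t - ?I s\<bar> \<le> integral {s..t} bnd"
    using rhs_le[OF _ assms(3)]
    by (intro integral_abs_increment_le[OF step_rhs_integrable[OF assms(1)] bnd(1) _ assms(4-6)])
      (auto simp: step_rhs_def)
  finally show ?thesis by simp
qed

lemma euler_limit:
  fixes n :: "nat \<Rightarrow> nat" and \<theta> \<alpha> a :: "nat \<Rightarrow> real"
  assumes n: "\<And>k. n k > 0" "filterlim n at_top sequentially"
    and par: "\<And>k. \<theta> k \<in> {0..1}" "\<And>k. \<alpha> k \<in> {0..\<alpha>\<^sub>0}"
    and lim: "\<theta> \<longlonglongrightarrow> \<theta>'" "\<alpha> \<longlonglongrightarrow> \<alpha>'" "a \<longlonglongrightarrow> a'"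
    and y: "continuous_on {0..T} y"
    and uniform: "\<forall>e>0. \<forall>\<^sub>F k in sequentially. \<forall>t\<in>{0..T}. \<bar>slope (n k) (\<theta> k) (\<alpha> k) (a k) t - y t\<bar> < e"
  defines "x \<equiv> \<lambda>t. integral {0..t} y"
  defines "H \<equiv> \<lambda>t. F t (x t) (y t) + \<alpha>' * v t"
  shows "H integrable_on {0..T}"
    and "t \<in> {0..T} \<Longrightarrow> y t = a' - \<theta>' * integral {0..t} H"
    and "(\<lambda>k. P (n k) (\<theta> k) (\<alpha> k) (a k)) \<longlonglongrightarrow> integral {0..T} H"
    and "(\<lambda>k. M (n k) (\<theta> k) (\<alpha> k) (a k) (n k)) \<longlonglongrightarrow> max_norm T x"
    and "t \<in> {0..T} \<Longrightarrow> (\<lambda>k. U (n k) (\<theta> k) (\<alpha> k) (a k) (idx (n k) t)) \<longlonglongrightarrow> x t"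
proof -
  note unif = uniform[rule_format]
  define u where "u k i = U (n k) (\<theta> k) (\<alpha> k) (a k) i" for k i
  define w where "w k i = W (n k) (\<theta> k) (\<alpha> k) (a k) i" for k i
  have yi: "y integrable_on {c..d}" if "{c..d} \<subseteq> {0..T}" for c d
    using y that by (intro integrable_continuous_real continuous_on_subset[OF y])
  have cx: "continuous_on {0..T} x"
    unfolding x_def by (rule indefinite_integral_continuous_1[OF yi]) simp
  have mesh: "\<forall>\<^sub>F k in sequentially. T / real (n k) < d" if "d > 0" for d
  proof -
    have "\<forall>\<^sub>F k in sequentially. T / d < real (n k)"
      using filterlim_compose[OF filterlim_real_sequentially n(2)] by (simp add: filterlim_at_top_dense)
    then show ?thesis by eventually_elim (use that n(1) T in \<open>simp add: field_simps\<close>)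
  qed
  have w_node: "\<forall>\<^sub>F k in sequentially. \<forall>i\<le>n k. \<bar>w k i - y (node (n k) i)\<bar> < e" if "e > 0" for e
    using unif[OF that]
  proof eventually_elim
    case (elim k)
    show ?case
    proof (intro allI impI)
      fix i assume i: "i \<le> n k"
      have "node (n k) i \<in> {0..T}" using node_nonneg node_le[OF i] by auto
      then show "\<bar>w k i - y (node (n k) i)\<bar> < e"
        using bspec[OF elim] by (simp add: w_def flip: slope_node[OF n(1) i])
    qed
  qed
  have unif_cont: "\<exists>d>0. \<forall>s\<in>{0..T}. \<forall>t\<in>{0..T}. \<bar>s - t\<bar> < d \<longrightarrow> \<bar>z s - z t\<bar> < e"
    if "continuous_on {0..T} z" "e > 0" for z :: "real \<Rightarrow> real" and e
  proof -
    have "uniformly_continuous_on {0..T} z" using compact_uniformly_continuous[OF that(1)] by simp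
    then show ?thesis using that(2) unfolding uniformly_continuous_on_def dist_real_def by metis
  qed
  have u_node: "\<forall>\<^sub>F k in sequentially. \<forall>i\<le>n k. \<bar>u k i - x (node (n k) i)\<bar> \<le> T * e" if "e > 0" for e
  proof -
    have half: "e / 2 > 0" using that by simp
    obtain d where d: "d > 0" "\<And>s t. s \<in> {0..T} \<Longrightarrow> t \<in> {0..T} \<Longrightarrow> \<bar>s - t\<bar> < d \<Longrightarrow> \<bar>y s - y t\<bar> < e / 2"
      using unif_cont[OF y half] by blast
    from mesh[OF d(1)] w_node[OF half] show ?thesis
    proof eventually_elim
      case (elim k)
      let ?h = "T / real (n k)" and ?node = "node (n k)"
      \<comment> \<open>The scheme uses the slope at the right end of the cell. Half of
        \<open>e\<close> covers its distance to \<open>y\<close> at that node, the other half the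
        oscillation of \<open>y\<close> on the cell.\<close>
      have cell: "\<bar>?h * w k (Suc j) - integral {?node j..?node (Suc j)} y\<bar> \<le> ?h * e" if j: "j < n k" for j
      proof -
        note sub = cell_subset[OF j]
        have "?h * w k (Suc j) - integral {?node j..?node (Suc j)} y = integral {?node j..?node (Suc j)} (\<lambda>t. w k (Suc j) - y t)"
          using yi[OF sub] T by (subst integral_diff) (auto simp: node_Suc)
        also have "\<bar>\<dots>\<bar> \<le> integral {?node j..?node (Suc j)} (\<lambda>t. e)"
          unfolding real_norm_def[symmetric]
        proof (rule integral_norm_bound_integral)
          fix t assume t: "t \<in> {?node j..?node (Suc j)}"
          have "?node (Suc j) \<in> {0..T}" "t \<in> {0..T}" using sub t by auto
          moreover have "\<bar>?node (Suc j) - t\<bar> < d" using t elim(1) by (auto simp: node_Suc)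
          ultimately have "\<bar>y (?node (Suc j)) - y t\<bar> < e / 2" by (intro d)
          moreover have "\<bar>w k (Suc j) - y (?node (Suc j))\<bar> < e / 2" using elim(2) j by auto
          ultimately show "norm (w k (Suc j) - y t) \<le> e" unfolding real_norm_def by linarith
        qed (use yi[OF sub] in \<open>auto intro!: integrable_diff\<close>)
        also have "\<dots> = ?h * e" using T by (simp add: node_Suc)
        finally show ?thesis .
      qed
      show ?case
      proof (intro allI impI)
        fix i assume i: "i \<le> n k"
        have "x (?node i) = (\<Sum>j<i. integral {?node j..?node (Suc j)} y)"
          unfolding x_def using yi[of 0 T] i by (simp add: integral_cells)
        then have "\<bar>u k i - x (?node i)\<bar> = \<bar>\<Sum>j<i. ?h * w k (Suc j) - integral {?node j..?node (Suc j)} y\<bar>"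
          by (simp add: u_def w_def U_eq sum_subtractf)
        also have "\<dots> \<le> (\<Sum>j<i. ?h * e)"
          using i cell by (intro order_trans[OF sum_abs] sum_mono) auto
        also have "\<dots> = real i / real (n k) * (T * e)" by simp
        also have "\<dots> \<le> 1 * (T * e)" using i T \<open>e > 0\<close> n(1)[of k] by (intro mult_right_mono) auto
        finally show "\<bar>u k i - x (?node i)\<bar> \<le> T * e" by simp
      qed
    qed
  qed
  have step_lim: "(\<lambda>k. z k (idx (n k) t)) \<longlonglongrightarrow> zz t"
    if z: "continuous_on {0..T} zz" and t: "t \<in> {0..T}"
      and ev: "\<And>e. e > 0 \<Longrightarrow> \<forall>\<^sub>F k in sequentially. \<forall>i\<le>n k. \<bar>z k i - zz (node (n k) i)\<bar> < e"
    for z :: "nat \<Rightarrow> nat \<Rightarrow> real" and zz t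
    unfolding tendsto_iff dist_real_def
  proof (intro allI impI)
    fix e :: real assume "e > 0"
    have half: "e / 2 > 0" using \<open>e > 0\<close> by simp
    obtain d where d: "d > 0" "\<And>s t. s \<in> {0..T} \<Longrightarrow> t \<in> {0..T} \<Longrightarrow> \<bar>s - t\<bar> < d \<Longrightarrow> \<bar>zz s - zz t\<bar> < e / 2"
      using unif_cont[OF z half] by blast
    from mesh[OF d(1)] ev[OF half] show "\<forall>\<^sub>F k in sequentially. \<bar>z k (idx (n k) t) - zz t\<bar> < e"
    proof eventually_elim
      case (elim k)
      note i = idx[OF n(1) t, of k]
      have "node (n k) (idx (n k) t) \<in> {0..T}" using node_nonneg i(2) t by auto
      then have "\<bar>zz (node (n k) (idx (n k) t)) - zz t\<bar> < e / 2"
        using i elim(1) by (intro d t) auto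
      moreover have "\<bar>z k (idx (n k) t) - zz (node (n k) (idx (n k) t))\<bar> < e / 2" using elim(2) i(1) by blast
      ultimately show ?case by linarith
    qed
  qed
  have u_node': "\<forall>\<^sub>F k in sequentially. \<forall>i\<le>n k. \<bar>u k i - x (node (n k) i)\<bar> < e" if "e > 0" for e
  proof -
    have "e / (2 * T) > 0" using that T by simp
    from u_node[OF this] show ?thesis
    proof eventually_elim
      case (elim k)
      have "T * (e / (2 * T)) < e" using that T by (simp add: field_simps)
      with elim show ?case by fastforce
    qed
  qed
  have u_lim: "(\<lambda>k. u k (idx (n k) t)) \<longlonglongrightarrow> x t" if "t \<in> {0..T}" for t
    using step_lim[OF cx that u_node'] by simp
  have w_lim: "(\<lambda>k. w k (idx (n k) t)) \<longlonglongrightarrow> y t" if "t \<in> {0..T}" for t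
    using step_lim[OF y that w_node] by simp
  show "(\<lambda>k. U (n k) (\<theta> k) (\<alpha> k) (a k) (idx (n k) t)) \<longlonglongrightarrow> x t" if "t \<in> {0..T}" for t
    using u_lim[OF that] by (simp add: u_def)
  define h where "h k = step_rhs (n k) (\<theta> k) (\<alpha> k) (a k)" for k
  have hi: "h k integrable_on {0..T}" for k unfolding h_def by (rule step_rhs_integrable[OF n(1)])
  have hle: "norm (h k t) \<le> bnd t" if "t \<in> {0..T}" for k t
    using rhs_le[OF that par(2)] by (simp add: h_def step_rhs_def)
  have hlim: "(\<lambda>k. h k t) \<longlonglongrightarrow> H t" if t: "t \<in> {0..T}" for t
  proof -
    have uw: "(\<lambda>k. (u k (idx (n k) t), w k (idx (n k) t))) \<longlonglongrightarrow> (x t, y t)"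
      using u_lim[OF t] w_lim[OF t] by (rule tendsto_Pair)
    then have "(\<lambda>k. F t (u k (idx (n k) t)) (w k (idx (n k) t))) \<longlonglongrightarrow> F t (x t) (y t)"
      using continuous_on_tendsto_compose[OF F_continuous[OF t] uw] by simp
    then show ?thesis
      unfolding h_def H_def step_rhs_def u_def w_def by (intro tendsto_intros lim)
  qed
  show Hi: "H integrable_on {0..T}"
    by (rule dominated_convergence(1)[where f = h and h = bnd]; fact hi bnd(1) hle hlim)
  have int_lim: "(\<lambda>k. integral {0..t} (h k)) \<longlonglongrightarrow> integral {0..t} H" if "t \<in> {0..T}" for t
  proof (rule dominated_convergence(2))
    show "h k integrable_on {0..t}" for k using integrable_on_subinterval[OF hi] that by auto
    show "bnd integrable_on {0..t}" using integrable_on_subinterval[OF bnd(1)] that by auto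
    fix s assume "s \<in> {0..t}"
    then have s: "s \<in> {0..T}" using that by auto
    show "norm (h k s) \<le> bnd s" for k by (rule hle[OF s])
    show "(\<lambda>k. h k s) \<longlonglongrightarrow> H s" by (rule hlim[OF s])
  qed
  show "y t = a' - \<theta>' * integral {0..t} H" if t: "t \<in> {0..T}" for t
  proof (rule LIMSEQ_unique)
    show "(\<lambda>k. slope (n k) (\<theta> k) (\<alpha> k) (a k) t) \<longlonglongrightarrow> a' - \<theta>' * integral {0..t} H"
      unfolding slope_def h_def[symmetric] by (intro tendsto_intros lim int_lim t)
    show "(\<lambda>k. slope (n k) (\<theta> k) (\<alpha> k) (a k) t) \<longlonglongrightarrow> y t"
      unfolding tendsto_iff dist_real_def
      by (intro allI impI, rule eventually_mono[OF unif]) (use t in auto)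
  qed
  show "(\<lambda>k. P (n k) (\<theta> k) (\<alpha> k) (a k)) \<longlonglongrightarrow> integral {0..T} H"
    using int_lim[of T] T by (simp add: P_eq_integral[OF n(1)] h_def)
  show "(\<lambda>k. M (n k) (\<theta> k) (\<alpha> k) (a k) (n k)) \<longlonglongrightarrow> max_norm T x"
    unfolding tendsto_iff dist_real_def
  proof (intro allI impI)
    fix e :: real assume "e > 0"
    obtain t where t: "t \<in> {0..T}" "max_norm T x = \<bar>x t\<bar>" using max_norm_attained[OF T cx] by blast
    have "\<forall>\<^sub>F k in sequentially. \<bar>u k (idx (n k) t) - x t\<bar> < e"
      using u_lim[OF t(1)] \<open>e > 0\<close> unfolding tendsto_iff dist_real_def by blast
    with u_node'[OF \<open>e > 0\<close>] show "\<forall>\<^sub>F k in sequentially. \<bar>M (n k) (\<theta> k) (\<alpha> k) (a k) (n k) - max_norm T x\<bar> < e"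
    proof eventually_elim
      case (elim k)
      let ?M = "M (n k) (\<theta> k) (\<alpha> k) (a k) (n k)"
      have "\<bar>u k (idx (n k) t)\<bar> \<le> ?M"
        unfolding u_def by (intro U_le_M idx(1) n t)
      then have "\<bar>x t\<bar> < ?M + e" using elim(2) by linarith
      moreover obtain j where j: "j \<le> n k" "?M = \<bar>u k j\<bar>" using M_attained unfolding u_def by blast
      have "\<bar>x (node (n k) j)\<bar> \<le> max_norm T x"
        using max_norm_upper[OF cx] node_nonneg node_le[OF j(1)] by auto
      then have "?M < max_norm T x + e" using elim(1) j by fastforce
      ultimately show ?case using t(2) by linarith
    qed
  qed
qed

text \<open>The boundary condition \<open>integral {0..T} H = 0\<close> is left out on purpose: in
  the linear case with slope \<open>r / T\<close> only the sign of this integral is known.\<close>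

definition integral_solution :: "real \<Rightarrow> real \<Rightarrow> real \<Rightarrow> (real \<Rightarrow> real) \<Rightarrow> (real \<Rightarrow> real) \<Rightarrow> (real \<Rightarrow> real) \<Rightarrow> bool" where
  "integral_solution \<theta> \<alpha> a x y H \<longleftrightarrow>
     H integrable_on {0..T} \<and> y = (\<lambda>t. a - \<theta> * integral {0..t} H) \<and> x = (\<lambda>t. integral {0..t} y) \<and>
     (\<forall>t\<in>{0..T}. H t = F t (x t) (y t) + \<alpha> * v t)"

text \<open>Every slope function has its increments bounded by those of the primitive
  \<open>b\<close> of \<open>bnd\<close>, a single modulus of continuity for all step numbers and
  parameters.\<close>

lemma slope_Arzela_Ascoli:
  fixes n :: "nat \<Rightarrow> nat" and \<theta> \<alpha> a :: "nat \<Rightarrow> real"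
  assumes n: "\<And>k. n k > 0" and par: "\<And>k. \<theta> k \<in> {0..1}" "\<And>k. \<alpha> k \<in> {0..\<alpha>\<^sub>0}" "\<And>k. a k \<in> {0..A}"
  obtains y \<sigma> where "continuous_on {0..T} y" "strict_mono (\<sigma> :: nat \<Rightarrow> nat)"
    "\<And>e. 0 < e \<Longrightarrow> \<forall>\<^sub>F k in sequentially. \<forall>t\<in>{0..T}.
       \<bar>slope (n (\<sigma> k)) (\<theta> (\<sigma> k)) (\<alpha> (\<sigma> k)) (a (\<sigma> k)) t - y t\<bar> < e"
proof -
  define z where "z k = slope (n k) (\<theta> k) (\<alpha> k) (a k)" for k
  have inc: "\<bar>z k t - z k s\<bar> \<le> integral {s..t} bnd" if "0 \<le> s" "s \<le> t" "t \<le> T" for k s t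
    unfolding z_def by (rule slope_increment[OF n par(1,2) that])
  define b where "b t = integral {0..t} bnd" for t
  have bi: "bnd integrable_on {0..t}" if "t \<le> T" for t
    using integrable_on_subinterval[OF bnd(1)] that by auto
  have b: "integral {s..t} bnd = b t - b s" if "0 \<le> s" "s \<le> t" "t \<le> T" for s t
    using Henstock_Kurzweil_Integration.integral_combine[OF that(1,2) bi[OF that(3)]] by (simp add: b_def)
  have inc': "\<bar>z k t - z k s\<bar> \<le> \<bar>b t - b s\<bar>" if "s \<in> {0..T}" "t \<in> {0..T}" for k s t
    using inc[of s t k] inc[of t s k] b[of s t] b[of t s] that by (cases "s \<le> t") auto
  have cb: "continuous_on {0..T} b"
    unfolding b_def by (rule indefinite_integral_continuous_1[OF bnd(1)])
  have z0: "z k 0 = a k" for k by (simp add: z_def slope_def)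
  show thesis
  proof (rule Arzela_Ascoli[of "{0..T}" z "A + B"])
    show "norm (z k t) \<le> A + B" if t: "t \<in> {0..T}" for k t
    proof -
      have "\<bar>z k t - z k 0\<bar> \<le> integral {0..t} bnd" using inc t by auto
      also have "\<dots> \<le> B" unfolding B_def using t bnd bi by (intro integral_subset_le) auto
      finally show ?thesis using par(3)[of k] z0[of k] by auto
    qed
    show "\<exists>d>0. \<forall>k s. s \<in> {0..T} \<and> norm (t - s) < d \<longrightarrow> norm (z k t - z k s) < e"
      if t: "t \<in> {0..T}" and e: "0 < e" for t e
    proof -
      obtain d where d: "d > 0" "\<And>s. s \<in> {0..T} \<Longrightarrow> dist s t < d \<Longrightarrow> dist (b s) (b t) < e"
        using cb t e unfolding continuous_on_iff by metis
      show ?thesis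
      proof (intro exI[of _ d] conjI allI impI d(1))
        fix k s assume "s \<in> {0..T} \<and> norm (t - s) < d"
        then have s: "s \<in> {0..T}" "dist s t < d" by (auto simp: dist_real_def)
        show "norm (z k t - z k s) < e"
          using inc'[OF s(1) t, of k] d(2)[OF s] by (simp add: dist_real_def abs_minus_commute)
      qed
    qed
    fix y \<sigma> assume y: "continuous_on {0..T} y" "strict_mono (\<sigma> :: nat \<Rightarrow> nat)"
      and lim: "\<And>e. 0 < e \<Longrightarrow> \<exists>K. \<forall>k t. k \<ge> K \<and> t \<in> {0..T} \<longrightarrow> norm (z (\<sigma> k) t - y t) < e"
    show thesis
    proof (rule that[OF y])
      fix e :: real assume "0 < e"
      then show "\<forall>\<^sub>F k in sequentially. \<forall>t\<in>{0..T}.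
         \<bar>slope (n (\<sigma> k)) (\<theta> (\<sigma> k)) (\<alpha> (\<sigma> k)) (a (\<sigma> k)) t - y t\<bar> < e"
        using lim[of e] unfolding eventually_sequentially z_def by (metis real_norm_def)
    qed
  qed auto
qed

lemma euler_compactness:
  fixes n :: "nat \<Rightarrow> nat" and \<theta> \<alpha> a :: "nat \<Rightarrow> real"
  assumes n: "\<And>k. n k > 0" "filterlim n at_top sequentially"
    and par: "\<And>k. \<theta> k \<in> {0..1}" "\<And>k. \<alpha> k \<in> {0..\<alpha>\<^sub>0}" "\<And>k. a k \<in> {0..A}"
  obtains \<tau> \<theta>' \<alpha>' a' x y H where "strict_mono (\<tau> :: nat \<Rightarrow> nat)"
    "(\<lambda>k. \<theta> (\<tau> k)) \<longlonglongrightarrow> \<theta>'" "(\<lambda>k. \<alpha> (\<tau> k)) \<longlonglongrightarrow> \<alpha>'" "(\<lambda>k. a (\<tau> k)) \<longlonglongrightarrow> a'"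
    "\<theta>' \<in> {0..1}" "\<alpha>' \<in> {0..\<alpha>\<^sub>0}" "a' \<in> {0..A}" "integral_solution \<theta>' \<alpha>' a' x y H"
    "(\<lambda>k. P (n (\<tau> k)) (\<theta> (\<tau> k)) (\<alpha> (\<tau> k)) (a (\<tau> k))) \<longlonglongrightarrow> integral {0..T} H"
    "(\<lambda>k. M (n (\<tau> k)) (\<theta> (\<tau> k)) (\<alpha> (\<tau> k)) (a (\<tau> k)) (n (\<tau> k))) \<longlonglongrightarrow> max_norm T x"
    "\<And>t. t \<in> {0..T} \<Longrightarrow>
       (\<lambda>k. U (n (\<tau> k)) (\<theta> (\<tau> k)) (\<alpha> (\<tau> k)) (a (\<tau> k)) (idx (n (\<tau> k)) t)) \<longlonglongrightarrow> x t"
proof -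
  let ?S = "{0..1 :: real} \<times> {0..\<alpha>\<^sub>0} \<times> {0..A}"
  have "seq_compact ?S" unfolding compact_eq_seq_compact_metric[symmetric] by (intro compact_Times compact_Icc)
  moreover have "\<forall>k. (\<theta> k, \<alpha> k, a k) \<in> ?S" using par by auto
  ultimately obtain l \<sigma>1 where l: "l \<in> ?S" "strict_mono (\<sigma>1 :: nat \<Rightarrow> nat)"
      "((\<lambda>k. (\<theta> k, \<alpha> k, a k)) \<circ> \<sigma>1) \<longlonglongrightarrow> l"
    by (rule seq_compactE)
  obtain y \<sigma>2 where y: "continuous_on {0..T} y" "strict_mono (\<sigma>2 :: nat \<Rightarrow> nat)"
    "\<And>e. 0 < e \<Longrightarrow> \<forall>\<^sub>F k in sequentially. \<forall>t\<in>{0..T}.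
       \<bar>slope (n (\<sigma>1 (\<sigma>2 k))) (\<theta> (\<sigma>1 (\<sigma>2 k))) (\<alpha> (\<sigma>1 (\<sigma>2 k))) (a (\<sigma>1 (\<sigma>2 k))) t - y t\<bar> < e"
    by (rule slope_Arzela_Ascoli[of "\<lambda>k. n (\<sigma>1 k)" "\<lambda>k. \<theta> (\<sigma>1 k)" "\<lambda>k. \<alpha> (\<sigma>1 k)" "\<lambda>k. a (\<sigma>1 k)" A,
          OF n(1) par]) (rule that)
  define \<tau> where "\<tau> k = \<sigma>1 (\<sigma>2 k)" for k
  have \<tau>: "strict_mono \<tau>" using l(2) y(2) by (auto simp: strict_mono_def \<tau>_def)
  obtain \<theta>' \<alpha>' a' where l': "l = (\<theta>', \<alpha>', a')" by (metis prod.exhaust)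
  have lim: "(\<lambda>k. (\<theta> (\<tau> k), \<alpha> (\<tau> k), a (\<tau> k))) \<longlonglongrightarrow> (\<theta>', \<alpha>', a')"
    using LIMSEQ_subseq_LIMSEQ[OF l(3) y(2)] by (simp add: l' o_def \<tau>_def)
  have lims: "(\<lambda>k. \<theta> (\<tau> k)) \<longlonglongrightarrow> \<theta>'" "(\<lambda>k. \<alpha> (\<tau> k)) \<longlonglongrightarrow> \<alpha>'" "(\<lambda>k. a (\<tau> k)) \<longlonglongrightarrow> a'"
    using tendsto_fst[OF lim] tendsto_fst[OF tendsto_snd[OF lim]] tendsto_snd[OF tendsto_snd[OF lim]] by simp_all
  have n\<tau>: "filterlim (\<lambda>k. n (\<tau> k)) at_top sequentially"
    using filterlim_compose[OF n(2) filterlim_subseq[OF \<tau>]] .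
  define x where "x t = integral {0..t} y" for t
  define H where "H t = F t (x t) (y t) + \<alpha>' * v t" for t
  have unif: "\<forall>e>0. \<forall>\<^sub>F k in sequentially. \<forall>t\<in>{0..T}.
      \<bar>slope (n (\<tau> k)) (\<theta> (\<tau> k)) (\<alpha> (\<tau> k)) (a (\<tau> k)) t - y t\<bar> < e"
    using y(3) by (simp add: \<tau>_def)
  note el = euler_limit[OF n(1) n\<tau> par(1,2) lims y(1) unif, folded x_def, folded H_def]
  \<comment> \<open>The limit \<open>y\<close> obeys its integral equation on \<open>{0..T}\<close>
    only; redefining it by the formula gives the equalities of functions that
    \<open>integral_solution\<close> demands.\<close>
  define y' where "y' t = a' - \<theta>' * integral {0..t} H" for t
  define x' where "x' t = integral {0..t} y'" for t
  have yy: "y' t = y t" if "t \<in> {0..T}" for t using el(2)[OF that] by (simp add: y'_def)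
  have xx: "x' t = x t" if "t \<in> {0..T}" for t
    unfolding x'_def x_def by (rule integral_cong) (use that yy in auto)
  have mm: "max_norm T x' = max_norm T x" unfolding max_norm_def by (rule SUP_cong) (auto simp: xx)
  show thesis
  proof (rule that[OF \<tau> lims])
    show "\<theta>' \<in> {0..1}" "\<alpha>' \<in> {0..\<alpha>\<^sub>0}" "a' \<in> {0..A}" using l(1) l' by auto
    show "integral_solution \<theta>' \<alpha>' a' x' y' H"
      unfolding integral_solution_def using el(1) xx yy by (auto simp: y'_def[abs_def] x'_def[abs_def] H_def[abs_def])
    show "(\<lambda>k. P (n (\<tau> k)) (\<theta> (\<tau> k)) (\<alpha> (\<tau> k)) (a (\<tau> k))) \<longlonglongrightarrow> integral {0..T} H" by (rule el(3))
    show "(\<lambda>k. M (n (\<tau> k)) (\<theta> (\<tau> k)) (\<alpha> (\<tau> k)) (a (\<tau> k)) (n (\<tau> k))) \<longlonglongrightarrow> max_norm T x'"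
      using el(4) mm by simp
    show "(\<lambda>k. U (n (\<tau> k)) (\<theta> (\<tau> k)) (\<alpha> (\<tau> k)) (a (\<tau> k)) (idx (n (\<tau> k)) t)) \<longlonglongrightarrow> x' t" if "t \<in> {0..T}" for t
      using el(5)[OF that] xx[OF that] by simp
  qed
qed

text \<open>The discrete alternative is membership of parameters, slope, \<open>P\<close> and norm
  in the closed set \<open>C\<close>, and thus passes to the limit along a subsequence. Step numbers
  start at 2, as the discrete statement requires.\<close>

lemma continuous_alternative:
  assumes r: "r > 0" and R: "R > 0"
  obtains \<theta> \<alpha> a x y H where "\<theta> \<in> {0..1}" "\<alpha> \<in> {0..\<alpha>\<^sub>0}" "integral_solution \<theta> \<alpha> a x y H"
    "\<And>t. t \<in> {0..T} \<Longrightarrow> 0 \<le> x t"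
    "\<theta> = 0 \<and> \<alpha> = 0 \<and> a = r / T \<and> integral {0..T} H \<ge> 0 \<or>
     integral {0..T} H = 0 \<and> max_norm T x \<le> max r R \<and>
       (\<alpha> = 0 \<and> max_norm T x = r \<or> \<theta> = 1 \<and> max_norm T x = R \<or>
        \<theta> = 1 \<and> \<alpha> = 0 \<and> min r R \<le> max_norm T x \<or> \<theta> = 1 \<and> \<alpha> = \<alpha>\<^sub>0 \<and> max_norm T x \<le> R)"
proof -
  define C where "C = {z :: real \<times> real \<times> real \<times> real \<times> real. case z of (\<theta>, \<alpha>, a, p, m) \<Rightarrow>
    \<theta> = 0 \<and> \<alpha> = 0 \<and> a = r / T \<and> p \<ge> 0 \<or>
     p = 0 \<and> m \<le> max r R \<and> (\<alpha> = 0 \<and> m = r \<or> \<theta> = 1 \<and> m = R \<or>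
        \<theta> = 1 \<and> \<alpha> = 0 \<and> min r R \<le> m \<or> \<theta> = 1 \<and> \<alpha> = \<alpha>\<^sub>0 \<and> m \<le> R)}"
  have C: "closed C"
    unfolding C_def case_prod_beta
    by (intro closed_Collect_disj closed_Collect_conj closed_Collect_le closed_Collect_eq
        continuous_on_fst continuous_on_snd continuous_on_id continuous_on_const)
  have "\<forall>k. \<exists>\<theta> \<alpha> a. \<theta> \<in> {0..1} \<and> \<alpha> \<in> {0..\<alpha>\<^sub>0} \<and> a \<in> {0..B + max r R / T} \<and>
      (\<forall>i\<le>k + 2. 0 \<le> U (k + 2) \<theta> \<alpha> a i) \<and> (\<theta>, \<alpha>, a, P (k + 2) \<theta> \<alpha> a, M (k + 2) \<theta> \<alpha> a (k + 2)) \<in> C"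
    using discrete_alternative[OF _ r R, of "_ + 2"] by (simp add: C_def)
  then obtain \<theta> \<alpha> a where par: "\<And>k. \<theta> k \<in> {0..1}" "\<And>k. \<alpha> k \<in> {0..\<alpha>\<^sub>0}" "\<And>k. a k \<in> {0..B + max r R / T}"
    and U: "\<And>k i. i \<le> k + 2 \<Longrightarrow> 0 \<le> U (k + 2) (\<theta> k) (\<alpha> k) (a k) i"
    and inC: "\<And>k. (\<theta> k, \<alpha> k, a k, P (k + 2) (\<theta> k) (\<alpha> k) (a k), M (k + 2) (\<theta> k) (\<alpha> k) (a k) (k + 2)) \<in> C"
    by metis
  have lim2: "filterlim (\<lambda>k :: nat. k + 2) at_top sequentially"
    by (rule filterlim_add_const_nat_at_top)
  show thesis
  proof (rule euler_compactness[OF _ lim2 par])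
    fix \<tau> \<theta>' \<alpha>' a' x y H
    assume \<tau>: "strict_mono (\<tau> :: nat \<Rightarrow> nat)"
      and lims: "(\<lambda>k. \<theta> (\<tau> k)) \<longlonglongrightarrow> \<theta>'" "(\<lambda>k. \<alpha> (\<tau> k)) \<longlonglongrightarrow> \<alpha>'" "(\<lambda>k. a (\<tau> k)) \<longlonglongrightarrow> a'"
      and par': "\<theta>' \<in> {0..1}" "\<alpha>' \<in> {0..\<alpha>\<^sub>0}" and sol: "integral_solution \<theta>' \<alpha>' a' x y H"
      and Pl: "(\<lambda>k. P (\<tau> k + 2) (\<theta> (\<tau> k)) (\<alpha> (\<tau> k)) (a (\<tau> k))) \<longlonglongrightarrow> integral {0..T} H"
      and Ml: "(\<lambda>k. M (\<tau> k + 2) (\<theta> (\<tau> k)) (\<alpha> (\<tau> k)) (a (\<tau> k)) (\<tau> k + 2)) \<longlonglongrightarrow> max_norm T x"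
      and Ul: "\<And>t. t \<in> {0..T} \<Longrightarrow>
         (\<lambda>k. U (\<tau> k + 2) (\<theta> (\<tau> k)) (\<alpha> (\<tau> k)) (a (\<tau> k)) (idx (\<tau> k + 2) t)) \<longlonglongrightarrow> x t"
    have "0 \<le> x t" if "t \<in> {0..T}" for t
      using Ul[OF that] idx(1)[OF _ that] by (intro tendsto_lowerbound[OF Ul[OF that]] always_eventually allI U) auto
    moreover have "(\<theta>', \<alpha>', a', integral {0..T} H, max_norm T x) \<in> C"
      by (rule closed_sequentially[OF C _ tendsto_Pair[OF lims(1) tendsto_Pair[OF lims(2)
          tendsto_Pair[OF lims(3) tendsto_Pair[OF Pl Ml]]]]]) (rule inC)
    ultimately show thesis using that[OF par' sol] by (simp add: C_def)
  qed simp
qed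

end

subsection \<open>The existence theorem\<close>

theorem theorem5p1:
  fixes T r R :: real and p :: ennreal and f :: "real \<Rightarrow> real \<Rightarrow> real \<Rightarrow> real"
  assumes "T > 0" and "1 \<le> p"
    and "Lp_Caratheodory p T f"
    and "cond_f1 T f" and "cond_f2 T f" and "cond_f3 p T f"
    and "r > 0" and "R > 0" and "r \<noteq> R"
    and "hyp_r T f r" and "hyp_R p T f R"
  shows "\<exists>u. is_solution T f u \<and> (\<forall>t\<in>{0<..T}. u t > 0) \<and>
             min r R < (SUP t\<in>{0..T}. u t) \<and> (SUP t\<in>{0..T}. u t) < max r R"
proof -
  note T = \<open>T > 0\<close> and p = \<open>1 \<le> p\<close>
  define S where "S = max r R"
  have S: "S > 0" "r \<le> S" "R \<le> S" using \<open>r > 0\<close> by (auto simp: S_def)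
  obtain v \<alpha>\<^sub>0 where v: "Lp_fun p T v" "nonneg_ae T v" and al0: "\<alpha>\<^sub>0 > 0"
    and R1: "\<And>\<alpha> u. \<alpha> \<in> {0..\<alpha>\<^sub>0} \<Longrightarrow> is_solution T (\<lambda>t s \<xi>. f t s \<xi> + \<alpha> * v t) u \<Longrightarrow>
      (\<forall>t\<in>{0..T}. 0 \<le> u t) \<Longrightarrow> max_norm T u \<noteq> R"
    and R2: "\<And>u. is_solution T (\<lambda>t s \<xi>. f t s \<xi> + \<alpha>\<^sub>0 * v t) u \<Longrightarrow> \<not> (\<forall>t\<in>{0..T}. 0 \<le> u t \<and> u t \<le> R)"
    using \<open>hyp_R p T f R\<close> unfolding hyp_R_def by blast
  have r1: "(LINT t|lebesgue_on {0..T}. f t (r / T * t) (r / T)) < 0"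
    and r2: "\<And>\<theta> u. 0 < \<theta> \<Longrightarrow> \<theta> \<le> 1 \<Longrightarrow> is_solution T (\<lambda>t s \<xi>. \<theta> * f t s \<xi>) u \<Longrightarrow>
      (\<forall>t\<in>{0<..T}. u t > 0) \<Longrightarrow> max_norm T u \<noteq> r"
    using \<open>hyp_r T f r\<close> by (auto simp: hyp_r_def Let_def)
  obtain k \<rho> where k: "Lp_fun 1 T k" "nonneg_ae T k" "\<rho> > 0"
    and f2: "AE t in lebesgue_on {0..T}. \<forall>s \<xi>. 0 \<le> s \<and> s \<le> \<rho> \<and> \<bar>\<xi>\<bar> \<le> \<rho> \<longrightarrow> \<bar>f t s \<xi>\<bar> \<le> k t * (\<bar>s\<bar> + \<bar>\<xi>\<bar>)"
    using \<open>cond_f2 T f\<close> unfolding cond_f2_def by blast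
  obtain \<phi> \<psi> where \<phi>: "continuous_on {0..} \<phi>" "\<And>\<xi>. 0 \<le> \<xi> \<Longrightarrow> 0 \<le> \<phi> \<xi>"
    and div: "\<forall>\<^sub>F M in at_top. (\<integral>\<^sup>+\<xi>\<in>{M..}. ennreal (\<xi> powr Nagumo_exponent p / \<phi> \<xi>) \<partial>lborel) = \<infinity>"
    and lim: "Liminf at_top (\<lambda>\<xi>. ereal (\<phi> \<xi>)) > 0"
    and \<psi>: "Lp_fun p T \<psi>" "nonneg_ae T \<psi>"
    and f3: "AE t in lebesgue_on {0..T}. \<forall>s \<xi>. 0 \<le> s \<and> s \<le> S \<longrightarrow> \<bar>f t s \<xi>\<bar> \<le> \<psi> t * \<phi> \<bar>\<xi>\<bar>"
    using \<open>cond_f3 p T f\<close> S(1) unfolding cond_f3_def by blast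
  have Lp_abs: "Lp_fun p T (\<lambda>t. \<bar>h t\<bar>)" if "Lp_fun p T h" for h
    using that by (auto simp: Lp_fun_def)
  \<comment> \<open>The lower bound \<open>r / T\<close> keeps the line of slope
    \<open>r / T\<close> untouched by the truncation, so that the sign condition of
    \<open>hyp_r\<close> can be applied to it.\<close>
  obtain N where N: "N > r / T" and Nagumo: "\<And>y t. continuous_on {0..T} y \<Longrightarrow>
      (\<And>s t. 0 \<le> s \<Longrightarrow> s \<le> t \<Longrightarrow> t \<le> T \<Longrightarrow>
        \<bar>y t - y s\<bar> \<le> integral {s..t} (\<lambda>\<tau>. \<bar>\<psi> \<tau>\<bar> * \<phi> (min \<bar>y \<tau>\<bar> N) + \<alpha>\<^sub>0 * \<bar>v \<tau>\<bar>)) \<Longrightarrow>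
      (\<And>t. t \<in> {0..T} \<Longrightarrow> integral {0..t} y \<in> {0..S}) \<Longrightarrow> t \<in> {0..T} \<Longrightarrow> \<bar>y t\<bar> \<le> N"
    by (rule Nagumo_derivative_bound[OF T p \<phi> div lim Lp_abs[OF \<psi>(1)] _ Lp_abs[OF v(1)] _
        less_imp_le[OF S(1)] less_imp_le[OF al0], of "r / T"]) (auto intro: that)
  have N0: "N > 0" using N T \<open>r > 0\<close> by (meson divide_pos_pos less_trans)
  have "max S N > 0" using S(1) by simp
  then obtain g where g: "Lp_fun p T g"
    and f_le: "AE t in lebesgue_on {0..T}. \<forall>s \<xi>. 0 \<le> s \<and> \<bar>s\<bar> \<le> max S N \<and> \<bar>\<xi>\<bar> \<le> max S N \<longrightarrow> \<bar>f t s \<xi>\<bar> \<le> g t"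
    using \<open>Lp_Caratheodory p T f\<close> unfolding Lp_Caratheodory_def by blast
  have f_meas: "(\<lambda>t. f t s \<xi>) \<in> borel_measurable (lebesgue_on {0..T})" if "s \<ge> 0" for s \<xi>
    using \<open>Lp_Caratheodory p T f\<close> that unfolding Lp_Caratheodory_def by blast
  have f_cont: "AE t in lebesgue_on {0..T}. continuous_on ({0..} \<times> UNIV) (\<lambda>(s, \<xi>). f t s \<xi>)"
    using \<open>Lp_Caratheodory p T f\<close> unfolding Lp_Caratheodory_def by blast
  \<comment> \<open>All almost-everywhere conditions are gathered so that a single null set is
    discarded.\<close>
  define good where "good t \<longleftrightarrow>
      continuous_on ({0..} \<times> UNIV) (case_prod (f t)) \<and>
      (\<forall>s \<xi>. 0 \<le> s \<and> \<bar>s\<bar> \<le> max S N \<and> \<bar>\<xi>\<bar> \<le> max S N \<longrightarrow> \<bar>f t s \<xi>\<bar> \<le> g t) \<and>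
      (\<forall>\<xi>. f t 0 \<xi> = 0) \<and>
      (\<forall>s \<xi>. 0 \<le> s \<and> s \<le> \<rho> \<and> \<bar>\<xi>\<bar> \<le> \<rho> \<longrightarrow> \<bar>f t s \<xi>\<bar> \<le> k t * (\<bar>s\<bar> + \<bar>\<xi>\<bar>)) \<and>
      (\<forall>s \<xi>. 0 \<le> s \<and> s \<le> S \<longrightarrow> \<bar>f t s \<xi>\<bar> \<le> \<psi> t * \<phi> \<bar>\<xi>\<bar>) \<and> 0 \<le> v t" for t
  have "AE t in lebesgue_on {0..T}. good t"
    using f_cont f_le \<open>cond_f1 T f\<close>[unfolded cond_f1_def] f2 f3 v(2)[unfolded nonneg_ae_def]
    unfolding good_def by eventually_elim (intro conjI)
  moreover have "{0..T} \<in> sets lebesgue" by simp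
  ultimately obtain Z where Z: "negligible Z" and Z_good: "\<forall>t\<in>{0..T} - Z. good t"
    using AE_lebesgue_on_negligible by blast
  define E where "E = {0..T} - Z"
  have E_sets: "E \<in> sets (lebesgue_on {0..T})"
    using Z by (auto simp: E_def sets_restrict_space_iff negligible_iff_null_sets)
  have good: "continuous_on ({0..} \<times> UNIV) (case_prod (f t)) \<and>
      (\<forall>s \<xi>. 0 \<le> s \<and> \<bar>s\<bar> \<le> max S N \<and> \<bar>\<xi>\<bar> \<le> max S N \<longrightarrow> \<bar>f t s \<xi>\<bar> \<le> g t) \<and>
      (\<forall>\<xi>. f t 0 \<xi> = 0) \<and>
      (\<forall>s \<xi>. 0 \<le> s \<and> s \<le> \<rho> \<and> \<bar>\<xi>\<bar> \<le> \<rho> \<longrightarrow> \<bar>f t s \<xi>\<bar> \<le> k t * (\<bar>s\<bar> + \<bar>\<xi>\<bar>)) \<and>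
      (\<forall>s \<xi>. 0 \<le> s \<and> s \<le> S \<longrightarrow> \<bar>f t s \<xi>\<bar> \<le> \<psi> t * \<phi> \<bar>\<xi>\<bar>) \<and> 0 \<le> v t"
    if "t \<in> E" for t
    using Z_good that unfolding good_def E_def by blast

  \<comment> \<open>The truncated problem and its limit solution\<close>
  define cs where "cs s = max 0 (min S s)" for s
  define cx where "cx \<xi> = max (- N) (min N \<xi>)" for \<xi>
  have cs: "0 \<le> cs s" "\<bar>cs s\<bar> \<le> max S N" "cs s \<le> S" for s using S(1) by (auto simp: cs_def)
  have cx: "\<bar>cx \<xi>\<bar> \<le> max S N" "\<bar>cx \<xi>\<bar> = min \<bar>\<xi>\<bar> N" for \<xi> using N0 by (auto simp: cx_def)
  \<comment> \<open>truncated beyond the a priori bounds, and extended to \<open>s < 0\<close> so that solutions stay nonnegative\<close>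
  define F where "F t s \<xi> = (if t \<in> E then f t (cs s) (cx \<xi>) else 0) + max 0 (min (- s) 1)" for t s \<xi>
  have int_abs: "(\<lambda>t. \<bar>h t\<bar>) integrable_on {0..T}" if "Lp_fun q T h" "1 \<le> q" for h q
    using Lp_fun_imp_integrable[OF that(2,1)] by (intro integrable_on_lebesgue_on integrable_abs) auto
  \<comment> \<open>The summand 1 in the bound accounts for the extension term, and
    \<open>\<bar>v t\<bar>\<close> is nonnegative everywhere while agreeing with \<open>v\<close>
    off the null set.\<close>
  interpret truncated: truncated_problem T F "\<lambda>t. \<bar>g t\<bar> + 1" "\<lambda>t. \<bar>v t\<bar>" \<alpha>\<^sub>0
  proof
    show "(\<lambda>t. F t s \<xi>) \<in> borel_measurable (lebesgue_on {0..T})" for s \<xi>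
    proof -
      have "(\<lambda>t. indicator E t * f t (cs s) (cx \<xi>)) \<in> borel_measurable (lebesgue_on {0..T})"
        using E_sets f_meas[OF cs(1)] by (intro borel_measurable_times borel_measurable_indicator)
      moreover have "(\<lambda>t. F t s \<xi>) = (\<lambda>t. indicator E t * f t (cs s) (cx \<xi>) + max 0 (min (- s) 1))"
        by (auto simp: F_def fun_eq_iff)
      ultimately show ?thesis by simp
    qed
    show "continuous_on UNIV (\<lambda>(s, \<xi>). F t s \<xi>)" for t
    proof (cases "t \<in> E")
      case True
      have "continuous_on UNIV (\<lambda>z :: real \<times> real. (cs (fst z), cx (snd z)))"
        unfolding cs_def cx_def by (intro continuous_intros)
      moreover have "continuous_on ({0..} \<times> UNIV) (\<lambda>(s, \<xi>). f t s \<xi>)" using good[OF True] by simp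
      ultimately have "continuous_on UNIV (\<lambda>z. f t (cs (fst z)) (cx (snd z)))"
        using continuous_on_compose2[of "{0..} \<times> UNIV" "\<lambda>(s, \<xi>). f t s \<xi>" UNIV "\<lambda>z. (cs (fst z), cx (snd z))"] cs(1)
        by auto
      then show ?thesis
        using True unfolding F_def case_prod_beta by (auto intro!: continuous_intros)
    next
      case False
      then show ?thesis unfolding F_def case_prod_beta by (auto intro!: continuous_intros)
    qed
    show "(\<lambda>t. \<bar>g t\<bar> + 1) integrable_on {0..T}"
      using int_abs[OF g p] by (intro integrable_add) auto
    show "\<bar>F t s \<xi>\<bar> \<le> \<bar>g t\<bar> + 1" if "t \<in> {0..T}" for t s \<xi>
    proof -
      have "\<bar>if t \<in> E then f t (cs s) (cx \<xi>) else 0\<bar> \<le> \<bar>g t\<bar>"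
        using good[of t] cs[of s] cx(1)[of \<xi>] by (auto intro: order_trans[OF _ abs_ge_self])
      moreover have "\<bar>max 0 (min (- s) 1)\<bar> \<le> 1" by auto
      ultimately show ?thesis unfolding F_def by linarith
    qed
    show "F t s \<xi> = min (- s) 1" if "t \<in> {0..T}" "s \<le> 0" for t s \<xi>
      using that good[of t] S(1) by (auto simp: F_def cs_def)
    show "(\<lambda>t. \<bar>v t\<bar>) integrable_on {0..T}" by (rule int_abs[OF v(1) p])
  qed (use T al0 in auto)
  obtain \<theta> \<alpha> a x y H where \<theta>: "\<theta> \<in> {0..1}" and \<alpha>: "\<alpha> \<in> {0..\<alpha>\<^sub>0}"
    and sol: "truncated.integral_solution \<theta> \<alpha> a x y H" and x0: "\<And>t. t \<in> {0..T} \<Longrightarrow> 0 \<le> x t"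
    and alt: "\<theta> = 0 \<and> \<alpha> = 0 \<and> a = r / T \<and> integral {0..T} H \<ge> 0 \<or>
     integral {0..T} H = 0 \<and> max_norm T x \<le> max r R \<and>
       (\<alpha> = 0 \<and> max_norm T x = r \<or> \<theta> = 1 \<and> max_norm T x = R \<or>
        \<theta> = 1 \<and> \<alpha> = 0 \<and> min r R \<le> max_norm T x \<or> \<theta> = 1 \<and> \<alpha> = \<alpha>\<^sub>0 \<and> max_norm T x \<le> R)"
    by (rule truncated.continuous_alternative[OF \<open>r > 0\<close> \<open>R > 0\<close>]) (rule that; assumption)
  have Hi: "H integrable_on {0..T}" and y_def: "y = (\<lambda>t. a - \<theta> * integral {0..t} H)"
    and x_def: "x = (\<lambda>t. integral {0..t} y)"
    and H_eq: "\<And>t. t \<in> {0..T} \<Longrightarrow> H t = F t (x t) (y t) + \<alpha> * \<bar>v t\<bar>"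
    using sol by (auto simp: truncated.integral_solution_def)
  have cy: "continuous_on {0..T} y"
    unfolding y_def by (intro continuous_intros indefinite_integral_continuous_1 Hi)
  have cont_x: "continuous_on {0..T} x"
    unfolding x_def by (intro indefinite_integral_continuous_1 integrable_continuous_real cy)
  have H_off: "H t = \<alpha> * \<bar>v t\<bar>" if "t \<in> {0..T}" "t \<notin> E" for t
    using H_eq[OF that(1)] x0[OF that(1)] that(2) by (simp add: F_def)
  have H_on: "H t = f t (x t) (cx (y t)) + \<alpha> * v t" if "t \<in> E" "x t \<le> S" for t
  proof -
    have "t \<in> {0..T}" "0 \<le> v t" using that good[of t] by (auto simp: E_def)
    moreover have "cs (x t) = x t" using x0[of t] that calculation by (simp add: cs_def)
    ultimately show ?thesis using H_eq[of t] x0[of t] that by (simp add: F_def)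
  qed
  have linear: False if "\<theta> = 0" "\<alpha> = 0" "a = r / T" "integral {0..T} H \<ge> 0"
  proof -
    have ya: "y t = r / T" for t using that by (simp add: y_def)
    have xa: "x t = r / T * t" if "0 \<le> t" for t using that by (simp add: x_def ya[abs_def])
    let ?h = "\<lambda>t. f t (r / T * t) (r / T)"
    have "integral {0..T} H = integral {0..T} ?h"
    proof (rule integral_spike[OF Z])
      fix t assume t: "t \<in> {0..T} - Z"
      then have "x t = r / T * t" "r / T * t \<le> r" using xa T \<open>r > 0\<close> by (auto simp: field_simps)
      moreover have "cx (r / T) = r / T" using N divide_pos_pos[OF \<open>r > 0\<close> T] by (simp add: cx_def)
      ultimately show "?h t = H t" using H_on[of t] t S ya that by (simp add: E_def)
    qed
    also have "\<dots> = (LINT t|lebesgue_on {0..T}. ?h t)"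
    proof (rule lebesgue_integral_eq_integral[symmetric])
      \<comment> \<open>A non-integrable function has integral 0 by convention, so the strictly
        negative value forces integrability.\<close>
      show "integrable (lebesgue_on {0..T}) ?h" using r1 not_integrable_integral_eq by fastforce
    qed simp
    finally show False using r1 that by simp
  qed
  from alt linear have H0: "integral {0..T} H = 0" and xS: "max_norm T x \<le> S"
    and alt': "\<alpha> = 0 \<and> max_norm T x = r \<or> \<theta> = 1 \<and> max_norm T x = R \<or>
        \<theta> = 1 \<and> \<alpha> = 0 \<and> min r R \<le> max_norm T x \<or> \<theta> = 1 \<and> \<alpha> = \<alpha>\<^sub>0 \<and> max_norm T x \<le> R"
    unfolding S_def by blast+
  have x_le: "x t \<le> max_norm T x" if "t \<in> {0..T}" for t
    using max_norm_upper[OF cont_x that] by linarith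
  have x_range: "x t \<in> {0..S}" if "t \<in> {0..T}" for t using x0 x_le[OF that] xS that by auto
  \<comment> \<open>The clamped slope has modulus \<open>min \<bar>y\<bar> N\<close>, so the
    truncated equation satisfies exactly the hypothesis of the Nagumo bound. Its conclusion makes
    the clamp inactive.\<close>
  have yN: "\<bar>y t\<bar> \<le> N" if "t \<in> {0..T}" for t
  proof (rule Nagumo[OF cy _ _ that])
    show "integral {0..t} y \<in> {0..S}" if "t \<in> {0..T}" for t using x_range[OF that] by (simp add: x_def)
    define e where "e \<tau> = \<bar>\<psi> \<tau>\<bar> * \<phi> (min \<bar>y \<tau>\<bar> N) + \<alpha>\<^sub>0 * \<bar>v \<tau>\<bar>" for \<tau>
    have "continuous_on {0..T} (\<lambda>\<tau>. \<phi> (min \<bar>y \<tau>\<bar> N))"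
      using N0 by (intro continuous_on_compose2[OF \<phi>(1)] continuous_intros cy) auto
    then have "(\<lambda>\<tau>. \<phi> (min \<bar>y \<tau>\<bar> N) * \<bar>\<psi> \<tau>\<bar>) integrable_on {0..T}"
      by (rule continuous_mult_integrable[OF _ int_abs[OF \<psi>(1) p]]) simp
    then have ei: "e integrable_on {0..T}"
      unfolding e_def using int_abs[OF v(1) p]
      by (intro integrable_add integrable_on_mult_right) (simp_all add: mult.commute)
    have He: "\<bar>H \<tau>\<bar> \<le> e \<tau>" if \<tau>: "\<tau> \<in> {0..T}" for \<tau>
    proof -
      have av: "\<bar>\<alpha> * \<bar>v \<tau>\<bar>\<bar> \<le> \<alpha>\<^sub>0 * \<bar>v \<tau>\<bar>" using \<alpha> by (simp add: abs_mult mult_right_mono)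
      have ph: "0 \<le> \<bar>\<psi> \<tau>\<bar> * \<phi> (min \<bar>y \<tau>\<bar> N)" using \<phi>(2) N0 by (intro mult_nonneg_nonneg) auto
      show ?thesis
      proof (cases "\<tau> \<in> E")
        case True
        have "\<bar>f \<tau> (x \<tau>) (cx (y \<tau>))\<bar> \<le> \<psi> \<tau> * \<phi> \<bar>cx (y \<tau>)\<bar>"
          using good[of \<tau>] True x_range[OF \<tau>] by (auto simp: E_def)
        also have "\<dots> \<le> \<bar>\<psi> \<tau>\<bar> * \<phi> \<bar>cx (y \<tau>)\<bar>" using \<phi>(2) by (intro mult_right_mono) auto
        finally have "\<bar>f \<tau> (x \<tau>) (cx (y \<tau>))\<bar> \<le> \<bar>\<psi> \<tau>\<bar> * \<phi> (min \<bar>y \<tau>\<bar> N)" by (simp add: cx(2))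
        moreover have "H \<tau> = f \<tau> (x \<tau>) (cx (y \<tau>)) + \<alpha> * \<bar>v \<tau>\<bar>"
          using H_on[of \<tau>] True x_range[OF \<tau>] good[of \<tau>] by (auto simp: E_def)
        ultimately show ?thesis using av unfolding e_def by linarith
      next
        case False
        then show ?thesis using H_off[OF \<tau>] av ph unfolding e_def by linarith
      qed
    qed
    show "\<bar>y t - y s\<bar> \<le> integral {s..t} (\<lambda>\<tau>. \<bar>\<psi> \<tau>\<bar> * \<phi> (min \<bar>y \<tau>\<bar> N) + \<alpha>\<^sub>0 * \<bar>v \<tau>\<bar>)"
      if st: "0 \<le> s" "s \<le> t" "t \<le> T" for s t
    proof -
      have "\<bar>y t - y s\<bar> = \<bar>\<theta> * (integral {0..t} H - integral {0..s} H)\<bar>"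
        by (simp add: y_def algebra_simps abs_minus_commute)
      also have "\<dots> \<le> 1 * \<bar>integral {0..t} H - integral {0..s} H\<bar>"
        unfolding abs_mult using \<theta> by (intro mult_right_mono) auto
      also have "\<dots> \<le> integral {s..t} e" using integral_abs_increment_le[OF Hi ei He st] by simp
      finally show ?thesis by (simp add: e_def[abs_def])
    qed
  qed
  have Hf: "H t = f t (x t) (y t) + \<alpha> * v t" if "t \<in> {0..T} - Z" for t
  proof -
    have "cx (y t) = y t" using yN[of t] that by (auto simp: cx_def)
    then show ?thesis using H_on[of t] x_range[of t] that by (simp add: E_def)
  qed
  have H_bnd: "\<bar>H t\<bar> \<le> truncated.bnd t" if "t \<in> {0..T}" for t using truncated.rhs_le[OF that \<alpha>] H_eq[OF that] by simp
  \<comment> \<open>Here \<theta> also multiplies the term with \<open>v\<close>. This does no harm: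
    the result is used only with \<alpha> = 0 or with \<theta> = 1, where it is one of the two given
    families.\<close>
  have solution: "is_solution T (\<lambda>t s \<xi>. \<theta> * (f t s \<xi> + \<alpha> * v t)) x"
    by (rule is_solutionI_integral[OF T Hi truncated.bnd(1) H_bnd H0 y_def x_def Z]) (simp_all add: Hf)
  have pos: "\<forall>t\<in>{0<..T}. x t > 0" if "\<alpha> = 0" "max_norm T x > 0"
  proof
    fix t assume t: "t \<in> {0<..T}"
    show "x t > 0"
    proof (rule nonneg_solution_pos[OF T Hi H0 y_def x_def \<theta> x0 int_abs[OF k(1)] _ k(3) _ _ t])
      show "\<bar>H t\<bar> \<le> \<bar>k t\<bar> * (\<bar>x t\<bar> + \<bar>y t\<bar>)" if t: "t \<in> {0..T}" "x t \<le> \<rho>" "\<bar>y t\<bar> \<le> \<rho>" for t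
      proof (cases "t \<in> E")
        case True
        then have "\<bar>H t\<bar> \<le> k t * (\<bar>x t\<bar> + \<bar>y t\<bar>)"
          using good[of t] Hf[of t] t x0[of t] \<open>\<alpha> = 0\<close> by (auto simp: E_def)
        also have "\<dots> \<le> \<bar>k t\<bar> * (\<bar>x t\<bar> + \<bar>y t\<bar>)" by (intro mult_right_mono) auto
        finally show ?thesis .
      next
        case False
        then show ?thesis using H_off[OF t(1)] \<open>\<alpha> = 0\<close> by simp
      qed
      show "\<exists>t\<in>{0..T}. x t \<noteq> 0" using max_norm_attained[OF T cont_x] that(2) by force
    qed auto
  qed
  \<comment> \<open>\<open>hyp_r\<close> excludes norm \<open>r\<close> for positive \<theta> only.
    At \<theta> = 0 the solution is a line of slope \<open>r / T\<close> with vanishing integral,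
    which the sign condition excludes.\<close>
  have not_r: "max_norm T x \<noteq> r" if "\<alpha> = 0"
  proof
    assume mr: "max_norm T x = r"
    show False
    proof (cases "\<theta> = 0")
      case True
      have ya: "y t = a" for t using True by (simp add: y_def)
      have xa: "x t = a * t" if "0 \<le> t" for t using that by (simp add: x_def ya[abs_def])
      have "0 \<le> a" using x0[of T] xa[of T] T by (simp add: zero_le_mult_iff)
      obtain t where t: "t \<in> {0..T}" "max_norm T x = \<bar>x t\<bar>" using max_norm_attained[OF T cont_x] by blast
      then have "r \<le> a * T" using xa[of t] mr \<open>0 \<le> a\<close> by (simp add: abs_mult mult_left_mono)
      moreover have "a * T \<le> r" using x_le[of T] xa[of T] T mr by simp
      ultimately have "a = r / T" using T by (simp add: field_simps)
      then show False using linear True that H0 by simp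
    next
      case False
      then have "0 < \<theta>" "\<theta> \<le> 1" using \<theta> by auto
      then show False using r2[of \<theta> x] solution that pos mr \<open>r > 0\<close> by simp
    qed
  qed
  have solution1: "is_solution T (\<lambda>t s \<xi>. f t s \<xi> + \<alpha> * v t) x" if "\<theta> = 1" using solution that by simp
  have not_R: "max_norm T x \<noteq> R" if "\<theta> = 1"
    using R1[OF \<alpha> solution1[OF that]] x0 by blast
  have not_top: False if "\<theta> = 1" "\<alpha> = \<alpha>\<^sub>0" "max_norm T x \<le> R"
    using R2[of x] solution1[OF that(1)] that x0 x_le by force
  from alt' not_r not_R not_top have *: "\<theta> = 1" "\<alpha> = 0" "min r R \<le> max_norm T x" by auto
  have strict: "min r R < max_norm T x" "max_norm T x < max r R"
    using *(3) xS not_r[OF *(2)] not_R[OF *(1)] unfolding S_def by (auto simp: min_def max_def split: if_splits)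
  have "(SUP t\<in>{0..T}. x t) = max_norm T x"
    unfolding max_norm_def by (rule SUP_cong) (auto simp: x0)
  moreover have "is_solution T f x" using solution1 * by simp
  moreover have "\<forall>t\<in>{0<..T}. x t > 0"
    using pos[OF *(2)] strict(1) \<open>r > 0\<close> \<open>R > 0\<close> by (simp add: min_def split: if_splits)
  ultimately show ?thesis using strict by (intro exI[of _ x]) simp
qed

end
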